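(* Let $\mathsf{p}:P\to M$ be a principal fibre bundle with structure Lie group $G$, $\star$ a star product on $M$, and $\bullet$ a deformation quantization of the principal fibre bundle with respect to $\star$, with a $G$-invariant vertical bimodule structure $(\star',\bullet')$. Let $V$ be a finite dimensional complex representation of $G$, let $E=P\times_GV$, and denote also by $\bullet$ the induced deformation quantization of $E$. Then for all structures $\star'_E$ and $\bullet'_E$ such that $\Gamma^\infty(E)[[\lambda]]$, with left multiplication $\bullet'_E$ and right multiplication $\bullet$, is a deformed bimodule for $(\Gamma^\infty(\mathrm{End}(E))[[\lambda]],\star'_E)$ and $(C^\infty(M)[[\lambda]],\star)$, there exists a surjective algebra homomorphism $$\phi:\big((\mathrm{DiffOp}_{\mathrm{ver}}(P)\otimes\mathrm{End}(V))^G[[\lambda]],\star'\big)\to\big(\Gamma^\infty(\mathrm{End}(E))[[\lambda]],\star'_E\big)$$ such that $D\bullet' s=\phi(D)\bullet'_Es$ for all $D\in(\mathrm{DiffOp}_{\mathrm{ver}}(P)\otimes\mathrm{End}(V))^G[[\lambda]]$ and $s\in\Gamma^\infty(E)[[\lambda]]$.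
   Context: All functions and sections are smooth, functions complex valued; $\lambda$ is a formal parameter; maps are extended $\mathbb{C}[[\lambda]]$-(multi)linearly. The principal right action is $\mathsf{r}_g:P\to P$. $\mathrm{DiffOp}(P)$ is the algebra of differential operators on $C^\infty(P)$ with $G$-action $\mathsf{r}_g^*D=\mathsf{r}_g^*\circ D\circ(\mathsf{r}_g^* )^{-1}$; $\mathrm{DiffOp}_{\mathrm{ver}}(P)$ consists of those $D$ with $D(f\cdot\mathsf{p}^*a)=D(f)\cdot\mathsf{p}^*a$ for all $f\in C^\infty(P)$, $a\in C^\infty(M)$. Star product: an associative $\mathbb{C}[[\lambda]]$-bilinear product $a \star b = \sum_{r\ge0} \lambda^r C_r(a,b)$ on $C^\infty(M)[[\lambda]]$ with $C_0(a,b)=ab$, all $C_r$ bidifferential, $1\star a = a = a\star 1$. Deformation quantization of the principal bundle: a right module structure $\bullet$ of $(C^\infty(M)[[\lambda]],\star)$ on $C^\infty(P)[[\lambda]]$ of the form $f\bullet a = f\cdot \mathsf{p}^*a + \sum_{r\ge1} \lambda^r \rho_r(f,a)$ with bidifferential $\rho_r$ and $\mathsf{r}_g^*(f\bullet a)=(\mathsf{r}_g^*f)\bullet a$. $G$-invariant vertical bimodule structure: a $\mathbb{C}[[\lambda]]$-linear bijection $\rho'=\mathrm{id}+\sum_{r\ge1}\lambda^r\rho'_r$ from $\mathrm{DiffOp}_{\mathrm{ver}}(P)[[\lambda]]$ onto $\{D\in\mathrm{DiffOp}(P)[[\lambda]]:D(f\bullet a)=D(f)\bullet a\ \forall f,a\}$,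 with $A\bullet'f=\rho'(A)f$ and $A\star'B=\rho'^{-1}(\rho'(A)\circ\rho'(B))$, such that $\mathsf{r}_g^*(A\star'B)=\mathsf{r}_g^*A\star'\mathsf{r}_g^*B$ and $\mathsf{r}_g^*(A\bullet'f)=\mathsf{r}_g^*A\bullet'\mathsf{r}_g^*f$. (Such a structure always exists.) Associated bundle: $\pi:G\to\mathrm{End}(V)$ is the representation; $\Gamma^\infty(P\times_GV)\cong(C^\infty(P)\otimes V)^G$, invariants under $\mathsf{r}_g^*\otimes\pi(g)$. The corresponding $G$-action is used on $\mathrm{DiffOp}_{\mathrm{ver}}(P)\otimes\mathrm{End}(V)$ (conjugation by $\pi(g)$ on $\mathrm{End}(V)$). The structures extend by $(h\otimes w)\bullet a=(h\bullet a)\otimes w$, $(A\otimes L)\bullet'(h\otimes w)=(A\bullet'h)\otimes L(w)$, $(A\otimes L)\star'(B\otimes K)=(A\star'B)\otimes LK$, and restrict to $G$-invariant elements; via the isomorphism $\Gamma^\infty(P\times_GV)\cong(C^\infty(P)\otimes V)^G$ this gives the right module structure $\bullet$ (the induced deformation quantization of $E$) and the left module structure $\bullet'$ on $\Gamma^\infty(E)[[\lambda]]$. Deformed bimodule: $\star'_E$ is an associative $\mathbb{C}[[\lambda]]$-bilinear product on $\Gamma^\infty(\mathrm{End}(E))[[\lambda]]$ deforming the pointwise composition, and $\bullet'_E$ is a left module structure of $(\Gamma^\infty(\mathrm{End}(E))[[\lambda]],\star'_E)$ on $\Gamma^\infty(E)[[\lambda]]$ deforming the pointwise action and commuting with $\bullet$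 ("deforming" means equal to the classical structure in order $\lambda^0$). *)

theory Defs
  imports "HOL-Analysis.Analysis" "HOL-Algebra.Module"
begin

section \<open>Smooth manifolds\<close>

text \<open>
  The underlying space of a manifold is a whole type, with the topology given by its type class.
  Charts take values in a real inner product space that is required to be finite dimensional in
  \<open>manifold\<close>. The class \<open>euclidean_space\<close> is not used because it excludes
  dimension zero, hence discrete structure groups.
\<close>

type_synonym ('a, 'e) atlas = "('a set \<times> ('a \<Rightarrow> 'e)) set"

text \<open>\<open>Ck_on k S f\<close> is meant for open \<open>S\<close>; the derivatives are taken
  in constant directions, which in finite dimensions amounts to the usual notion of \<open>k\<close>
  times continuously differentiable.\<close>

primrec Ck_on ::
  "nat \<Rightarrow> 'e::real_normed_vector set \<Rightarrow> ('e \<Rightarrow> 'f::real_normed_vector) \<Rightarrow> bool" where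
  "Ck_on 0 S f \<longleftrightarrow> continuous_on S f"
| "Ck_on (Suc k) S f \<longleftrightarrow> (\<forall>x\<in>S. f differentiable (at x)) \<and>
     (\<forall>v. Ck_on k S (\<lambda>x. frechet_derivative f (at x) v))"

definition smooth_on ::
  "'e::real_normed_vector set \<Rightarrow> ('e \<Rightarrow> 'f::real_normed_vector) \<Rightarrow> bool" where
  "smooth_on S f \<longleftrightarrow> (\<forall>k. Ck_on k S f)"

definition manifold ::
  "('a::{t2_space,second_countable_topology}, 'e::real_inner) atlas \<Rightarrow> bool" where
  "manifold A \<longleftrightarrow>
     (\<exists>B::'e set. finite B \<and> span B = UNIV) \<and>
     (\<Union>(U, \<phi>)\<in>A. U) = UNIV \<and>
     (\<forall>(U, \<phi>)\<in>A. open U \<and> open (\<phi> ` U) \<and> (\<exists>\<psi>. homeomorphism U (\<phi> ` U) \<phi> \<psi>)) \<and>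
     (\<forall>(U, \<phi>)\<in>A. \<forall>(W, \<psi>)\<in>A. smooth_on (\<phi> ` (U \<inter> W)) (\<psi> \<circ> inv_into U \<phi>))"

definition smooth_map_on ::
  "'a::topological_space set \<Rightarrow> ('a, 'e::real_normed_vector) atlas \<Rightarrow>
   ('b::topological_space, 'f::real_normed_vector) atlas \<Rightarrow> ('a \<Rightarrow> 'b) \<Rightarrow> bool" where
  "smooth_map_on S A B f \<longleftrightarrow>
     continuous_on S f \<and>
     (\<forall>(U, \<phi>)\<in>A. \<forall>(W, \<psi>)\<in>B.
        smooth_on (\<phi> ` (U \<inter> S \<inter> f -` W)) (\<psi> \<circ> f \<circ> inv_into U \<phi>))"

definition prod_atlas ::
  "('a, 'e) atlas \<Rightarrow> ('b, 'f) atlas \<Rightarrow> ('a \<times> 'b, 'e \<times> 'f) atlas" where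
  "prod_atlas A B = {(U \<times> W, map_prod \<phi> \<psi>) |U \<phi> W \<psi>. (U, \<phi>) \<in> A \<and> (W, \<psi>) \<in> B}"

definition std_atlas :: "('a, 'a) atlas" where
  "std_atlas = {(UNIV, id)}"

text \<open>The algebra of complex valued smooth functions.\<close>

definition smooth_fns ::
  "('a::topological_space, 'e::real_normed_vector) atlas \<Rightarrow> (complex, 'a \<Rightarrow> complex) module" where
  "smooth_fns A =
     \<lparr>carrier = {f. smooth_map_on UNIV A std_atlas f},
      mult = (\<lambda>f g x. f x * g x), one = (\<lambda>x. 1),
      zero = (\<lambda>x. 0), add = (\<lambda>f g x. f x + g x),
      smult = (\<lambda>c f x. c * f x)\<rparr>"


section \<open>Principal fibre bundles\<close>

definition lie_group ::
  "('g::{t2_space,second_countable_topology}) monoid \<Rightarrow> ('g, 'e::real_inner) atlas \<Rightarrow> bool" where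
  "lie_group G A \<longleftrightarrow>
     group G \<and> carrier G = UNIV \<and> manifold A \<and>
     smooth_map_on UNIV (prod_atlas A A) A (\<lambda>(g, h). g \<otimes>\<^bsub>G\<^esub> h) \<and>
     smooth_map_on UNIV A A (\<lambda>g. inv\<^bsub>G\<^esub> g)"

record ('p, 'm, 'g, 'ep, 'em, 'eg) pfb =
  tot :: "('p, 'ep) atlas"
  base :: "('m, 'em) atlas"
  grp :: "'g monoid"
  grp_atlas :: "('g, 'eg) atlas"
  act :: "'p \<Rightarrow> 'g \<Rightarrow> 'p"
  proj :: "'p \<Rightarrow> 'm"

definition local_trivialization ::
  "('p::topological_space, 'm::topological_space, 'g::topological_space,
    'ep::real_normed_vector, 'em::real_normed_vector, 'eg::real_normed_vector) pfb \<Rightarrow>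
   'm set \<Rightarrow> ('p \<Rightarrow> 'm \<times> 'g) \<Rightarrow> bool" where
  "local_trivialization PB U \<Theta> \<longleftrightarrow>
     open U \<and> bij_betw \<Theta> (proj PB -` U) (U \<times> UNIV) \<and>
     smooth_map_on (proj PB -` U) (tot PB) (prod_atlas (base PB) (grp_atlas PB)) \<Theta> \<and>
     smooth_map_on (U \<times> UNIV) (prod_atlas (base PB) (grp_atlas PB)) (tot PB)
       (inv_into (proj PB -` U) \<Theta>) \<and>
     (\<forall>q \<in> proj PB -` U. fst (\<Theta> q) = proj PB q \<and>
        (\<forall>g. \<Theta> (act PB q g) = (proj PB q, snd (\<Theta> q) \<otimes>\<^bsub>grp PB\<^esub> g)))"

definition principal_bundle ::
  "('p::{t2_space,second_countable_topology}, 'm::{t2_space,second_countable_topology},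
    'g::{t2_space,second_countable_topology},
    'ep::real_inner, 'em::real_inner, 'eg::real_inner) pfb \<Rightarrow> bool" where
  "principal_bundle PB \<longleftrightarrow>
     manifold (tot PB) \<and> manifold (base PB) \<and> lie_group (grp PB) (grp_atlas PB) \<and>
     smooth_map_on UNIV (tot PB) (base PB) (proj PB) \<and>
     smooth_map_on UNIV (prod_atlas (tot PB) (grp_atlas PB)) (tot PB) (\<lambda>(q, g). act PB q g) \<and>
     (\<forall>q. act PB q \<one>\<^bsub>grp PB\<^esub> = q) \<and>
     (\<forall>q g h. act PB (act PB q g) h = act PB q (g \<otimes>\<^bsub>grp PB\<^esub> h)) \<and>
     (\<forall>q g. proj PB (act PB q g) = proj PB q) \<and>
     (\<forall>m. \<exists>U \<Theta>. m \<in> U \<and> local_trivialization PB U \<Theta>)"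

definition local_section ::
  "('p::topological_space, 'm::topological_space, 'g, 'ep::real_normed_vector,
    'em::real_normed_vector, 'eg) pfb \<Rightarrow> 'm set \<Rightarrow> ('m \<Rightarrow> 'p) \<Rightarrow> bool" where
  "local_section PB U \<sigma> \<longleftrightarrow>
     open U \<and> smooth_map_on U (base PB) (tot PB) \<sigma> \<and> (\<forall>m\<in>U. proj PB (\<sigma> m) = m)"

definition pull_fun ::
  "('p, 'm, 'g, 'ep, 'em, 'eg) pfb \<Rightarrow> 'g \<Rightarrow> ('p \<Rightarrow> 'x) \<Rightarrow> 'p \<Rightarrow> 'x" where
  "pull_fun PB g f = (\<lambda>q. f (act PB q g))"

definition pull_op ::
  "('p, 'm, 'g, 'ep, 'em, 'eg) pfb \<Rightarrow> 'g \<Rightarrow>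
   (('p \<Rightarrow> complex) \<Rightarrow> 'p \<Rightarrow> complex) \<Rightarrow> ('p \<Rightarrow> complex) \<Rightarrow> 'p \<Rightarrow> complex" where
  "pull_op PB g D = pull_fun PB g \<circ> D \<circ> pull_fun PB (inv\<^bsub>grp PB\<^esub> g)"


section \<open>Linear maps and formal power series\<close>

text \<open>
  Modules are \<open>module\<close> records of HOL-Algebra whose scalars form a whole type: complex
  numbers for the classical objects, \<open>complex fps\<close> for the formal power series in
  \<open>\<lambda>\<close>. Modules without a product have \<open>mult\<close> and \<open>one\<close>
  set to \<open>undefined\<close>.
\<close>

definition linear_map ::
  "('r, 'a) module \<Rightarrow> ('r, 'b) module \<Rightarrow> ('a \<Rightarrow> 'b) \<Rightarrow> bool" where
  "linear_map M N T \<longleftrightarrow>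
     T \<in> carrier M \<rightarrow> carrier N \<and>
     (\<forall>x\<in>carrier M. \<forall>y\<in>carrier M. T (x \<oplus>\<^bsub>M\<^esub> y) = T x \<oplus>\<^bsub>N\<^esub> T y) \<and>
     (\<forall>c. \<forall>x\<in>carrier M. T (c \<odot>\<^bsub>M\<^esub> x) = c \<odot>\<^bsub>N\<^esub> T x)"

definition bilinear_map ::
  "('r, 'a) module \<Rightarrow> ('r, 'b) module \<Rightarrow> ('r, 'c) module \<Rightarrow> ('a \<Rightarrow> 'b \<Rightarrow> 'c) \<Rightarrow> bool" where
  "bilinear_map L M N B \<longleftrightarrow>
     (\<forall>y\<in>carrier M. linear_map L N (\<lambda>x. B x y)) \<and> (\<forall>x\<in>carrier L. linear_map M N (B x))"

definition series :: "(complex, 'a) module \<Rightarrow> (complex fps, 'a fps) module" where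
  "series M =
     \<lparr>carrier = {x. \<forall>n. fps_nth x n \<in> carrier M},
      mult = (\<lambda>x y. Abs_fps (\<lambda>n. \<Oplus>\<^bsub>M\<^esub>i\<in>{..n}. fps_nth x i \<otimes>\<^bsub>M\<^esub> fps_nth y (n - i))),
      one = Abs_fps (\<lambda>n. if n = 0 then \<one>\<^bsub>M\<^esub> else \<zero>\<^bsub>M\<^esub>),
      zero = Abs_fps (\<lambda>n. \<zero>\<^bsub>M\<^esub>),
      add = (\<lambda>x y. Abs_fps (\<lambda>n. fps_nth x n \<oplus>\<^bsub>M\<^esub> fps_nth y n)),
      smult = (\<lambda>c x. Abs_fps (\<lambda>n. \<Oplus>\<^bsub>M\<^esub>i\<in>{..n}. fps_nth c i \<odot>\<^bsub>M\<^esub> fps_nth x (n - i)))\<rparr>"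

text \<open>The extensions to formal power series of \<open>\<Sum>r. \<lambda>^r T r\<close> and
  \<open>\<Sum>r. \<lambda>^r C r\<close>, where \<open>T r\<close> is linear and \<open>C r\<close>
  bilinear with values in \<open>N\<close>.\<close>

definition lin_series ::
  "(complex, 'b) module \<Rightarrow> (nat \<Rightarrow> 'a \<Rightarrow> 'b) \<Rightarrow> 'a fps \<Rightarrow> 'b fps" where
  "lin_series N T x = Abs_fps (\<lambda>n. \<Oplus>\<^bsub>N\<^esub>r\<in>{..n}. T r (fps_nth x (n - r)))"

definition bilin_series ::
  "(complex, 'c) module \<Rightarrow> (nat \<Rightarrow> 'a \<Rightarrow> 'b \<Rightarrow> 'c) \<Rightarrow> 'a fps \<Rightarrow> 'b fps \<Rightarrow> 'c fps" where
  "bilin_series N C x y = Abs_fps (\<lambda>n.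
     finsum N (\<lambda>(r, i, j). C r (fps_nth x i) (fps_nth y j)) {(r, i, j). r + i + j = n})"

definition coeffwise :: "('a \<Rightarrow> 'b) \<Rightarrow> 'a fps \<Rightarrow> 'b fps" where
  "coeffwise F x = Abs_fps (\<lambda>n. F (fps_nth x n))"


section \<open>Differential operators\<close>

text \<open>
  Algebraic definition: an operator has order at most \<open>0\<close> if it commutes with
  multiplications by functions in \<open>F\<close>, and order at most \<open>Suc k\<close> if all its
  commutators with them have order at most \<open>k\<close>. The target is a module over \<open>F\<close>
  by pullback along \<open>\<pi>\<close>.
\<close>

primrec diff_order ::
  "('y \<Rightarrow> 'x) \<Rightarrow> ('x \<Rightarrow> complex) set \<Rightarrow> nat \<Rightarrow>
   (('x \<Rightarrow> complex) \<Rightarrow> 'y \<Rightarrow> complex) \<Rightarrow> bool" where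
  "diff_order \<pi> F 0 D \<longleftrightarrow>
     (\<forall>a\<in>F. \<forall>f\<in>F. D (\<lambda>x. a x * f x) = (\<lambda>y. a (\<pi> y) * D f y))"
| "diff_order \<pi> F (Suc k) D \<longleftrightarrow>
     (\<forall>a\<in>F. diff_order \<pi> F k (\<lambda>f y. D (\<lambda>x. a x * f x) y - a (\<pi> y) * D f y))"

definition bidifferential ::
  "('x::topological_space, 'ex::real_normed_vector) atlas \<Rightarrow>
   ('z::topological_space, 'ez::real_normed_vector) atlas \<Rightarrow>
   ('y::topological_space, 'ey::real_normed_vector) atlas \<Rightarrow>
   ('y \<Rightarrow> 'x) \<Rightarrow> ('y \<Rightarrow> 'z) \<Rightarrow>
   (('x \<Rightarrow> complex) \<Rightarrow> ('z \<Rightarrow> complex) \<Rightarrow> 'y \<Rightarrow> complex) \<Rightarrow> bool" where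
  "bidifferential X Z Y \<pi> \<tau> B \<longleftrightarrow>
     bilinear_map (smooth_fns X) (smooth_fns Z) (smooth_fns Y) B \<and>
     (\<exists>k l. (\<forall>h\<in>carrier (smooth_fns Z). diff_order \<pi> (carrier (smooth_fns X)) k (\<lambda>f. B f h)) \<and>
            (\<forall>f\<in>carrier (smooth_fns X). diff_order \<tau> (carrier (smooth_fns Z)) l (B f)))"

text \<open>Operators on smooth functions are extended by zero to all functions, so that equality of
  operators is equality of HOL functions.\<close>

definition diff_ops ::
  "('a::topological_space, 'e::real_normed_vector) atlas \<Rightarrow>
   (complex, ('a \<Rightarrow> complex) \<Rightarrow> 'a \<Rightarrow> complex) module" where
  "diff_ops A =
     \<lparr>carrier = {D. linear_map (smooth_fns A) (smooth_fns A) D \<and>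
                    (\<exists>k. diff_order id (carrier (smooth_fns A)) k D) \<and>
                    (\<forall>f. f \<notin> carrier (smooth_fns A) \<longrightarrow> D f = (\<lambda>x. 0))},
      mult = (\<circ>),
      one = (\<lambda>f. if f \<in> carrier (smooth_fns A) then f else (\<lambda>x. 0)),
      zero = (\<lambda>f x. 0), add = (\<lambda>D E f x. D f x + E f x),
      smult = (\<lambda>c D f x. c * D f x)\<rparr>"

definition ver_ops ::
  "('p::topological_space, 'm::topological_space, 'g, 'ep::real_normed_vector,
    'em::real_normed_vector, 'eg) pfb \<Rightarrow>
   (complex, ('p \<Rightarrow> complex) \<Rightarrow> 'p \<Rightarrow> complex) module" where
  "ver_ops PB = diff_ops (tot PB)
     \<lparr>carrier := {D \<in> carrier (diff_ops (tot PB)).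
        \<forall>f\<in>carrier (smooth_fns (tot PB)). \<forall>a\<in>carrier (smooth_fns (base PB)).
          D (\<lambda>q. f q * a (proj PB q)) = (\<lambda>q. D f q * a (proj PB q))}\<rparr>"


section \<open>Star products and deformation quantization of principal bundles\<close>

definition star ::
  "('m::topological_space, 'em::real_normed_vector) atlas \<Rightarrow>
   (nat \<Rightarrow> ('m \<Rightarrow> complex) \<Rightarrow> ('m \<Rightarrow> complex) \<Rightarrow> 'm \<Rightarrow> complex) \<Rightarrow>
   ('m \<Rightarrow> complex) fps \<Rightarrow> ('m \<Rightarrow> complex) fps \<Rightarrow> ('m \<Rightarrow> complex) fps" where
  "star A C = bilin_series (smooth_fns A) C"

definition star_product ::
  "('m::topological_space, 'em::real_normed_vector) atlas \<Rightarrow>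
   (nat \<Rightarrow> ('m \<Rightarrow> complex) \<Rightarrow> ('m \<Rightarrow> complex) \<Rightarrow> 'm \<Rightarrow> complex) \<Rightarrow> bool" where
  "star_product A C \<longleftrightarrow>
     (\<forall>r. bidifferential A A A id id (C r)) \<and>
     (\<forall>a\<in>carrier (smooth_fns A). \<forall>b\<in>carrier (smooth_fns A). C 0 a b = (\<lambda>x. a x * b x)) \<and>
     (\<forall>a\<in>carrier (series (smooth_fns A)). \<forall>b\<in>carrier (series (smooth_fns A)).
        \<forall>c\<in>carrier (series (smooth_fns A)).
          star A C (star A C a b) c = star A C a (star A C b c)) \<and>
     (\<forall>a\<in>carrier (series (smooth_fns A)).
        star A C \<one>\<^bsub>series (smooth_fns A)\<^esub> a = a \<and> star A C a \<one>\<^bsub>series (smooth_fns A)\<^esub> = a)"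

definition rmod ::
  "('p::topological_space, 'm, 'g, 'ep::real_normed_vector, 'em, 'eg) pfb \<Rightarrow>
   (nat \<Rightarrow> ('p \<Rightarrow> complex) \<Rightarrow> ('m \<Rightarrow> complex) \<Rightarrow> 'p \<Rightarrow> complex) \<Rightarrow>
   ('p \<Rightarrow> complex) fps \<Rightarrow> ('m \<Rightarrow> complex) fps \<Rightarrow> ('p \<Rightarrow> complex) fps" where
  "rmod PB \<rho> = bilin_series (smooth_fns (tot PB)) \<rho>"

text \<open>Unitality of the module is automatic: the map \<open>f \<mapsto> f \<bullet> 1\<close> is idempotent, and
  invertible because it is the identity in lowest order.\<close>

definition bundle_quantization ::
  "('p::topological_space, 'm::topological_space, 'g, 'ep::real_normed_vector,
    'em::real_normed_vector, 'eg) pfb \<Rightarrow>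
   (nat \<Rightarrow> ('m \<Rightarrow> complex) \<Rightarrow> ('m \<Rightarrow> complex) \<Rightarrow> 'm \<Rightarrow> complex) \<Rightarrow>
   (nat \<Rightarrow> ('p \<Rightarrow> complex) \<Rightarrow> ('m \<Rightarrow> complex) \<Rightarrow> 'p \<Rightarrow> complex) \<Rightarrow> bool" where
  "bundle_quantization PB C \<rho> \<longleftrightarrow>
     (\<forall>r. bidifferential (tot PB) (base PB) (tot PB) id (proj PB) (\<rho> r)) \<and>
     (\<forall>f\<in>carrier (smooth_fns (tot PB)). \<forall>a\<in>carrier (smooth_fns (base PB)).
        \<rho> 0 f a = (\<lambda>q. f q * a (proj PB q))) \<and>
     (\<forall>f\<in>carrier (series (smooth_fns (tot PB))). \<forall>a\<in>carrier (series (smooth_fns (base PB))).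
        \<forall>b\<in>carrier (series (smooth_fns (base PB))).
          rmod PB \<rho> (rmod PB \<rho> f a) b = rmod PB \<rho> f (star (base PB) C a b)) \<and>
     (\<forall>g. \<forall>f\<in>carrier (series (smooth_fns (tot PB))).
        \<forall>a\<in>carrier (series (smooth_fns (base PB))).
          coeffwise (pull_fun PB g) (rmod PB \<rho> f a) = rmod PB \<rho> (coeffwise (pull_fun PB g) f) a)"

text \<open>The action of a formal power series of operators.\<close>

definition op_apply ::
  "('p::topological_space, 'm, 'g, 'ep::real_normed_vector, 'em, 'eg) pfb \<Rightarrow>
   (('p \<Rightarrow> complex) \<Rightarrow> 'p \<Rightarrow> complex) fps \<Rightarrow> ('p \<Rightarrow> complex) fps \<Rightarrow> ('p \<Rightarrow> complex) fps" where
  "op_apply PB D = lin_series (smooth_fns (tot PB)) (fps_nth D)"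

definition commutant ::
  "('p::topological_space, 'm::topological_space, 'g, 'ep::real_normed_vector,
    'em::real_normed_vector, 'eg) pfb \<Rightarrow>
   (nat \<Rightarrow> ('p \<Rightarrow> complex) \<Rightarrow> ('m \<Rightarrow> complex) \<Rightarrow> 'p \<Rightarrow> complex) \<Rightarrow>
   (('p \<Rightarrow> complex) \<Rightarrow> 'p \<Rightarrow> complex) fps set" where
  "commutant PB \<rho> = {D \<in> carrier (series (diff_ops (tot PB))).
     \<forall>f\<in>carrier (series (smooth_fns (tot PB))). \<forall>a\<in>carrier (series (smooth_fns (base PB))).
       op_apply PB D (rmod PB \<rho> f a) = rmod PB \<rho> (op_apply PB D f) a}"

text \<open>The map \<open>\<rho>'\<close>, the left action \<open>\<bullet>'\<close> and the product \<open>\<star>'\<close>; here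
  \<open>Q r\<close> is the coefficient of \<open>\<lambda>^r\<close> in \<open>\<rho>'\<close>.\<close>

definition qmap ::
  "('p::topological_space, 'm, 'g, 'ep::real_normed_vector, 'em, 'eg) pfb \<Rightarrow>
   (nat \<Rightarrow> (('p \<Rightarrow> complex) \<Rightarrow> 'p \<Rightarrow> complex) \<Rightarrow> ('p \<Rightarrow> complex) \<Rightarrow> 'p \<Rightarrow> complex) \<Rightarrow>
   (('p \<Rightarrow> complex) \<Rightarrow> 'p \<Rightarrow> complex) fps \<Rightarrow> (('p \<Rightarrow> complex) \<Rightarrow> 'p \<Rightarrow> complex) fps" where
  "qmap PB Q = lin_series (diff_ops (tot PB)) Q"

definition ver_lmod ::
  "('p::topological_space, 'm, 'g, 'ep::real_normed_vector, 'em, 'eg) pfb \<Rightarrow>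
   (nat \<Rightarrow> (('p \<Rightarrow> complex) \<Rightarrow> 'p \<Rightarrow> complex) \<Rightarrow> ('p \<Rightarrow> complex) \<Rightarrow> 'p \<Rightarrow> complex) \<Rightarrow>
   (('p \<Rightarrow> complex) \<Rightarrow> 'p \<Rightarrow> complex) fps \<Rightarrow> ('p \<Rightarrow> complex) fps \<Rightarrow> ('p \<Rightarrow> complex) fps" where
  "ver_lmod PB Q A f = op_apply PB (qmap PB Q A) f"

definition ver_star ::
  "('p::topological_space, 'm::topological_space, 'g, 'ep::real_normed_vector,
    'em::real_normed_vector, 'eg) pfb \<Rightarrow>
   (nat \<Rightarrow> (('p \<Rightarrow> complex) \<Rightarrow> 'p \<Rightarrow> complex) \<Rightarrow> ('p \<Rightarrow> complex) \<Rightarrow> 'p \<Rightarrow> complex) \<Rightarrow>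
   (('p \<Rightarrow> complex) \<Rightarrow> 'p \<Rightarrow> complex) fps \<Rightarrow> (('p \<Rightarrow> complex) \<Rightarrow> 'p \<Rightarrow> complex) fps \<Rightarrow>
   (('p \<Rightarrow> complex) \<Rightarrow> 'p \<Rightarrow> complex) fps" where
  "ver_star PB Q A B = inv_into (carrier (series (ver_ops PB))) (qmap PB Q)
     (qmap PB Q A \<otimes>\<^bsub>series (diff_ops (tot PB))\<^esub> qmap PB Q B)"

definition vertical_bimodule ::
  "('p::topological_space, 'm::topological_space, 'g, 'ep::real_normed_vector,
    'em::real_normed_vector, 'eg) pfb \<Rightarrow>
   (nat \<Rightarrow> ('p \<Rightarrow> complex) \<Rightarrow> ('m \<Rightarrow> complex) \<Rightarrow> 'p \<Rightarrow> complex) \<Rightarrow>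
   (nat \<Rightarrow> (('p \<Rightarrow> complex) \<Rightarrow> 'p \<Rightarrow> complex) \<Rightarrow> ('p \<Rightarrow> complex) \<Rightarrow> 'p \<Rightarrow> complex) \<Rightarrow>
   bool" where
  "vertical_bimodule PB \<rho> Q \<longleftrightarrow>
     (\<forall>r. linear_map (ver_ops PB) (diff_ops (tot PB)) (Q r)) \<and>
     (\<forall>A\<in>carrier (ver_ops PB). Q 0 A = A) \<and>
     bij_betw (qmap PB Q) (carrier (series (ver_ops PB))) (commutant PB \<rho>) \<and>
     (\<forall>g. \<forall>A\<in>carrier (series (ver_ops PB)). \<forall>B\<in>carrier (series (ver_ops PB)).
        coeffwise (pull_op PB g) (ver_star PB Q A B) =
        ver_star PB Q (coeffwise (pull_op PB g) A) (coeffwise (pull_op PB g) B)) \<and>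
     (\<forall>g. \<forall>A\<in>carrier (series (ver_ops PB)). \<forall>f\<in>carrier (series (smooth_fns (tot PB))).
        coeffwise (pull_fun PB g) (ver_lmod PB Q A f) =
        ver_lmod PB Q (coeffwise (pull_op PB g) A) (coeffwise (pull_fun PB g) f))"


section \<open>Representations and associated vector bundles\<close>

text \<open>A complex vector space with scalar multiplication \<open>scl\<close> and a finite basis
  \<open>bas\<close>, acted on by \<open>rep\<close>. None of the notions below depends on the basis.\<close>

record ('g, 'v) grep =
  scl :: "complex \<Rightarrow> 'v \<Rightarrow> 'v"
  bas :: "'v set"
  rep :: "'g \<Rightarrow> 'v \<Rightarrow> 'v"

definition vcoord :: "('g, 'v::ab_group_add) grep \<Rightarrow> 'v \<Rightarrow> 'v \<Rightarrow> complex" where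
  "vcoord R b v = Modules.module.representation (scl R) (bas R) v b"

definition representation_of ::
  "('p, 'm, 'g::topological_space, 'ep, 'em, 'eg::real_normed_vector) pfb \<Rightarrow>
   ('g, 'v::ab_group_add) grep \<Rightarrow> bool" where
  "representation_of PB R \<longleftrightarrow>
     finite_dimensional_vector_space (scl R) (bas R) \<and>
     (\<forall>g. Vector_Spaces.linear (scl R) (scl R) (rep R g)) \<and>
     rep R \<one>\<^bsub>grp PB\<^esub> = id \<and>
     (\<forall>g h. rep R (g \<otimes>\<^bsub>grp PB\<^esub> h) = rep R g \<circ> rep R h) \<and>
     (\<forall>v. \<forall>b\<in>bas R. smooth_map_on UNIV (grp_atlas PB) std_atlas (\<lambda>g. vcoord R b (rep R g v)))"

text \<open>The point \<open>[q, v]\<close> of the associated bundle, i.e. the orbit of \<open>(q, v)\<close> under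
  the action \<open>(q, v) \<mapsto> (q g, \<pi>(g)\<inverse> v)\<close>, and the vector \<open>v\<close> with
  \<open>e = [q, v]\<close>.\<close>

definition assoc_pt ::
  "('p, 'm, 'g, 'ep, 'em, 'eg) pfb \<Rightarrow> ('g, 'v) grep \<Rightarrow> 'p \<Rightarrow> 'v \<Rightarrow> ('p \<times> 'v) set" where
  "assoc_pt PB R q v = range (\<lambda>g. (act PB q g, rep R (inv\<^bsub>grp PB\<^esub> g) v))"

definition fib_vec ::
  "('p, 'm, 'g, 'ep, 'em, 'eg) pfb \<Rightarrow> ('g, 'v) grep \<Rightarrow> 'p \<Rightarrow> ('p \<times> 'v) set \<Rightarrow> 'v" where
  "fib_vec PB R q e = (THE v. e = assoc_pt PB R q v)"

definition some_lift :: "('p, 'm, 'g, 'ep, 'em, 'eg) pfb \<Rightarrow> 'm \<Rightarrow> 'p" where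
  "some_lift PB m = (SOME q. proj PB q = m)"

text \<open>The fibre of \<open>E = P \<times>\<^sub>G V\<close> over \<open>m\<close>, with the vector space structure making
  \<open>v \<mapsto> [q, v]\<close> linear for one, equivalently every, \<open>q\<close> over \<open>m\<close>.\<close>

definition fibre ::
  "('p, 'm, 'g, 'ep, 'em, 'eg) pfb \<Rightarrow> ('g, 'v::ab_group_add) grep \<Rightarrow> 'm \<Rightarrow>
   (complex, ('p \<times> 'v) set) module" where
  "fibre PB R m = (let q = some_lift PB m in
     \<lparr>carrier = {assoc_pt PB R p v |p v. proj PB p = m},
      mult = undefined, one = undefined,
      zero = assoc_pt PB R q 0,
      add = (\<lambda>e f. assoc_pt PB R q (fib_vec PB R q e + fib_vec PB R q f)),
      smult = (\<lambda>c e. assoc_pt PB R q (scl R c (fib_vec PB R q e)))\<rparr>)"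

text \<open>The smooth structure of \<open>E\<close> is the one for which every local section \<open>\<sigma>\<close>
  of \<open>P\<close> over \<open>U\<close> yields a local trivialization
  \<open>(m, v) \<mapsto> [\<sigma>(m), v]\<close> over \<open>U\<close>. Smoothness of sections of \<open>E\<close> and
  of \<open>End(E)\<close> is smoothness in these trivializations.\<close>

definition sections ::
  "('p::topological_space, 'm::topological_space, 'g, 'ep::real_normed_vector,
    'em::real_normed_vector, 'eg) pfb \<Rightarrow> ('g, 'v::ab_group_add) grep \<Rightarrow>
   (complex, 'm \<Rightarrow> ('p \<times> 'v) set) module" where
  "sections PB R =
     \<lparr>carrier = {s. (\<forall>m. s m \<in> carrier (fibre PB R m)) \<and>
        (\<forall>U \<sigma>. \<forall>b\<in>bas R. local_section PB U \<sigma> \<longrightarrow>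
           smooth_map_on U (base PB) std_atlas (\<lambda>m. vcoord R b (fib_vec PB R (\<sigma> m) (s m))))},
      mult = undefined, one = undefined,
      zero = (\<lambda>m. \<zero>\<^bsub>fibre PB R m\<^esub>),
      add = (\<lambda>s t m. s m \<oplus>\<^bsub>fibre PB R m\<^esub> t m),
      smult = (\<lambda>c s m. c \<odot>\<^bsub>fibre PB R m\<^esub> s m)\<rparr>"

definition end_sections ::
  "('p::topological_space, 'm::topological_space, 'g, 'ep::real_normed_vector,
    'em::real_normed_vector, 'eg) pfb \<Rightarrow> ('g, 'v::ab_group_add) grep \<Rightarrow>
   (complex, 'm \<Rightarrow> ('p \<times> 'v) set \<Rightarrow> ('p \<times> 'v) set) module" where
  "end_sections PB R =
     \<lparr>carrier = {A. (\<forall>m. linear_map (fibre PB R m) (fibre PB R m) (A m) \<and>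
                         A m \<in> extensional (carrier (fibre PB R m))) \<and>
        (\<forall>U \<sigma>. \<forall>b\<in>bas R. \<forall>c\<in>bas R. local_section PB U \<sigma> \<longrightarrow>
           smooth_map_on U (base PB) std_atlas
             (\<lambda>m. vcoord R b (fib_vec PB R (\<sigma> m) (A m (assoc_pt PB R (\<sigma> m) c)))))},
      mult = (\<lambda>A B m. compose (carrier (fibre PB R m)) (A m) (B m)),
      one = (\<lambda>m. \<lambda>e\<in>carrier (fibre PB R m). e),
      zero = (\<lambda>m. \<lambda>e\<in>carrier (fibre PB R m). \<zero>\<^bsub>fibre PB R m\<^esub>),
      add = (\<lambda>A B m. \<lambda>e\<in>carrier (fibre PB R m). A m e \<oplus>\<^bsub>fibre PB R m\<^esub> B m e),
      smult = (\<lambda>c A m. \<lambda>e\<in>carrier (fibre PB R m). c \<odot>\<^bsub>fibre PB R m\<^esub> A m e)\<rparr>"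

text \<open>The isomorphism between sections of \<open>E\<close> and \<open>G\<close>-invariant elements of
  \<open>C\<^sup>\<infinity>(P) \<otimes> V\<close>, the latter being functions from \<open>P\<close> to \<open>V\<close>, and its inverse.\<close>

definition sec_to_fun ::
  "('p, 'm, 'g, 'ep, 'em, 'eg) pfb \<Rightarrow> ('g, 'v) grep \<Rightarrow> ('m \<Rightarrow> ('p \<times> 'v) set) \<Rightarrow> 'p \<Rightarrow> 'v" where
  "sec_to_fun PB R s = (\<lambda>q. fib_vec PB R q (s (proj PB q)))"

definition fun_to_sec ::
  "('p, 'm, 'g, 'ep, 'em, 'eg) pfb \<Rightarrow> ('g, 'v) grep \<Rightarrow> ('p \<Rightarrow> 'v) \<Rightarrow> 'm \<Rightarrow> ('p \<times> 'v) set" where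
  "fun_to_sec PB R s = (\<lambda>m. assoc_pt PB R (some_lift PB m) (s (some_lift PB m)))"


section \<open>Extension of the structures to tensor products and to sections\<close>

text \<open>\<open>C\<^sup>\<infinity>(P) \<otimes> V\<close> is realized as the space of smooth functions \<open>P \<rightarrow> V\<close>.\<close>

definition vfns ::
  "('p::topological_space, 'm, 'g, 'ep::real_normed_vector, 'em, 'eg) pfb \<Rightarrow>
   ('g, 'v::ab_group_add) grep \<Rightarrow> ('p \<Rightarrow> 'v) set" where
  "vfns PB R = {s. \<forall>b\<in>bas R. (\<lambda>q. vcoord R b (s q)) \<in> carrier (smooth_fns (tot PB))}"

text \<open>\<open>A \<otimes> L\<close> as an operator on \<open>C\<^sup>\<infinity>(P) \<otimes> V\<close>, mapping \<open>h \<otimes> w\<close> to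
  \<open>A h \<otimes> L w\<close>, and extended by zero.\<close>

definition tensor_op ::
  "('p::topological_space, 'm, 'g, 'ep::real_normed_vector, 'em, 'eg) pfb \<Rightarrow>
   ('g, 'v::ab_group_add) grep \<Rightarrow> (('p \<Rightarrow> complex) \<Rightarrow> 'p \<Rightarrow> complex) \<Rightarrow> ('v \<Rightarrow> 'v) \<Rightarrow>
   ('p \<Rightarrow> 'v) \<Rightarrow> 'p \<Rightarrow> 'v" where
  "tensor_op PB R A L = (\<lambda>s q.
     if s \<in> vfns PB R then \<Sum>b\<in>bas R. scl R (A (\<lambda>q. vcoord R b (s q)) q) (L b) else 0)"

definition ver_end_ops ::
  "('p::topological_space, 'm::topological_space, 'g, 'ep::real_normed_vector,
    'em::real_normed_vector, 'eg) pfb \<Rightarrow> ('g, 'v::ab_group_add) grep \<Rightarrow>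
   (complex, ('p \<Rightarrow> 'v) \<Rightarrow> 'p \<Rightarrow> 'v) module" where
  "ver_end_ops PB R =
     \<lparr>carrier = {(\<lambda>s q. \<Sum>i<n. tensor_op PB R (A i) (L i) s q) |(n::nat) A L.
        \<forall>i<n. A i \<in> carrier (ver_ops PB) \<and> Vector_Spaces.linear (scl R) (scl R) (L i)},
      mult = (\<circ>),
      one = (\<lambda>s. if s \<in> vfns PB R then s else (\<lambda>q. 0)),
      zero = (\<lambda>s q. 0), add = (\<lambda>D E s q. D s q + E s q),
      smult = (\<lambda>c D s q. scl R c (D s q))\<rparr>"

text \<open>The action of \<open>g\<close> on \<open>C\<^sup>\<infinity>(P) \<otimes> V\<close>, and the induced one on operators by
  conjugation, which maps \<open>A \<otimes> L\<close> to \<open>pull_op PB g A \<otimes> \<pi>(g) L \<pi>(g)\<inverse>\<close>.\<close>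

definition vact ::
  "('p, 'm, 'g, 'ep, 'em, 'eg) pfb \<Rightarrow> ('g, 'v) grep \<Rightarrow> 'g \<Rightarrow> ('p \<Rightarrow> 'v) \<Rightarrow> 'p \<Rightarrow> 'v" where
  "vact PB R g s = (\<lambda>q. rep R g (pull_fun PB g s q))"

definition vact_op ::
  "('p, 'm, 'g, 'ep, 'em, 'eg) pfb \<Rightarrow> ('g, 'v) grep \<Rightarrow> 'g \<Rightarrow>
   (('p \<Rightarrow> 'v) \<Rightarrow> 'p \<Rightarrow> 'v) \<Rightarrow> ('p \<Rightarrow> 'v) \<Rightarrow> 'p \<Rightarrow> 'v" where
  "vact_op PB R g D = vact PB R g \<circ> D \<circ> vact PB R (inv\<^bsub>grp PB\<^esub> g)"

definition inv_ops ::
  "('p::topological_space, 'm::topological_space, 'g, 'ep::real_normed_vector,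
    'em::real_normed_vector, 'eg) pfb \<Rightarrow> ('g, 'v::ab_group_add) grep \<Rightarrow>
   (complex, ('p \<Rightarrow> 'v) \<Rightarrow> 'p \<Rightarrow> 'v) module" where
  "inv_ops PB R = ver_end_ops PB R
     \<lparr>carrier := {D \<in> carrier (ver_end_ops PB R). \<forall>g. vact_op PB R g D = D}\<rparr>"

text \<open>The components \<open>s\<^sub>b\<close> and \<open>D\<^sub>b\<^sub>c\<close> in
  \<open>s = \<Sum>b. s\<^sub>b \<otimes> b\<close> and \<open>D = \<Sum>b c. D\<^sub>b\<^sub>c \<otimes> E\<^sub>b\<^sub>c\<close>, with \<open>E\<^sub>b\<^sub>c\<close> the elementary
  endomorphism that maps \<open>c\<close> to \<open>b\<close> and the other basis vectors to zero.\<close>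

definition vcomp ::
  "('g, 'v::ab_group_add) grep \<Rightarrow> 'v \<Rightarrow> ('p \<Rightarrow> 'v) \<Rightarrow> 'p \<Rightarrow> complex" where
  "vcomp R b s = (\<lambda>q. vcoord R b (s q))"

definition ocomp ::
  "('g, 'v::ab_group_add) grep \<Rightarrow> 'v \<Rightarrow> 'v \<Rightarrow> (('p \<Rightarrow> 'v) \<Rightarrow> 'p \<Rightarrow> 'v) \<Rightarrow>
   ('p \<Rightarrow> complex) \<Rightarrow> 'p \<Rightarrow> complex" where
  "ocomp R b c D = (\<lambda>h. vcomp R b (D (\<lambda>q. scl R (h q) c)))"

definition elem_end :: "('g, 'v::ab_group_add) grep \<Rightarrow> 'v \<Rightarrow> 'v \<Rightarrow> 'v \<Rightarrow> 'v" where
  "elem_end R b c = (\<lambda>v. scl R (vcoord R c v) b)"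

text \<open>The unique \<open>\<complex>[[\<lambda>]]\<close>-bilinear extensions with
  \<open>(h \<otimes> w) \<bullet> a = (h \<bullet> a) \<otimes> w\<close>,
  \<open>(A \<otimes> L) \<bullet>' (h \<otimes> w) = (A \<bullet>' h) \<otimes> L w\<close> and
  \<open>(A \<otimes> L) \<star>' (B \<otimes> K) = (A \<star>' B) \<otimes> L K\<close>, expanded in components.\<close>

definition vrmod ::
  "('p::topological_space, 'm, 'g, 'ep::real_normed_vector, 'em, 'eg) pfb \<Rightarrow>
   (nat \<Rightarrow> ('p \<Rightarrow> complex) \<Rightarrow> ('m \<Rightarrow> complex) \<Rightarrow> 'p \<Rightarrow> complex) \<Rightarrow>
   ('g, 'v::ab_group_add) grep \<Rightarrow>
   ('p \<Rightarrow> 'v) fps \<Rightarrow> ('m \<Rightarrow> complex) fps \<Rightarrow> ('p \<Rightarrow> 'v) fps" where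
  "vrmod PB \<rho> R s a = Abs_fps (\<lambda>n q.
     \<Sum>b\<in>bas R. scl R (fps_nth (rmod PB \<rho> (coeffwise (vcomp R b) s) a) n q) b)"

definition vlmod ::
  "('p::topological_space, 'm, 'g, 'ep::real_normed_vector, 'em, 'eg) pfb \<Rightarrow>
   (nat \<Rightarrow> (('p \<Rightarrow> complex) \<Rightarrow> 'p \<Rightarrow> complex) \<Rightarrow> ('p \<Rightarrow> complex) \<Rightarrow> 'p \<Rightarrow> complex) \<Rightarrow>
   ('g, 'v::ab_group_add) grep \<Rightarrow>
   (('p \<Rightarrow> 'v) \<Rightarrow> 'p \<Rightarrow> 'v) fps \<Rightarrow> ('p \<Rightarrow> 'v) fps \<Rightarrow> ('p \<Rightarrow> 'v) fps" where
  "vlmod PB Q R D s = Abs_fps (\<lambda>n q. \<Sum>b\<in>bas R. \<Sum>c\<in>bas R.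
     scl R (fps_nth (ver_lmod PB Q (coeffwise (ocomp R b c) D) (coeffwise (vcomp R c) s)) n q) b)"

definition vstar ::
  "('p::topological_space, 'm::topological_space, 'g, 'ep::real_normed_vector,
    'em::real_normed_vector, 'eg) pfb \<Rightarrow>
   (nat \<Rightarrow> (('p \<Rightarrow> complex) \<Rightarrow> 'p \<Rightarrow> complex) \<Rightarrow> ('p \<Rightarrow> complex) \<Rightarrow> 'p \<Rightarrow> complex) \<Rightarrow>
   ('g, 'v::ab_group_add) grep \<Rightarrow>
   (('p \<Rightarrow> 'v) \<Rightarrow> 'p \<Rightarrow> 'v) fps \<Rightarrow> (('p \<Rightarrow> 'v) \<Rightarrow> 'p \<Rightarrow> 'v) fps \<Rightarrow>
   (('p \<Rightarrow> 'v) \<Rightarrow> 'p \<Rightarrow> 'v) fps" where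
  "vstar PB Q R D D' = Abs_fps (\<lambda>n s q. \<Sum>b\<in>bas R. \<Sum>c\<in>bas R. \<Sum>d\<in>bas R.
     tensor_op PB R
       (fps_nth (ver_star PB Q (coeffwise (ocomp R b c) D) (coeffwise (ocomp R c d) D')) n)
       (elem_end R b d) s q)"

definition sec_rmod ::
  "('p::topological_space, 'm, 'g, 'ep::real_normed_vector, 'em, 'eg) pfb \<Rightarrow>
   (nat \<Rightarrow> ('p \<Rightarrow> complex) \<Rightarrow> ('m \<Rightarrow> complex) \<Rightarrow> 'p \<Rightarrow> complex) \<Rightarrow>
   ('g, 'v::ab_group_add) grep \<Rightarrow>
   ('m \<Rightarrow> ('p \<times> 'v) set) fps \<Rightarrow> ('m \<Rightarrow> complex) fps \<Rightarrow> ('m \<Rightarrow> ('p \<times> 'v) set) fps" where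
  "sec_rmod PB \<rho> R s a =
     coeffwise (fun_to_sec PB R) (vrmod PB \<rho> R (coeffwise (sec_to_fun PB R) s) a)"

definition sec_lmod ::
  "('p::topological_space, 'm, 'g, 'ep::real_normed_vector, 'em, 'eg) pfb \<Rightarrow>
   (nat \<Rightarrow> (('p \<Rightarrow> complex) \<Rightarrow> 'p \<Rightarrow> complex) \<Rightarrow> ('p \<Rightarrow> complex) \<Rightarrow> 'p \<Rightarrow> complex) \<Rightarrow>
   ('g, 'v::ab_group_add) grep \<Rightarrow>
   (('p \<Rightarrow> 'v) \<Rightarrow> 'p \<Rightarrow> 'v) fps \<Rightarrow> ('m \<Rightarrow> ('p \<times> 'v) set) fps \<Rightarrow>
   ('m \<Rightarrow> ('p \<times> 'v) set) fps" where
  "sec_lmod PB Q R D s =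
     coeffwise (fun_to_sec PB R) (vlmod PB Q R D (coeffwise (sec_to_fun PB R) s))"


section \<open>Deformed bimodules\<close>

text \<open>\<open>\<star>'\<^sub>E\<close> is \<open>starE\<close>, \<open>\<bullet>'\<^sub>E\<close> is \<open>lmodE\<close>. The right module structure is the
  induced one, \<open>sec_rmod PB \<rho> R\<close>.\<close>

definition deformed_bimodule ::
  "('p::topological_space, 'm::topological_space, 'g, 'ep::real_normed_vector,
    'em::real_normed_vector, 'eg) pfb \<Rightarrow>
   (nat \<Rightarrow> ('p \<Rightarrow> complex) \<Rightarrow> ('m \<Rightarrow> complex) \<Rightarrow> 'p \<Rightarrow> complex) \<Rightarrow>
   ('g, 'v::ab_group_add) grep \<Rightarrow>
   (('m \<Rightarrow> ('p \<times> 'v) set \<Rightarrow> ('p \<times> 'v) set) fps \<Rightarrow>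
    ('m \<Rightarrow> ('p \<times> 'v) set \<Rightarrow> ('p \<times> 'v) set) fps \<Rightarrow>
    ('m \<Rightarrow> ('p \<times> 'v) set \<Rightarrow> ('p \<times> 'v) set) fps) \<Rightarrow>
   (('m \<Rightarrow> ('p \<times> 'v) set \<Rightarrow> ('p \<times> 'v) set) fps \<Rightarrow>
    ('m \<Rightarrow> ('p \<times> 'v) set) fps \<Rightarrow> ('m \<Rightarrow> ('p \<times> 'v) set) fps) \<Rightarrow> bool" where
  "deformed_bimodule PB \<rho> R starE lmodE \<longleftrightarrow>
     (let Ends = series (end_sections PB R); Secs = series (sections PB R) in
      bilinear_map Ends Ends Ends starE \<and>
      (\<forall>A\<in>carrier Ends. \<forall>B\<in>carrier Ends. \<forall>C\<in>carrier Ends.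
         starE (starE A B) C = starE A (starE B C)) \<and>
      (\<forall>A\<in>carrier Ends. \<forall>B\<in>carrier Ends.
         fps_nth (starE A B) 0 = fps_nth A 0 \<otimes>\<^bsub>end_sections PB R\<^esub> fps_nth B 0) \<and>
      bilinear_map Ends Secs Secs lmodE \<and>
      (\<forall>A\<in>carrier Ends. \<forall>B\<in>carrier Ends. \<forall>s\<in>carrier Secs.
         lmodE (starE A B) s = lmodE A (lmodE B s)) \<and>
      (\<forall>A\<in>carrier Ends. \<forall>s\<in>carrier Secs.
         fps_nth (lmodE A s) 0 = (\<lambda>m. fps_nth A 0 m (fps_nth s 0 m))) \<and>
      (\<forall>A\<in>carrier Ends. \<forall>s\<in>carrier Secs. \<forall>a\<in>carrier (series (smooth_fns (base PB))).
         lmodE A (sec_rmod PB \<rho> R s a) = sec_rmod PB \<rho> R (lmodE A s) a))"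

text \<open>Homomorphisms of algebras over \<open>\<complex>[[\<lambda>]]\<close> with modules \<open>M\<close>, \<open>N\<close> and
  products \<open>s\<close>, \<open>t\<close>. Preservation of units is automatic for surjective ones.\<close>

definition algebra_hom ::
  "('r, 'a) module \<Rightarrow> ('a \<Rightarrow> 'a \<Rightarrow> 'a) \<Rightarrow> ('r, 'b) module \<Rightarrow> ('b \<Rightarrow> 'b \<Rightarrow> 'b) \<Rightarrow>
   ('a \<Rightarrow> 'b) \<Rightarrow> bool" where
  "algebra_hom M s N t \<phi> \<longleftrightarrow>
     linear_map M N \<phi> \<and>
     (\<forall>x\<in>carrier M. \<forall>y\<in>carrier M. \<phi> (s x y) = t (\<phi> x) (\<phi> y))"

end

theory Submission
  imports Defs
begin

text \<open>
  By \<open>\<complex>[[\<lambda>]]\<close>-linearity, an operator on \<open>\<Gamma>\<^sup>\<infinity>(E)[[\<lambda>]]\<close> commuting with \<open>\<bullet>\<close> is in lowest order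
  \<open>C\<^sup>\<infinity>(M)\<close>-linear, hence the pointwise action of a section \<open>A\<^sub>0\<close> of \<open>End(E)\<close>. Subtracting
  \<open>A\<^sub>0 \<bullet>'\<^sub>E\<close> leaves \<open>\<lambda>\<close> times another operator commuting with \<open>\<bullet>\<close>, and iterating shows that the
  operator is \<open>A \<bullet>'\<^sub>E\<close> for a unique \<open>A\<close>. Applied to the operators \<open>D \<bullet>'\<close> this gives \<open>\<phi>(D) = A\<close>; by
  uniqueness \<open>\<phi>\<close> is linear and multiplicative. In lowest order \<open>\<phi>\<close> is onto because a section of
  \<open>End(E)\<close> is the same as an equivariant function \<open>P \<rightarrow> End(V)\<close>, and multiplication by that function is
  an invariant vertical differential operator of order zero. Surjectivity in all orders follows by the
  same iteration.
\<close>

section \<open>Smooth functions on open sets\<close>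

text \<open>Commuting with the right action says only that the lowest order of an operator on global
  sections is linear over the smooth functions on M. To read it as a pointwise endomorphism, its
  value at m must depend on the section only through the value at m, every fibre vector must be the
  value of a global section, and the resulting endomorphism must be smooth. All three are obtained
  from bump functions, which is why a calculus with a chain rule for the direction-wise derivatives
  of \<open>Ck_on\<close> comes before any geometry. The iteration over the orders knows nothing of
  bundles and is done once for abstract modules of power series. Its delicate point is that one
  sequence of coefficients has to serve all sections s at the same time, and that an operator stays
  linear over power series after division by the formal parameter. The actions on E are given by
  component formulas on P. That these preserve equivariant functions, and so descend to sections, is
  where the G-invariance of both structures enters.\<close>

lemma Ck_on_cong:
  assumes "open S" "\<And>x. x \<in> S \<Longrightarrow> f x = g x" "Ck_on k S f"
  shows "Ck_on k S g"
  using assms(2,3)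
proof (induction k arbitrary: f g)
  case 0
  then show ?case using continuous_on_cong by (metis Ck_on.simps(1))
next
  case (Suc k)
  have d: "f differentiable (at x)" if "x \<in> S" for x
    using Suc.prems that by simp
  have "g differentiable (at x)" if "x \<in> S" for x
    using d[OF that] has_derivative_transform_within_open[of f _ x UNIV S g] assms(1) that Suc.prems(1)
    unfolding differentiable_def by blast
  moreover have "frechet_derivative f (at x) = frechet_derivative g (at x)" if "x \<in> S" for x
    using frechet_derivative_transform_within_open[OF d[OF that] assms(1) that Suc.prems(1)] .
  then have "Ck_on k S (\<lambda>x. frechet_derivative g (at x) v)" for v
    using Suc.IH[of "\<lambda>x. frechet_derivative f (at x) v" "\<lambda>x. frechet_derivative g (at x) v"] Suc.prems
    by simp
  ultimately show ?case by simp
qed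

lemma Ck_on_subset: "T \<subseteq> S \<Longrightarrow> Ck_on k S f \<Longrightarrow> Ck_on k T f"
  by (induction k arbitrary: f) (auto intro: continuous_on_subset)

lemma Ck_on_local:
  assumes "\<And>x. x \<in> S \<Longrightarrow> \<exists>T. open T \<and> x \<in> T \<and> Ck_on k T f"
  shows "Ck_on k S f"
  using assms
proof (induction k arbitrary: f)
  case 0
  then show ?case
    by (metis Ck_on.simps(1) continuous_at_imp_continuous_on continuous_on_eq_continuous_at)
next
  case (Suc k)
  have "f differentiable (at x)" if "x \<in> S" for x
    using Suc.prems[OF that] by auto
  moreover have "Ck_on k S (\<lambda>x. frechet_derivative f (at x) v)" for v
    by (rule Suc.IH) (use Suc.prems in force)
  ultimately show ?case by simp
qed

text \<open>Allows the derivative to be given by any formula \<open>f'\<close>. The definition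
  speaks of the chosen \<open>frechet_derivative\<close>; by uniqueness it agrees with
  \<open>f'\<close> on S, and for open S this agreement passes to all higher orders.\<close>

lemma Ck_on_SucI:
  assumes "open S" "\<And>x. x \<in> S \<Longrightarrow> (f has_derivative f' x) (at x)" "\<And>v. Ck_on k S (\<lambda>x. f' x v)"
  shows "Ck_on (Suc k) S f"
proof -
  have "Ck_on k S (\<lambda>x. frechet_derivative f (at x) v)" for v
    by (rule Ck_on_cong[OF assms(1) _ assms(3)[of v]]) (simp add: frechet_derivative_at[OF assms(2)])
  then show ?thesis using assms(2) by (auto simp: differentiable_def)
qed

text \<open>The recursion differentiates first and meets continuity only at the bottom, so losing
  one order needs an induction whose base is that differentiable maps are continuous.\<close>

lemma Ck_on_SucD: "Ck_on (Suc k) S f \<Longrightarrow> Ck_on k S f"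
proof (induction k arbitrary: f)
  case 0
  then show ?case
    by (auto intro!: continuous_at_imp_continuous_on differentiable_imp_continuous_within)
next
  case (Suc k)
  then show ?case by (metis Ck_on.simps(2))
qed

lemma Ck_on_Suc_has_derivative:
  assumes "Ck_on (Suc k) S f" "x \<in> S"
  shows "(f has_derivative frechet_derivative f (at x)) (at x)"
  using assms frechet_derivative_works by auto

lemma Ck_on_const: "Ck_on k S (\<lambda>x. c)"
  by (induction k arbitrary: c) (auto simp: frechet_derivative_const)

lemma Ck_on_bounded_linear:
  assumes "open S" "bounded_linear L" "Ck_on k S f"
  shows "Ck_on k S (\<lambda>x. L (f x))"
  using assms(3)
proof (induction k arbitrary: f)
  case 0
  then show ?case using bounded_linear.continuous_on[OF assms(2)] by auto
next
  case (Suc k)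
  show ?case
  proof (rule Ck_on_SucI[OF assms(1)])
    show "((\<lambda>x. L (f x)) has_derivative (\<lambda>v. L (frechet_derivative f (at x) v))) (at x)" if "x \<in> S" for x
      using Ck_on_Suc_has_derivative[OF Suc.prems that] bounded_linear.has_derivative[OF assms(2)] by blast
    show "Ck_on k S (\<lambda>x. L (frechet_derivative f (at x) v))" for v
      using Suc.IH Suc.prems by simp
  qed
qed

lemma Ck_on_add:
  assumes "open S" "Ck_on k S f" "Ck_on k S g"
  shows "Ck_on k S (\<lambda>x. f x + g x)"
  using assms(2,3)
proof (induction k arbitrary: f g)
  case 0
  then show ?case by (simp add: continuous_on_add)
next
  case (Suc k)
  show ?case
  proof (rule Ck_on_SucI[OF assms(1)])
    show "((\<lambda>x. f x + g x) has_derivative (\<lambda>v. frechet_derivative f (at x) v + frechet_derivative g (at x) v)) (at x)"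
      if "x \<in> S" for x
      using Ck_on_Suc_has_derivative[OF Suc.prems(1) that] Ck_on_Suc_has_derivative[OF Suc.prems(2) that]
      by (rule has_derivative_add)
    show "Ck_on k S (\<lambda>x. frechet_derivative f (at x) v + frechet_derivative g (at x) v)" for v
      using Suc.IH Suc.prems by simp
  qed
qed

lemma Ck_on_sum:
  assumes "open S" "\<And>i. i \<in> I \<Longrightarrow> Ck_on k S (f i)"
  shows "Ck_on k S (\<lambda>x. \<Sum>i\<in>I. f i x)"
  using assms(2)
proof (induction I rule: infinite_finite_induct)
  case (insert i I)
  have "Ck_on k S (\<lambda>x. f i x + (\<Sum>i\<in>I. f i x))"
    by (rule Ck_on_add[OF assms(1)]) (use insert in auto)
  then show ?case using insert.hyps by simp
qed (simp_all add: Ck_on_const)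

lemma Ck_on_bounded_bilinear:
  assumes "open S" "bounded_bilinear b" "Ck_on k S f" "Ck_on k S g"
  shows "Ck_on k S (\<lambda>x. b (f x) (g x))"
  using assms(3,4)
proof (induction k arbitrary: f g)
  case 0
  then show ?case using bounded_bilinear.continuous_on[OF assms(2)] by auto
next
  case (Suc k)
  show ?case
  proof (rule Ck_on_SucI[OF assms(1)])
    show "((\<lambda>x. b (f x) (g x)) has_derivative
        (\<lambda>v. b (f x) (frechet_derivative g (at x) v) + b (frechet_derivative f (at x) v) (g x))) (at x)"
      if "x \<in> S" for x
      using Ck_on_Suc_has_derivative[OF Suc.prems(1) that] Ck_on_Suc_has_derivative[OF Suc.prems(2) that]
      by (rule bounded_bilinear.FDERIV[OF assms(2)])
    show "Ck_on k S (\<lambda>x. b (f x) (frechet_derivative g (at x) v) + b (frechet_derivative f (at x) v) (g x))" for v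
      \<comment> \<open>Each summand of the product rule keeps one factor undifferentiated; that
        factor has to be lowered by one order before the induction hypothesis applies.\<close>
      using Suc.prems Ck_on_SucD[OF Suc.prems(1)] Ck_on_SucD[OF Suc.prems(2)]
      by (intro Ck_on_add[OF assms(1)] Suc.IH) auto
  qed
qed

text \<open>A predicate on the type instead of a class constraint, so that it can be extracted from
  an atlas.\<close>

definition finite_dim :: "'e::real_inner itself \<Rightarrow> bool" where
  "finite_dim T \<longleftrightarrow> (\<exists>B::'e set. finite B \<and> span B = UNIV)"

lemma finite_dim_prod:
  assumes "finite_dim TYPE('a::real_inner)" "finite_dim TYPE('b::real_inner)"
  shows "finite_dim TYPE('a \<times> 'b)"
proof -
  obtain A :: "'a set" and B :: "'b set" where A: "finite A" "span A = UNIV" and B: "finite B" "span B = UNIV"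
    using assms unfolding finite_dim_def by blast
  let ?f = "\<lambda>x. (x, 0) :: 'a \<times> 'b" and ?g = "\<lambda>y. (0, y) :: 'a \<times> 'b"
  let ?C = "?f ` A \<union> ?g ` B"
  have lf: "linear ?f" and lg: "linear ?g"
    by (auto intro!: linearI)
  have "?f x \<in> span ?C" for x
  proof -
    have "?f x \<in> span (?f ` A)" using A(2) linear_span_image[OF lf, of A] by auto
    then show ?thesis by (meson span_mono Un_upper1 subsetD)
  qed
  moreover have "?g y \<in> span ?C" for y
  proof -
    have "?g y \<in> span (?g ` B)" using B(2) linear_span_image[OF lg, of B] by auto
    then show ?thesis by (meson span_mono Un_upper2 subsetD)
  qed
  ultimately have "?f x + ?g y \<in> span ?C" for x y
    by (intro span_add)
  then have "z \<in> span ?C" for z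
    by (cases z) auto
  then have "span ?C = UNIV"
    by blast
  then show ?thesis unfolding finite_dim_def using A(1) B(1) by (intro exI[of _ ?C]) auto
qed

lemma finite_dim_euclidean: "finite_dim TYPE('a::euclidean_space)"
  unfolding finite_dim_def by (intro exI[of _ Basis]) auto

text \<open>For an orthogonal spanning set the coordinate along b is the inner product with
  \<open>b /\<^sub>R (b \<bullet> b)\<close>. Coordinates are thus bounded linear in w. A zero
  vector in the set does no harm, since its coefficient vector is zero as well.\<close>

lemma finite_dim_expansion:
  assumes "finite_dim TYPE('e::real_inner)"
  shows "\<exists>(B :: 'e set) c. finite B \<and> (\<forall>w. w = (\<Sum>b\<in>B. (w \<bullet> c b) *\<^sub>R b))"
proof -
  obtain B0 :: "'e set" where "finite B0" "span B0 = UNIV"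
    using assms unfolding finite_dim_def by blast
  then obtain C :: "'e set" where C: "finite C" "span C = UNIV" "pairwise orthogonal C"
    using basis_orthogonal[of B0] by metis
  have "w = (\<Sum>b\<in>C. (w \<bullet> (b /\<^sub>R (b \<bullet> b))) *\<^sub>R b)" for w
  proof -
    have "w \<in> span C" using C by auto
    then show ?thesis
    proof (induction rule: span_induct_alt)
      case base
      then show ?case by simp
    next
      case (step a x y)
      have "(\<Sum>b\<in>C. (x \<bullet> (b /\<^sub>R (b \<bullet> b))) *\<^sub>R b) = (\<Sum>b\<in>C. if b = x then x else 0)"
      proof (rule sum.cong)
        fix b assume "b \<in> C"
        then show "(x \<bullet> (b /\<^sub>R (b \<bullet> b))) *\<^sub>R b = (if b = x then x else 0)"
          using C(3) step(1) by (cases "x = 0") (auto simp: pairwise_def orthogonal_def)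
      qed auto
      also have "\<dots> = x" using step(1) C(1) by simp
      finally have x: "(\<Sum>b\<in>C. (x \<bullet> (b /\<^sub>R (b \<bullet> b))) *\<^sub>R b) = x" .
      have "(\<Sum>b\<in>C. ((a *\<^sub>R x + y) \<bullet> (b /\<^sub>R (b \<bullet> b))) *\<^sub>R b) =
          a *\<^sub>R (\<Sum>b\<in>C. (x \<bullet> (b /\<^sub>R (b \<bullet> b))) *\<^sub>R b) + (\<Sum>b\<in>C. (y \<bullet> (b /\<^sub>R (b \<bullet> b))) *\<^sub>R b)"
        by (simp add: inner_add_left scaleR_add_left sum.distrib scaleR_sum_right algebra_simps)
      then show ?case using x step(2) by simp
    qed
  qed
  then show ?thesis using C(1) by (intro exI[of _ C] exI[of _ "\<lambda>b. b /\<^sub>R (b \<bullet> b)"] conjI allI)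
qed

text \<open>The chain rule evaluates the derivative of g in the direction \<open>?f' x v\<close>,
  which varies with x, whereas \<open>Ck_on\<close> controls derivatives in constant directions
  only. Expanding that direction along the fixed vectors of \<open>finite_dim_expansion\<close>
  leaves a finite sum of products to which the induction, general in g, applies.\<close>

lemma Ck_on_compose:
  fixes f :: "'e::real_normed_vector \<Rightarrow> 'f::real_inner"
  assumes "finite_dim TYPE('f)" "open S" "f ` S \<subseteq> T" "Ck_on k S f" "Ck_on k T g"
  shows "Ck_on k S (\<lambda>x. g (f x))"
  using assms(4,5)
proof (induction k arbitrary: g)
  case 0
  then show ?case using assms(3) by (auto intro: continuous_on_compose2)
next
  case (Suc k)
  obtain B :: "'f set" and c where B: "finite B" and Bc: "\<forall>w. w = (\<Sum>b\<in>B. (w \<bullet> c b) *\<^sub>R b)"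
    using finite_dim_expansion[OF assms(1)] by (elim exE conjE) (rule that)
  let ?f' = "\<lambda>x. frechet_derivative f (at x)" and ?g' = "\<lambda>y. frechet_derivative g (at y)"
  have gl: "bounded_linear (?g' y)" if "y \<in> T" for y
    using Ck_on_Suc_has_derivative[OF Suc.prems(2) that] by (rule has_derivative_bounded_linear)
  show ?case
  proof (rule Ck_on_SucI[OF assms(2)])
    fix x assume x: "x \<in> S"
    then have "f x \<in> T" using assms(3) by auto
    have eq: "?g' (f x) w = (\<Sum>b\<in>B. (w \<bullet> c b) *\<^sub>R ?g' (f x) b)" for w
    proof -
      interpret bounded_linear "?g' (f x)" by (rule gl[OF \<open>f x \<in> T\<close>])
      show ?thesis by (subst Bc[rule_format, of w]) (simp add: sum scaleR)
    qed
    have "((\<lambda>x. g (f x)) has_derivative (\<lambda>v. ?g' (f x) (?f' x v))) (at x)"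
      using has_derivative_compose[OF Ck_on_Suc_has_derivative[OF Suc.prems(1) x]
        Ck_on_Suc_has_derivative[OF Suc.prems(2) \<open>f x \<in> T\<close>]] .
    then show "((\<lambda>x. g (f x)) has_derivative (\<lambda>v. \<Sum>b\<in>B. (?f' x v \<bullet> c b) *\<^sub>R ?g' (f x) b)) (at x)"
      unfolding eq[of "?f' x _"] .
  next
    fix v
    have "Ck_on k S (\<lambda>x. ?f' x v)" "Ck_on k S f" and g: "\<And>b. Ck_on k T (\<lambda>y. ?g' y b)"
      using Suc.prems Ck_on_SucD[OF Suc.prems(1)] by auto
    then show "Ck_on k S (\<lambda>x. \<Sum>b\<in>B. (?f' x v \<bullet> c b) *\<^sub>R ?g' (f x) b)"
      by (intro Ck_on_sum Ck_on_bounded_bilinear[OF _ bounded_bilinear_scaleR] Suc.IH assms(2) g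
          Ck_on_bounded_linear[OF _ bounded_linear_inner_left])
  qed
qed

lemma Ck_on_id: "open S \<Longrightarrow> Ck_on k S (\<lambda>x. x)"
proof (cases k)
  case (Suc k)
  assume S: "open S"
  show ?thesis unfolding Suc by (rule Ck_on_SucI[OF S has_derivative_ident]) (rule Ck_on_const)
qed simp

text \<open>The derivative of 1/f is a product of 1/f, f' and 1/f, so the induction hypothesis for
  the reciprocal itself, one order lower, gives the step.\<close>

lemma Ck_on_inverse:
  fixes f :: "'e::real_normed_vector \<Rightarrow> complex"
  assumes "open S" "Ck_on k S f" "\<And>x. x \<in> S \<Longrightarrow> f x \<noteq> 0"
  shows "Ck_on k S (\<lambda>x. inverse (f x))"
  using assms(2)
proof (induction k)
  case 0
  then show ?case using assms(3) by (auto intro: continuous_on_inverse)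
next
  case (Suc k)
  show ?case
  proof (rule Ck_on_SucI[OF assms(1)])
    show "((\<lambda>x. inverse (f x)) has_derivative
        (\<lambda>v. - (inverse (f x) * frechet_derivative f (at x) v * inverse (f x)))) (at x)" if "x \<in> S" for x
      using Ck_on_Suc_has_derivative[OF Suc.prems that] assms(3)[OF that]
      by (auto intro: derivative_eq_intros)
    fix v
    have "Ck_on k S f" "Ck_on k S (\<lambda>x. frechet_derivative f (at x) v)"
      using Suc.prems Ck_on_SucD[OF Suc.prems] by auto
    then show "Ck_on k S (\<lambda>x. - (inverse (f x) * frechet_derivative f (at x) v * inverse (f x)))"
      by (intro Ck_on_bounded_linear[OF assms(1) bounded_linear_minus[OF bounded_linear_ident]]
          Ck_on_bounded_bilinear[OF assms(1) bounded_bilinear_mult] Suc.IH)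
  qed
qed

section \<open>Closure properties of \<open>smooth_on\<close>\<close>

lemma smooth_on_cong: "open S \<Longrightarrow> (\<And>x. x \<in> S \<Longrightarrow> f x = g x) \<Longrightarrow> smooth_on S f \<Longrightarrow> smooth_on S g"
  unfolding smooth_on_def using Ck_on_cong by blast

lemma smooth_on_subset: "T \<subseteq> S \<Longrightarrow> smooth_on S f \<Longrightarrow> smooth_on T f"
  unfolding smooth_on_def using Ck_on_subset by blast

lemma smooth_on_local:
  assumes "\<And>x. x \<in> S \<Longrightarrow> \<exists>T. open T \<and> x \<in> T \<and> smooth_on T f"
  shows "smooth_on S f"
  unfolding smooth_on_def
proof
  show "Ck_on k S f" for k
    by (rule Ck_on_local) (use assms smooth_on_def in blast)
qed

lemma smooth_on_const: "smooth_on S (\<lambda>x. c)"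
  by (simp add: smooth_on_def Ck_on_const)

lemma smooth_on_id: "open S \<Longrightarrow> smooth_on S (\<lambda>x. x)"
  by (simp add: smooth_on_def Ck_on_id)

lemma smooth_on_add: "open S \<Longrightarrow> smooth_on S f \<Longrightarrow> smooth_on S g \<Longrightarrow> smooth_on S (\<lambda>x. f x + g x)"
  by (simp add: smooth_on_def Ck_on_add)

lemma smooth_on_bounded_linear:
  "open S \<Longrightarrow> bounded_linear L \<Longrightarrow> smooth_on S f \<Longrightarrow> smooth_on S (\<lambda>x. L (f x))"
  by (simp add: smooth_on_def Ck_on_bounded_linear)

lemma smooth_on_bounded_bilinear:
  "open S \<Longrightarrow> bounded_bilinear b \<Longrightarrow> smooth_on S f \<Longrightarrow> smooth_on S g \<Longrightarrow> smooth_on S (\<lambda>x. b (f x) (g x))"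
  by (simp add: smooth_on_def Ck_on_bounded_bilinear)

lemma smooth_on_Pair:
  assumes "open S" "smooth_on S f" "smooth_on S g"
  shows "smooth_on S (\<lambda>x. (f x, g x))"
proof -
  have "smooth_on S (\<lambda>x. (f x, 0) + (0, g x))"
    using smooth_on_bounded_linear[OF assms(1) bounded_linear_Pair[OF bounded_linear_ident bounded_linear_zero] assms(2)]
      smooth_on_bounded_linear[OF assms(1) bounded_linear_Pair[OF bounded_linear_zero bounded_linear_ident] assms(3)]
    by (rule smooth_on_add[OF assms(1)])
  then show ?thesis by simp
qed

lemma smooth_on_compose:
  fixes f :: "'e::real_normed_vector \<Rightarrow> 'f::real_inner"
  assumes "finite_dim TYPE('f)" "open S" "f ` S \<subseteq> T" "smooth_on S f" "smooth_on T g"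
  shows "smooth_on S (\<lambda>x. g (f x))"
  using assms Ck_on_compose unfolding smooth_on_def by blast

lemma smooth_on_inverse:
  fixes f :: "'e::real_normed_vector \<Rightarrow> complex"
  shows "open S \<Longrightarrow> smooth_on S f \<Longrightarrow> (\<And>x. x \<in> S \<Longrightarrow> f x \<noteq> 0) \<Longrightarrow> smooth_on S (\<lambda>x. inverse (f x))"
  by (simp add: smooth_on_def Ck_on_inverse)


section \<open>Bump functions\<close>

text \<open>The family t^(-n) exp(-1/t), extended by zero. Differentiation turns a member into a
  combination of the members n + 2 and n + 1, so smoothness of the whole family follows by one
  induction; the bumps are built from n = 0.\<close>

definition flat_exp :: "nat \<Rightarrow> real \<Rightarrow> real" where
  "flat_exp n t = (if t > 0 then inverse t ^ n * exp (- inverse t) else 0)"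

text \<open>With u = 1/t the limit from the right is that of u^n / exp u at infinity.\<close>

lemma flat_exp_tendsto_0: "(flat_exp n \<longlongrightarrow> 0) (at 0)"
proof -
  have "((\<lambda>t. inverse t ^ n / exp (inverse t)) \<longlongrightarrow> 0) (at_right (0::real))"
    using filterlim_compose[OF tendsto_power_div_exp_0 filterlim_inverse_at_top_right] .
  then have "(flat_exp n \<longlongrightarrow> 0) (at_right 0)"
    by (rule Lim_transform_eventually)
      (auto simp: eventually_at_filter flat_exp_def exp_minus divide_inverse)
  moreover have "(flat_exp n \<longlongrightarrow> 0) (at_left 0)"
    by (rule tendsto_eventually) (auto simp: eventually_at_filter flat_exp_def)
  ultimately show ?thesis
    by (simp add: filterlim_split_at)
qed

lemma flat_exp_has_derivative:
  "(flat_exp n has_real_derivative flat_exp (n + 2) t - of_nat n * flat_exp (n + 1) t) (at t)"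
proof -
  consider "t > 0" | "t < 0" | "t = 0" by linarith
  then show ?thesis
  proof cases
    case 1
    have "((\<lambda>t. inverse t ^ n * exp (- inverse t)) has_real_derivative
        flat_exp (n + 2) t - of_nat n * flat_exp (n + 1) t) (at t)"
      using 1 by (auto intro!: derivative_eq_intros simp: flat_exp_def power2_eq_square)
        (cases n; simp add: algebra_simps)
    then show ?thesis
      by (rule has_field_derivative_transform_within_open[where S = "{0<..}"])
        (use 1 in \<open>auto simp: flat_exp_def\<close>)
  next
    case 2
    have "((\<lambda>t. 0) has_real_derivative flat_exp (n + 2) t - of_nat n * flat_exp (n + 1) t) (at t)"
      using 2 by (simp add: flat_exp_def)
    then show ?thesis
      by (rule has_field_derivative_transform_within_open[where S = "{..<0}"])
        (use 2 in \<open>auto simp: flat_exp_def\<close>)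
  next
    case 3
    \<comment> \<open>At the origin the difference quotient is the next member of the family, so
      differentiability there is exactly its limit zero.\<close>
    have "(flat_exp n y - flat_exp n 0) / (y - 0) = flat_exp (n + 1) y" for y
      by (simp add: flat_exp_def divide_inverse)
    moreover have "flat_exp m 0 = 0" for m
      by (simp add: flat_exp_def)
    ultimately show ?thesis
      unfolding has_field_derivative_iff using 3 flat_exp_tendsto_0[of "n + 1"] by simp
  qed
qed

lemma smooth_on_flat_exp: "smooth_on UNIV (flat_exp n)"
proof -
  have "Ck_on k UNIV (flat_exp n)" for k
  proof (induction k arbitrary: n)
    case 0
    then show ?case
      using DERIV_isCont[OF flat_exp_has_derivative] by (simp add: continuous_on_eq_continuous_at)
  next
    case (Suc k)
    show ?case
    proof (rule Ck_on_SucI[OF open_UNIV])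
      show "(flat_exp n has_derivative (\<lambda>v. v * (flat_exp (n + 2) t + (- of_nat n) * flat_exp (n + 1) t))) (at t)" for t
        using flat_exp_has_derivative[of n t] by (simp add: has_field_derivative_def mult_commute_abs)
      show "Ck_on k UNIV (\<lambda>t. v * (flat_exp (n + 2) t + (- of_nat n) * flat_exp (n + 1) t))" for v
        by (intro Ck_on_bounded_linear[OF open_UNIV bounded_linear_mult_right] Ck_on_add[OF open_UNIV] Suc.IH)
    qed
  qed
  then show ?thesis by (simp add: smooth_on_def)
qed

text \<open>The squared distance appears as an inner product, which is smooth at the centre too,
  unlike the norm.\<close>

definition ball_bump :: "'e::real_inner \<Rightarrow> real \<Rightarrow> 'e \<Rightarrow> complex" where
  "ball_bump a r x = of_real (flat_exp 0 (r\<^sup>2 - (x - a) \<bullet> (x - a)))"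

lemma smooth_on_ball_bump: "open S \<Longrightarrow> smooth_on S (ball_bump (a::'e::real_inner) r)"
proof (rule smooth_on_subset[OF subset_UNIV])
  have "smooth_on UNIV (\<lambda>x::'e. x + (- a))"
    by (intro smooth_on_add smooth_on_id smooth_on_const) auto
  then have "smooth_on UNIV (\<lambda>x. (x + (- a)) \<bullet> (x + (- a)))"
    by (intro smooth_on_bounded_bilinear[OF _ bounded_bilinear_inner]) auto
  then have "smooth_on UNIV (\<lambda>x. r\<^sup>2 + - ((x + (- a)) \<bullet> (x + (- a))))"
    by (intro smooth_on_add smooth_on_const smooth_on_bounded_linear[OF _ bounded_linear_minus[OF bounded_linear_ident]]) auto
  from smooth_on_compose[OF finite_dim_euclidean open_UNIV subset_UNIV this smooth_on_flat_exp, of 0]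
  have "smooth_on UNIV (\<lambda>x. flat_exp 0 (r\<^sup>2 + - ((x + (- a)) \<bullet> (x + (- a)))))" .
  from smooth_on_bounded_linear[OF open_UNIV bounded_linear_of_real this]
  have "smooth_on UNIV (\<lambda>x. complex_of_real (flat_exp 0 (r\<^sup>2 + - ((x + (- a)) \<bullet> (x + (- a))))))" .
  then show "smooth_on UNIV (ball_bump a r)"
    by (simp add: ball_bump_def[abs_def])
qed

lemma ball_bump_eq_0: "norm (x - a) \<ge> r \<Longrightarrow> r > 0 \<Longrightarrow> ball_bump a r x = 0"
  by (auto simp: ball_bump_def flat_exp_def power2_norm_eq_inner[symmetric] power_mono not_less)

lemma ball_bump_center: "r > 0 \<Longrightarrow> ball_bump a r a \<noteq> 0"
  by (simp add: ball_bump_def flat_exp_def)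

text \<open>Points of the ball have bounded coordinates along a finite spanning set, so the ball is
  a closed subset of a compact set of linear combinations.\<close>

lemma compact_cball_finite_dim:
  fixes a :: "'e::real_inner"
  assumes "finite_dim TYPE('e)"
  shows "compact (cball a r)"
proof -
  obtain B :: "'e set" and c where B: "finite B" and Bc: "\<forall>w. w = (\<Sum>b\<in>B. (w \<bullet> c b) *\<^sub>R b)"
    using finite_dim_expansion[OF assms] by (elim exE conjE) (rule that)
  have K: "\<exists>K. compact K \<and> (\<forall>t. (\<forall>b\<in>B'. \<bar>t b\<bar> \<le> R) \<longrightarrow> (\<Sum>b\<in>B'. t b *\<^sub>R b) \<in> K)"
    if "finite B'" for B' :: "'e set" and R :: real
    using that
  proof (induction B')
    case empty
    show ?case by (intro exI[of _ "{0}"]) simp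
  next
    case (insert b0 B')
    from insert.IH obtain K where K: "compact K"
      "\<And>t. (\<forall>b\<in>B'. \<bar>t b\<bar> \<le> R) \<Longrightarrow> (\<Sum>b\<in>B'. t b *\<^sub>R b) \<in> K"
      by blast
    \<comment> \<open>One more spanning vector: the image of an interval times the previous compact
      set under a continuous map.\<close>
    have "compact ((\<lambda>(s, x). s *\<^sub>R b0 + x) ` ({- R..R} \<times> K))"
      by (intro compact_continuous_image compact_Times K(1))
        (auto simp: case_prod_unfold intro!: continuous_intros)
    moreover have "(\<Sum>b\<in>insert b0 B'. t b *\<^sub>R b) \<in> (\<lambda>(s, x). s *\<^sub>R b0 + x) ` ({- R..R} \<times> K)"
      if "\<forall>b\<in>insert b0 B'. \<bar>t b\<bar> \<le> R" for t
    proof (rule image_eqI)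
      show "(\<Sum>b\<in>insert b0 B'. t b *\<^sub>R b) = (\<lambda>(s, x). s *\<^sub>R b0 + x) (t b0, \<Sum>b\<in>B'. t b *\<^sub>R b)"
        using insert.hyps by simp
      show "(t b0, \<Sum>b\<in>B'. t b *\<^sub>R b) \<in> {- R..R} \<times> K"
        using that K(2)[of t] by auto
    qed
    ultimately show ?case by blast
  qed
  \<comment> \<open>By Cauchy-Schwarz each coordinate is at most the norm of x times the norm of
    \<open>c b\<close>; the sum over B bounds all of them uniformly.\<close>
  define R where "R = (norm a + \<bar>r\<bar>) * (\<Sum>b\<in>B. norm (c b))"
  obtain K where "compact K" and K: "\<And>t. (\<forall>b\<in>B. \<bar>t b\<bar> \<le> R) \<Longrightarrow> (\<Sum>b\<in>B. t b *\<^sub>R b) \<in> K"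
    using K[OF B, of R] by blast
  have "cball a r \<subseteq> K"
  proof
    fix x assume "x \<in> cball a r"
    then have x: "norm x \<le> norm a + \<bar>r\<bar>"
      using norm_triangle_sub[of x a] by (simp add: dist_norm norm_minus_commute)
    have "\<bar>x \<bullet> c b\<bar> \<le> R" if "b \<in> B" for b
    proof -
      have "\<bar>x \<bullet> c b\<bar> \<le> norm x * norm (c b)" by (rule Cauchy_Schwarz_ineq2)
      also have "\<dots> \<le> (norm a + \<bar>r\<bar>) * (\<Sum>b\<in>B. norm (c b))"
        using x that B by (intro mult_mono member_le_sum) auto
      finally show ?thesis by (simp add: R_def)
    qed
    then have "(\<Sum>b\<in>B. (x \<bullet> c b) *\<^sub>R b) \<in> K" by (intro K ballI)
    then show "x \<in> K" by (simp only: Bc[rule_format, symmetric])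
  qed
  then have "cball a r = K \<inter> cball a r" by blast
  then show ?thesis using compact_Int_closed[OF \<open>compact K\<close> closed_cball] by metis
qed


section \<open>Smooth maps between manifolds\<close>

text \<open>All that composition of smooth maps needs of the intermediate manifold; smoothness of the
  transition maps is left out, so that products are covered at no cost.\<close>

definition charted :: "('a::topological_space, 'e::real_inner) atlas \<Rightarrow> bool" where
  "charted A \<longleftrightarrow> finite_dim TYPE('e) \<and> (\<forall>x. \<exists>U \<phi>. (U, \<phi>) \<in> A \<and> x \<in> U) \<and>
     (\<forall>U \<phi>. (U, \<phi>) \<in> A \<longrightarrow> open U \<and> open (\<phi> ` U) \<and> (\<exists>\<psi>. homeomorphism U (\<phi> ` U) \<phi> \<psi>))"

lemma charted_cover:
  assumes "charted A" obtains U \<phi> where "(U, \<phi>) \<in> A" "x \<in> U"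
  using assms unfolding charted_def by blast

lemma charted_finite_dim: "charted (A :: ('a::topological_space, 'e::real_inner) atlas) \<Longrightarrow> finite_dim TYPE('e)"
  unfolding charted_def by blast

context
  fixes A :: "('a::topological_space, 'e::real_inner) atlas" and U \<phi>
  assumes charted: "charted A" and chart: "(U, \<phi>) \<in> A"
begin

lemma chart_open: "open U"
  using charted chart unfolding charted_def by blast

lemma chart_homeomorphism: "\<exists>\<psi>. homeomorphism U (\<phi> ` U) \<phi> \<psi>"
  using charted chart unfolding charted_def by blast

lemma chart_inj: "inj_on \<phi> U"
  using chart_homeomorphism by (metis homeomorphism_apply1 inj_onI)

lemma chart_continuous: "continuous_on U \<phi>"
  using chart_homeomorphism homeomorphism_cont1 by blast

lemma chart_inv [simp]: "x \<in> U \<Longrightarrow> inv_into U \<phi> (\<phi> x) = x"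
  by (simp add: chart_inj)

lemma chart_inv_continuous: "continuous_on (\<phi> ` U) (inv_into U \<phi>)"
proof -
  obtain \<psi> where \<psi>: "homeomorphism U (\<phi> ` U) \<phi> \<psi>" using chart_homeomorphism by blast
  have "inv_into U \<phi> y = \<psi> y" if "y \<in> \<phi> ` U" for y
    using that \<psi> by (auto simp: homeomorphism_apply1)
  then show ?thesis using homeomorphism_cont2[OF \<psi>] continuous_on_cong by metis
qed

lemma chart_open_image: "open V \<Longrightarrow> V \<subseteq> U \<Longrightarrow> open (\<phi> ` V)"
proof -
  assume V: "open V" "V \<subseteq> U"
  obtain \<psi> where \<psi>: "homeomorphism U (\<phi> ` U) \<phi> \<psi>" using chart_homeomorphism by blast
  have "openin (top_of_set (\<phi> ` U)) (\<phi> ` V)"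
    using homeomorphism_imp_open_map[OF \<psi>] V by (simp add: openin_open_eq chart_open)
  moreover have "open (\<phi> ` U)" using charted chart unfolding charted_def by blast
  ultimately show ?thesis using openin_open_trans by blast
qed

end

lemma manifold_charted: "manifold A \<Longrightarrow> charted A"
proof -
  assume A: "manifold A"
  have "\<exists>U \<phi>. (U, \<phi>) \<in> A \<and> x \<in> U" for x
  proof -
    have "(\<Union>(U, \<phi>)\<in>A. U) = UNIV"
      using A unfolding manifold_def by simp
    then have "x \<in> (\<Union>(U, \<phi>)\<in>A. U)" by simp
    then obtain c where "c \<in> A" "x \<in> (case c of (U, \<phi>) \<Rightarrow> U)" by (rule UN_E)
    then show ?thesis by (cases c) auto
  qed
  then show ?thesis
    using A unfolding manifold_def charted_def finite_dim_def by (simp add: case_prod_unfold Ball_def)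
qed

lemma manifold_transition:
  "manifold A \<Longrightarrow> (U, \<phi>) \<in> A \<Longrightarrow> (W, \<psi>) \<in> A \<Longrightarrow> smooth_on (\<phi> ` (U \<inter> W)) (\<psi> \<circ> inv_into U \<phi>)"
  unfolding manifold_def by blast

lemma charted_std_atlas: "charted (std_atlas :: ('a::euclidean_space, 'a) atlas)"
  unfolding charted_def std_atlas_def
  using homeomorphism_ident[of UNIV] by (simp add: finite_dim_euclidean id_def) blast

lemma charted_prod_atlas:
  assumes A: "charted A" and B: "charted B"
  shows "charted (prod_atlas A B)"
  unfolding charted_def
proof (intro conjI allI impI)
  show "finite_dim TYPE('b \<times> 'd)"
    using finite_dim_prod charted_finite_dim[OF A] charted_finite_dim[OF B] by blast
  show "\<exists>U \<phi>. (U, \<phi>) \<in> prod_atlas A B \<and> x \<in> U" for x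
  proof -
    obtain U \<phi> W \<psi> where "(U, \<phi>) \<in> A" "fst x \<in> U" "(W, \<psi>) \<in> B" "snd x \<in> W"
      using charted_cover[OF A] charted_cover[OF B] by metis
    then have "(U \<times> W, map_prod \<phi> \<psi>) \<in> prod_atlas A B" "x \<in> U \<times> W"
      unfolding prod_atlas_def by (blast, simp add: mem_Times_iff)
    then show ?thesis by blast
  qed
  fix UW \<phi>\<psi> assume "(UW, \<phi>\<psi>) \<in> prod_atlas A B"
  then obtain U \<phi> W \<psi> where eq: "UW = U \<times> W" "\<phi>\<psi> = map_prod \<phi> \<psi>" and c: "(U, \<phi>) \<in> A" "(W, \<psi>) \<in> B"
    unfolding prod_atlas_def by blast
  have o: "open U" "open W" "open (\<phi> ` U)" "open (\<psi> ` W)"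
    using chart_open[OF A c(1)] chart_open[OF B c(2)] chart_open_image[OF A c(1)] chart_open_image[OF B c(2)]
    by auto
  show "open UW" using o eq by (simp add: open_Times)
  have im: "\<phi>\<psi> ` UW = \<phi> ` U \<times> \<psi> ` W" using eq by (simp add: map_prod_image)
  show "open (\<phi>\<psi> ` UW)" using o im by (simp add: open_Times)
  have "homeomorphism UW (\<phi>\<psi> ` UW) \<phi>\<psi> (map_prod (inv_into U \<phi>) (inv_into W \<psi>))"
  proof (rule homeomorphismI)
    show "continuous_on UW \<phi>\<psi>"
      unfolding eq map_prod_def case_prod_unfold
      by (intro continuous_on_Pair continuous_on_compose2[OF chart_continuous[OF A c(1)]]
          continuous_on_compose2[OF chart_continuous[OF B c(2)]] continuous_intros) auto
    show "continuous_on (\<phi>\<psi> ` UW) (map_prod (inv_into U \<phi>) (inv_into W \<psi>))"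
      unfolding im map_prod_def case_prod_unfold
      by (intro continuous_on_Pair continuous_on_compose2[OF chart_inv_continuous[OF A c(1)]]
          continuous_on_compose2[OF chart_inv_continuous[OF B c(2)]] continuous_intros) auto
  qed (use chart_inv[OF A c(1)] chart_inv[OF B c(2)] eq in auto)
  then show "\<exists>\<psi>. homeomorphism UW (\<phi>\<psi> ` UW) \<phi>\<psi> \<psi>" by blast
qed

section \<open>Locality, composition and pairing of smooth maps\<close>

lemma smooth_map_on_continuous: "smooth_map_on S A B f \<Longrightarrow> continuous_on S f"
  by (simp add: smooth_map_on_def)

lemma smooth_map_onI:
  assumes "continuous_on S f"
    "\<And>U \<phi> W \<psi>. (U, \<phi>) \<in> A \<Longrightarrow> (W, \<psi>) \<in> B \<Longrightarrow>
       smooth_on (\<phi> ` (U \<inter> S \<inter> f -` W)) (\<psi> \<circ> f \<circ> inv_into U \<phi>)"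
  shows "smooth_map_on S A B f"
  unfolding smooth_map_on_def using assms by blast

lemma smooth_map_onD:
  "smooth_map_on S A B f \<Longrightarrow> (U, \<phi>) \<in> A \<Longrightarrow> (W, \<psi>) \<in> B \<Longrightarrow>
   smooth_on (\<phi> ` (U \<inter> S \<inter> f -` W)) (\<psi> \<circ> f \<circ> inv_into U \<phi>)"
  unfolding smooth_map_on_def by blast

lemma open_chart_domain:
  assumes "charted A" "charted B" "(U, \<phi>) \<in> A" "(W, \<psi>) \<in> B" "open S" "continuous_on S f"
  shows "open (U \<inter> S \<inter> f -` W)" "open (\<phi> ` (U \<inter> S \<inter> f -` W))"
proof -
  have "open (S \<inter> f -` W)"
    using continuous_open_preimage[OF assms(6,5)] chart_open[OF assms(2,4)] by blast
  then show *: "open (U \<inter> S \<inter> f -` W)"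
    using chart_open[OF assms(1,3)] by (simp add: Int_assoc open_Int)
  show "open (\<phi> ` (U \<inter> S \<inter> f -` W))"
    using chart_open_image[OF assms(1,3) *] by auto
qed

lemma smooth_map_on_subset:
  assumes "smooth_map_on S A B f" "T \<subseteq> S"
  shows "smooth_map_on T A B f"
proof (rule smooth_map_onI)
  show "continuous_on T f"
    using assms smooth_map_on_continuous continuous_on_subset by blast
  show "smooth_on (\<phi> ` (U \<inter> T \<inter> f -` W)) (\<psi> \<circ> f \<circ> inv_into U \<phi>)"
    if "(U, \<phi>) \<in> A" "(W, \<psi>) \<in> B" for U \<phi> W \<psi>
    by (rule smooth_on_subset[OF _ smooth_map_onD[OF assms(1) that]]) (use assms(2) in auto)
qed

lemma smooth_map_on_cong:
  assumes "charted A" "charted B" "open S" "\<And>x. x \<in> S \<Longrightarrow> f x = g x" "smooth_map_on S A B f"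
  shows "smooth_map_on S A B g"
proof -
  note cont = smooth_map_on_continuous[OF assms(5)]
  have "smooth_on (\<phi> ` (U \<inter> S \<inter> g -` W)) (\<psi> \<circ> g \<circ> inv_into U \<phi>)"
    if c: "(U, \<phi>) \<in> A" "(W, \<psi>) \<in> B" for U \<phi> W \<psi>
  proof -
    have "U \<inter> S \<inter> g -` W = U \<inter> S \<inter> f -` W" using assms(4) by auto
    moreover have "smooth_on (\<phi> ` (U \<inter> S \<inter> f -` W)) (\<psi> \<circ> g \<circ> inv_into U \<phi>)"
      by (rule smooth_on_cong[OF _ _ smooth_map_onD[OF assms(5) c]])
        (use open_chart_domain(2)[OF assms(1,2) c assms(3) cont] assms(4) chart_inv[OF assms(1) c(1)] in auto)
    ultimately show ?thesis by simp
  qed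
  moreover have "continuous_on S g" using cont assms(4) continuous_on_cong by metis
  ultimately show ?thesis by (rule smooth_map_onI[rotated])
qed

lemma smooth_map_on_local:
  fixes f :: "'a::t2_space \<Rightarrow> 'b::t2_space"
  assumes "charted A" "charted B"
    "\<And>x. x \<in> S \<Longrightarrow> \<exists>T. open T \<and> x \<in> T \<and> smooth_map_on T A B f"
  shows "smooth_map_on S A B f"
proof -
  have "continuous_on S f"
  proof (rule continuous_at_imp_continuous_on, rule ballI)
    fix x assume "x \<in> S"
    then obtain T where T: "open T" "x \<in> T" "smooth_map_on T A B f"
      using assms(3) by blast
    from T(1,2) smooth_map_on_continuous[OF T(3)] show "isCont f x" using continuous_on_eq_continuous_at by blast
  qed
  moreover have "smooth_on (\<phi> ` (U \<inter> S \<inter> f -` W)) (\<psi> \<circ> f \<circ> inv_into U \<phi>)"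
    if c: "(U, \<phi>) \<in> A" "(W, \<psi>) \<in> B" for U \<phi> W \<psi>
  proof (rule smooth_on_local)
    fix y assume "y \<in> \<phi> ` (U \<inter> S \<inter> f -` W)"
    then obtain x where x: "y = \<phi> x" "x \<in> U" "x \<in> S" "f x \<in> W" by auto
    then obtain T where T: "open T" "x \<in> T" "smooth_map_on T A B f" using assms(3) by blast
    show "\<exists>V. open V \<and> y \<in> V \<and> smooth_on V (\<psi> \<circ> f \<circ> inv_into U \<phi>)"
      using smooth_map_onD[OF T(3) c] x T(2)
        open_chart_domain(2)[OF assms(1,2) c T(1) smooth_map_on_continuous[OF T(3)]]
      by (intro exI[of _ "\<phi> ` (U \<inter> T \<inter> f -` W)"]) auto
  qed
  ultimately show ?thesis by (rule smooth_map_onI)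
qed

text \<open>The claim mentions charts of A and C only. Near each point a chart of B around f x is
  inserted; on the smaller domain the chart expression of the composite factors through it, and
  smoothness is local.\<close>

lemma smooth_map_on_compose:
  assumes A: "charted A" and B: "charted B" and C: "charted C" and "open S" "open T" "f ` S \<subseteq> T"
    and f: "smooth_map_on S A B f" and g: "smooth_map_on T B C g"
  shows "smooth_map_on S A C (\<lambda>x. g (f x))"
proof -
  note fc = smooth_map_on_continuous[OF f] and gc = smooth_map_on_continuous[OF g]
  have cont: "continuous_on S (\<lambda>x. g (f x))"
    using continuous_on_compose2[OF gc fc] assms(6) by blast
  have "smooth_on (\<phi> ` (U \<inter> S \<inter> (\<lambda>x. g (f x)) -` W)) (\<psi> \<circ> (\<lambda>x. g (f x)) \<circ> inv_into U \<phi>)"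
    if c: "(U, \<phi>) \<in> A" "(W, \<psi>) \<in> C" for U \<phi> W \<psi>
  proof (rule smooth_on_local)
    fix y assume "y \<in> \<phi> ` (U \<inter> S \<inter> (\<lambda>x. g (f x)) -` W)"
    then obtain x where x: "y = \<phi> x" "x \<in> U" "x \<in> S" "g (f x) \<in> W" by auto
    obtain V \<theta> where V: "(V, \<theta>) \<in> B" "f x \<in> V" using charted_cover[OF B] .
    let ?X = "(U \<inter> S \<inter> f -` V) \<inter> (U \<inter> S \<inter> (\<lambda>x. g (f x)) -` W)"
    have oX: "open ?X"
      using open_chart_domain(1)[OF A B c(1) V(1) assms(4) fc] open_chart_domain(1)[OF A C c assms(4) cont]
      by blast
    have oX': "open (\<phi> ` ?X)" by (rule chart_open_image[OF A c(1) oX]) auto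
    have "smooth_on (\<phi> ` ?X) (\<lambda>y. (\<psi> \<circ> g \<circ> inv_into V \<theta>) ((\<theta> \<circ> f \<circ> inv_into U \<phi>) y))"
    proof (rule smooth_on_compose[OF charted_finite_dim[OF B] oX' _ _ smooth_map_onD[OF g V(1) c(2)]])
      show "smooth_on (\<phi> ` ?X) (\<theta> \<circ> f \<circ> inv_into U \<phi>)"
        by (rule smooth_on_subset[OF _ smooth_map_onD[OF f c(1) V(1)]]) auto
      show "(\<theta> \<circ> f \<circ> inv_into U \<phi>) ` \<phi> ` ?X \<subseteq> \<theta> ` (V \<inter> T \<inter> g -` W)"
        using assms(6) by (auto simp: chart_inv[OF A c(1)])
    qed
    then have "smooth_on (\<phi> ` ?X) (\<psi> \<circ> (\<lambda>x. g (f x)) \<circ> inv_into U \<phi>)"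
      by (rule smooth_on_cong[OF oX', rotated])
        (auto simp: chart_inv[OF A c(1)] chart_inv[OF B V(1)])
    moreover have "y \<in> \<phi> ` ?X" using x V(2) by auto
    ultimately show "\<exists>T. open T \<and> y \<in> T \<and> smooth_on T (\<psi> \<circ> (\<lambda>x. g (f x)) \<circ> inv_into U \<phi>)"
      using oX' by blast
  qed
  then show ?thesis by (rule smooth_map_onI[OF cont])
qed

lemma smooth_map_on_Pair:
  assumes A: "charted A" and B: "charted B" and C: "charted C" and "open S"
    and f: "smooth_map_on S A B f" and g: "smooth_map_on S A C g"
  shows "smooth_map_on S A (prod_atlas B C) (\<lambda>x. (f x, g x))"
proof -
  have cont: "continuous_on S (\<lambda>x. (f x, g x))"
    by (intro continuous_on_Pair smooth_map_on_continuous[OF f] smooth_map_on_continuous[OF g])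
  have "smooth_on (\<phi> ` (U \<inter> S \<inter> (\<lambda>x. (f x, g x)) -` Z)) (\<zeta> \<circ> (\<lambda>x. (f x, g x)) \<circ> inv_into U \<phi>)"
    if c: "(U, \<phi>) \<in> A" "(Z, \<zeta>) \<in> prod_atlas B C" for U \<phi> Z \<zeta>
  proof -
    obtain V \<theta> W \<psi> where eq: "Z = V \<times> W" "\<zeta> = map_prod \<theta> \<psi>" and d: "(V, \<theta>) \<in> B" "(W, \<psi>) \<in> C"
      using c(2) unfolding prod_atlas_def by blast
    let ?X = "\<phi> ` (U \<inter> S \<inter> (\<lambda>x. (f x, g x)) -` Z)"
    have "smooth_on ?X (\<lambda>y. ((\<theta> \<circ> f \<circ> inv_into U \<phi>) y, (\<psi> \<circ> g \<circ> inv_into U \<phi>) y))"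
    proof (rule smooth_on_Pair)
      show "open ?X"
        by (rule open_chart_domain(2)[OF A charted_prod_atlas[OF B C] c assms(4) cont])
      show "smooth_on ?X (\<theta> \<circ> f \<circ> inv_into U \<phi>)"
        by (rule smooth_on_subset[OF _ smooth_map_onD[OF f c(1) d(1)]]) (auto simp: eq)
      show "smooth_on ?X (\<psi> \<circ> g \<circ> inv_into U \<phi>)"
        by (rule smooth_on_subset[OF _ smooth_map_onD[OF g c(1) d(2)]]) (auto simp: eq)
    qed
    moreover have "(\<lambda>y. ((\<theta> \<circ> f \<circ> inv_into U \<phi>) y, (\<psi> \<circ> g \<circ> inv_into U \<phi>) y)) =
        \<zeta> \<circ> (\<lambda>x. (f x, g x)) \<circ> inv_into U \<phi>"
      by (auto simp: eq)
    ultimately show ?thesis by simp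
  qed
  then show ?thesis by (rule smooth_map_onI[OF cont])
qed

text \<open>In charts the identity is a transition map, so \<open>charted\<close> is not enough and
  the full \<open>manifold\<close> is required; the same happens for the projection
  \<open>snd\<close> below.\<close>

lemma smooth_map_on_ident:
  assumes "manifold A"
  shows "smooth_map_on S A A (\<lambda>x. x)"
proof (rule smooth_map_onI)
  show "smooth_on (\<phi> ` (U \<inter> S \<inter> (\<lambda>x. x) -` W)) (\<psi> \<circ> (\<lambda>x. x) \<circ> inv_into U \<phi>)"
    if "(U, \<phi>) \<in> A" "(W, \<psi>) \<in> A" for U \<phi> W \<psi>
    using smooth_on_subset[OF _ manifold_transition[OF assms that], of "\<phi> ` (U \<inter> S \<inter> (\<lambda>x. x) -` W)"]
    by (auto simp: comp_def)
qed (rule continuous_on_id)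

lemma smooth_map_on_const: "smooth_map_on S A B (\<lambda>x. c)"
  by (intro smooth_map_onI) (simp_all add: comp_def smooth_on_const)

lemma smooth_map_on_snd:
  assumes A: "charted A" and B: "manifold B"
  shows "smooth_map_on UNIV (prod_atlas A B) B snd"
proof -
  note B' = manifold_charted[OF B]
  have "smooth_on (\<zeta> ` (Z \<inter> UNIV \<inter> snd -` V)) (\<theta> \<circ> snd \<circ> inv_into Z \<zeta>)"
    if c: "(Z, \<zeta>) \<in> prod_atlas A B" "(V, \<theta>) \<in> B" for Z \<zeta> V \<theta>
  proof -
    obtain U \<phi> W \<psi> where eq: "Z = U \<times> W" "\<zeta> = map_prod \<phi> \<psi>" and d: "(U, \<phi>) \<in> A" "(W, \<psi>) \<in> B"
      using c(1) unfolding prod_atlas_def by blast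
    note AB = charted_prod_atlas[OF A B']
    have o: "open (\<zeta> ` (Z \<inter> UNIV \<inter> snd -` V))"
      by (rule open_chart_domain(2)[OF AB B' c]) (auto intro: continuous_intros)
    have pr: "snd y \<in> \<psi> ` (W \<inter> V)"
      "(\<theta> \<circ> inv_into W \<psi>) (snd y) = (\<theta> \<circ> snd \<circ> inv_into Z \<zeta>) y"
      if "y \<in> \<zeta> ` (Z \<inter> UNIV \<inter> snd -` V)" for y
    proof -
      obtain x where x: "y = \<zeta> x" "x \<in> Z" "snd x \<in> V" using \<open>y \<in> _\<close> by blast
      then have "snd y = \<psi> (snd x)" "snd x \<in> W" by (simp_all add: eq mem_Times_iff)
      then show "snd y \<in> \<psi> ` (W \<inter> V)"
        "(\<theta> \<circ> inv_into W \<psi>) (snd y) = (\<theta> \<circ> snd \<circ> inv_into Z \<zeta>) y"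
        using x chart_inv[OF AB c(1) x(2)] chart_inv[OF B' d(2), of "snd x"] by simp_all
    qed
    have "smooth_on (\<zeta> ` (Z \<inter> UNIV \<inter> snd -` V)) snd"
      using smooth_on_bounded_linear[OF o bounded_linear_snd smooth_on_id[OF o]] .
    from smooth_on_compose[OF charted_finite_dim[OF B'] o _ this manifold_transition[OF B d(2) c(2)]]
    have "smooth_on (\<zeta> ` (Z \<inter> UNIV \<inter> snd -` V)) (\<lambda>y. (\<theta> \<circ> inv_into W \<psi>) (snd y))"
      using pr(1) by blast
    then show ?thesis
      by (rule smooth_on_cong[OF o pr(2), rotated])
  qed
  then show ?thesis by (rule smooth_map_onI[OF continuous_on_snd[OF continuous_on_id]])
qed


section \<open>Smooth complex valued functions\<close>

abbreviation smooth_fun ::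
  "('a::topological_space, 'e::real_inner) atlas \<Rightarrow> 'a set \<Rightarrow> ('a \<Rightarrow> complex) \<Rightarrow> bool" where
  "smooth_fun A S f \<equiv> smooth_map_on S A std_atlas f"

text \<open>Continuity can be read off from the chart expressions, since each of them is continuous
  by its order zero part. This leaves a criterion in charts of the source alone, from which the
  algebra of smooth functions is inherited.\<close>

lemma smooth_fun_iff:
  fixes A :: "('a::t2_space, 'e::real_inner) atlas"
  assumes "charted A" "open S"
  shows "smooth_fun A S f \<longleftrightarrow> (\<forall>(U, \<phi>)\<in>A. smooth_on (\<phi> ` (U \<inter> S)) (f \<circ> inv_into U \<phi>))"
    (is "_ \<longleftrightarrow> ?R")
proof
  assume ?R
  have "continuous_on S f"
  proof (rule continuous_at_imp_continuous_on, rule ballI)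
    fix x assume x: "x \<in> S"
    obtain U \<phi> where U: "(U, \<phi>) \<in> A" "x \<in> U" using charted_cover[OF assms(1)] .
    then have "smooth_on (\<phi> ` (U \<inter> S)) (f \<circ> inv_into U \<phi>)" using \<open>?R\<close> by auto
    then have "continuous_on (\<phi> ` (U \<inter> S)) (f \<circ> inv_into U \<phi>)"
      unfolding smooth_on_def by (metis Ck_on.simps(1))
    then have "continuous_on (U \<inter> S) (\<lambda>x. (f \<circ> inv_into U \<phi>) (\<phi> x))"
      by (rule continuous_on_compose2)
        (use chart_continuous[OF assms(1) U(1)] in \<open>auto intro: continuous_on_subset\<close>)
    then have "continuous_on (U \<inter> S) f"
      by (rule continuous_on_eq) (simp add: chart_inv[OF assms(1) U(1)])
    moreover have "open (U \<inter> S)" using chart_open[OF assms(1) U(1)] assms(2) by blast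
    ultimately show "isCont f x" using x U(2) continuous_on_eq_continuous_at by blast
  qed
  then show "smooth_fun A S f"
    using \<open>?R\<close> unfolding smooth_map_on_def std_atlas_def by auto
qed (auto simp: smooth_map_on_def std_atlas_def)

lemma smooth_fun_const: "smooth_fun A S (\<lambda>x. c)"
  by (rule smooth_map_on_const)

context
  fixes A :: "('a::t2_space, 'e::real_inner) atlas" and S :: "'a set"
  assumes A: "charted A" and S: "open S"
begin

lemma smooth_fun_binop:
  assumes "\<And>(T :: 'e set) f g. open T \<Longrightarrow> smooth_on T f \<Longrightarrow> smooth_on T g \<Longrightarrow> smooth_on T (\<lambda>x. op (f x) (g x))"
    and "smooth_fun A S f" "smooth_fun A S g"
  shows "smooth_fun A S (\<lambda>x. op (f x) (g x))"
  unfolding smooth_fun_iff[OF A S]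
proof (clarify)
  fix U \<phi> assume c: "(U, \<phi>) \<in> A"
  have "open (\<phi> ` (U \<inter> S))"
    using chart_open_image[OF A c, of "U \<inter> S"] chart_open[OF A c] S by auto
  moreover have "smooth_on (\<phi> ` (U \<inter> S)) (f \<circ> inv_into U \<phi>)"
    using assms(2) c unfolding smooth_fun_iff[OF A S] by blast
  moreover have "smooth_on (\<phi> ` (U \<inter> S)) (g \<circ> inv_into U \<phi>)"
    using assms(3) c unfolding smooth_fun_iff[OF A S] by blast
  ultimately have "smooth_on (\<phi> ` (U \<inter> S)) (\<lambda>x. op ((f \<circ> inv_into U \<phi>) x) ((g \<circ> inv_into U \<phi>) x))"
    by (rule assms(1))
  then show "smooth_on (\<phi> ` (U \<inter> S)) ((\<lambda>x. op (f x) (g x)) \<circ> inv_into U \<phi>)"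
    by (simp add: comp_def)
qed

lemma smooth_fun_add: "smooth_fun A S f \<Longrightarrow> smooth_fun A S g \<Longrightarrow> smooth_fun A S (\<lambda>x. f x + g x)"
  by (rule smooth_fun_binop) (rule smooth_on_add)

lemma smooth_fun_mult: "smooth_fun A S f \<Longrightarrow> smooth_fun A S g \<Longrightarrow> smooth_fun A S (\<lambda>x. f x * g x)"
  by (rule smooth_fun_binop) (rule smooth_on_bounded_bilinear[OF _ bounded_bilinear_mult])

lemma smooth_fun_inverse:
  assumes "smooth_fun A S f" "\<And>x. x \<in> S \<Longrightarrow> f x \<noteq> 0"
  shows "smooth_fun A S (\<lambda>x. inverse (f x))"
  unfolding smooth_fun_iff[OF A S]
proof (clarify)
  fix U \<phi> assume c: "(U, \<phi>) \<in> A"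
  have "open (\<phi> ` (U \<inter> S))"
    using chart_open_image[OF A c, of "U \<inter> S"] chart_open[OF A c] S by auto
  moreover have "smooth_on (\<phi> ` (U \<inter> S)) (f \<circ> inv_into U \<phi>)"
    using assms c by (auto simp: smooth_fun_iff[OF A S])
  ultimately have "smooth_on (\<phi> ` (U \<inter> S)) (\<lambda>x. inverse ((f \<circ> inv_into U \<phi>) x))"
    by (rule smooth_on_inverse) (use assms(2) chart_inv[OF A c] in auto)
  then show "smooth_on (\<phi> ` (U \<inter> S)) ((\<lambda>x. inverse (f x)) \<circ> inv_into U \<phi>)"
    by (simp add: comp_def)
qed

lemma smooth_fun_sum:
  "(\<And>i. i \<in> I \<Longrightarrow> smooth_fun A S (f i)) \<Longrightarrow> smooth_fun A S (\<lambda>x. \<Sum>i\<in>I. f i x)"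
  by (induction I rule: infinite_finite_induct) (auto intro: smooth_fun_add smooth_fun_const)

end

lemmas smooth_fun_cong = smooth_map_on_cong[OF _ charted_std_atlas]
lemmas smooth_fun_local = smooth_map_on_local[OF _ charted_std_atlas]
lemmas smooth_fun_compose = smooth_map_on_compose[OF _ _ charted_std_atlas]

lemma smooth_fns_iff: "f \<in> carrier (smooth_fns A) \<longleftrightarrow> smooth_fun A UNIV f"
  by (simp add: smooth_fns_def)

text \<open>A ball bump in a chart, extended by zero. The set K is the preimage of a closed ball: it
  is compact because the dimension is finite, hence closed in the whole Hausdorff space and not
  merely in the chart. This is what the extension by zero relies on.\<close>

lemma manifold_bump:
  fixes A :: "('a::{t2_space,second_countable_topology}, 'e::real_inner) atlas"
  assumes "manifold A" "open U" "m \<in> U"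
  obtains \<theta> K where "smooth_fun A UNIV \<theta>" "\<theta> m \<noteq> 0" "closed K" "K \<subseteq> U" "\<And>x. x \<notin> K \<Longrightarrow> \<theta> x = 0"
proof -
  note A = manifold_charted[OF assms(1)]
  obtain W \<phi> where W: "(W, \<phi>) \<in> A" "m \<in> W" using charted_cover[OF A] .
  note oW = chart_open[OF A W(1)]
  have "open (\<phi> ` (W \<inter> U))" by (rule chart_open_image[OF A W(1)]) (use oW assms(2) in auto)
  moreover have "\<phi> m \<in> \<phi> ` (W \<inter> U)" using W(2) assms(3) by auto
  ultimately obtain r where r: "r > 0" "cball (\<phi> m) r \<subseteq> \<phi> ` (W \<inter> U)"
    using open_contains_cball by blast
  define K where "K = inv_into W \<phi> ` cball (\<phi> m) r"
  define \<theta> where "\<theta> x = (if x \<in> W then ball_bump (\<phi> m) r (\<phi> x) else 0)" for x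
  have "continuous_on (cball (\<phi> m) r) (inv_into W \<phi>)"
    using chart_inv_continuous[OF A W(1)] r(2) by (auto intro: continuous_on_subset)
  then have "compact K" unfolding K_def
    by (rule compact_continuous_image) (rule compact_cball_finite_dim[OF charted_finite_dim[OF A]])
  then have K: "closed K" by (rule compact_imp_closed)
  have KU: "K \<subseteq> W \<inter> U" using r(2) by (auto simp: K_def chart_inv[OF A W(1)] subset_iff image_iff)
  have \<theta>0: "\<theta> x = 0" if "x \<notin> K" for x
  proof (cases "x \<in> W")
    case True
    then have "\<phi> x \<notin> cball (\<phi> m) r"
      using that chart_inv[OF A W(1) True] unfolding K_def by (metis image_eqI)
    then show ?thesis
      using r(1) by (auto simp: \<theta>_def dist_norm norm_minus_commute intro!: ball_bump_eq_0)
  qed (simp add: \<theta>_def)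
  have "smooth_fun A W (\<lambda>x. ball_bump (\<phi> m) r (\<phi> x))"
    unfolding smooth_fun_iff[OF A oW]
  proof clarify
    fix V \<psi> assume V: "(V, \<psi>) \<in> A"
    have o: "open (\<psi> ` (V \<inter> W))"
      by (rule chart_open_image[OF A V]) (use oW chart_open[OF A V] in auto)
    have "smooth_on (\<psi> ` (V \<inter> W)) (\<lambda>y. ball_bump (\<phi> m) r ((\<phi> \<circ> inv_into V \<psi>) y))"
      by (rule smooth_on_compose[OF charted_finite_dim[OF A] o subset_UNIV
            manifold_transition[OF assms(1) V W(1)] smooth_on_ball_bump]) simp
    then show "smooth_on (\<psi> ` (V \<inter> W)) ((\<lambda>x. ball_bump (\<phi> m) r (\<phi> x)) \<circ> inv_into V \<psi>)"
      by (simp add: comp_def)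
  qed
  then have "smooth_fun A W \<theta>"
    by (rule smooth_fun_cong[OF A oW, rotated]) (simp add: \<theta>_def)
  moreover have "smooth_fun A (- K) \<theta>"
    by (rule smooth_fun_cong[OF A _ _ smooth_fun_const[of _ _ 0]]) (use K \<theta>0 in auto)
  \<comment> \<open>The open sets \<open>W\<close> and \<open>- K\<close> cover the
    manifold.\<close>
  ultimately have "smooth_fun A UNIV \<theta>"
    using oW K KU by (intro smooth_fun_local[OF A]) (metis ComplI IntD1 open_Compl subsetD)
  then show ?thesis
    using that[of \<theta> K] ball_bump_center[OF r(1)] K KU \<theta>0 W(2) by (auto simp: \<theta>_def)
qed

text \<open>Here f is smooth on U only. On U the function g is a product, on the open complement of
  K it vanishes, and the two sets cover everything.\<close>

lemma smooth_fun_extend_zero: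
  fixes A :: "('a::t2_space, 'e::real_inner) atlas"
  assumes A: "charted A" and "open U" "closed K" "K \<subseteq> U" "smooth_fun A U f" "smooth_fun A UNIV \<theta>"
    "\<And>x. x \<notin> K \<Longrightarrow> \<theta> x = 0" "\<And>x. x \<in> U \<Longrightarrow> g x = \<theta> x * f x" "\<And>x. x \<notin> U \<Longrightarrow> g x = 0"
  shows "smooth_fun A UNIV g"
proof (rule smooth_fun_local[OF A])
  have "smooth_fun A U (\<lambda>x. \<theta> x * f x)"
    by (intro smooth_fun_mult[OF A assms(2)] smooth_map_on_subset[OF assms(6)] assms(5)) auto
  then have U: "smooth_fun A U g"
    by (rule smooth_fun_cong[OF A assms(2), rotated]) (simp add: assms(8))
  have K: "smooth_fun A (- K) g"
  proof (rule smooth_fun_cong[OF A _ _ smooth_fun_const[of _ _ 0]])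
    show "0 = g x" if "x \<in> - K" for x
      using that assms(7-9) by (cases "x \<in> U") auto
  qed (use assms(3) in auto)
  fix x
  show "\<exists>T. open T \<and> x \<in> T \<and> smooth_fun A T g"
    using U K assms(2-4) by (cases "x \<in> K") (auto intro: exI[of _ U] exI[of _ "- K"])
qed


section \<open>Modules of formal power series\<close>

text \<open>The module laws of HOL-Algebra refer to a ring record, while the scalars of the modules
  here are a whole type; this record connects the two.\<close>

definition complex_ring :: "complex ring" where
  "complex_ring = \<lparr>carrier = UNIV, mult = (*), one = 1, zero = 0, add = (+)\<rparr>"

lemma complex_ring_simps [simp]:
  "carrier complex_ring = UNIV" "mult complex_ring = (*)" "one complex_ring = 1"
  "zero complex_ring = 0" "add complex_ring = (+)"
  by (simp_all add: complex_ring_def)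

lemma cring_complex_ring: "cring complex_ring"
proof (rule cringI)
  show "abelian_group complex_ring"
  proof (rule abelian_groupI)
    show "\<exists>y\<in>carrier complex_ring. y \<oplus>\<^bsub>complex_ring\<^esub> x = \<zero>\<^bsub>complex_ring\<^esub>" for x
      by (rule bexI[of _ "- x"]) auto
  qed auto
  show "Group.comm_monoid complex_ring"
    by (rule comm_monoidI) auto
qed (auto simp: algebra_simps)

locale cmodule = Module.module complex_ring M for M :: "(complex, 'a) module" (structure)
begin

lemma smult_closed' [simp, intro]: "x \<in> carrier M \<Longrightarrow> c \<odot>\<^bsub>M\<^esub> x \<in> carrier M"
  using smult_closed by simp

lemma smult_add: "x \<in> carrier M \<Longrightarrow> (c + d) \<odot>\<^bsub>M\<^esub> x = c \<odot>\<^bsub>M\<^esub> x \<oplus>\<^bsub>M\<^esub> d \<odot>\<^bsub>M\<^esub> x"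
  using smult_l_distr[of c d x] by simp

lemma smult_0 [simp]: "x \<in> carrier M \<Longrightarrow> 0 \<odot>\<^bsub>M\<^esub> x = \<zero>\<^bsub>M\<^esub>"
  using smult_l_null[of x] by simp

lemma smult_1 [simp]: "x \<in> carrier M \<Longrightarrow> 1 \<odot>\<^bsub>M\<^esub> x = x"
  using smult_one[of x] by simp

lemma smult_zero [simp]: "c \<odot>\<^bsub>M\<^esub> \<zero>\<^bsub>M\<^esub> = \<zero>\<^bsub>M\<^esub>"
  using smult_r_null[of c] by simp

lemma smult_minus: "x \<in> carrier M \<Longrightarrow> x \<oplus>\<^bsub>M\<^esub> (- 1) \<odot>\<^bsub>M\<^esub> x = \<zero>\<^bsub>M\<^esub>"
  using smult_add[of x 1 "- 1"] by simp

end

text \<open>All modules considered here embed into functions with values in a complex vector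
  space, with pointwise operations; this reduces the module laws to closedness.\<close>

locale cmodule_embedding = vector_space scale
  for scale :: "complex \<Rightarrow> 'w::ab_group_add \<Rightarrow> 'w" +
  fixes M :: "(complex, 'a) module" and \<iota> :: "'a \<Rightarrow> 'i \<Rightarrow> 'w"
  assumes emb_inj: "x \<in> carrier M \<Longrightarrow> y \<in> carrier M \<Longrightarrow> (\<And>i. \<iota> x i = \<iota> y i) \<Longrightarrow> x = y"
    and emb_zero_closed: "\<zero>\<^bsub>M\<^esub> \<in> carrier M"
    and emb_add_closed: "x \<in> carrier M \<Longrightarrow> y \<in> carrier M \<Longrightarrow> x \<oplus>\<^bsub>M\<^esub> y \<in> carrier M"
    and emb_smult_closed: "x \<in> carrier M \<Longrightarrow> c \<odot>\<^bsub>M\<^esub> x \<in> carrier M"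
    and emb_zero: "\<iota> \<zero>\<^bsub>M\<^esub> i = 0"
    and emb_add: "x \<in> carrier M \<Longrightarrow> y \<in> carrier M \<Longrightarrow> \<iota> (x \<oplus>\<^bsub>M\<^esub> y) i = \<iota> x i + \<iota> y i"
    and emb_smult: "x \<in> carrier M \<Longrightarrow> \<iota> (c \<odot>\<^bsub>M\<^esub> x) i = scale c (\<iota> x i)"
begin

lemma cmodule: "cmodule M"
proof -
  note closed = emb_zero_closed emb_add_closed emb_smult_closed
  note emb = emb_zero emb_add emb_smult closed
  have "abelian_group M"
  proof (rule abelian_groupI)
    fix x y z assume xyz: "x \<in> carrier M" "y \<in> carrier M" "z \<in> carrier M"
    show "x \<oplus>\<^bsub>M\<^esub> y \<oplus>\<^bsub>M\<^esub> z = x \<oplus>\<^bsub>M\<^esub> (y \<oplus>\<^bsub>M\<^esub> z)"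
      using xyz by (intro emb_inj) (simp_all add: emb add.assoc)
  next
    fix x y assume xy: "x \<in> carrier M" "y \<in> carrier M"
    show "x \<oplus>\<^bsub>M\<^esub> y = y \<oplus>\<^bsub>M\<^esub> x"
      using xy by (intro emb_inj) (simp_all add: emb add.commute)
  next
    fix x assume x: "x \<in> carrier M"
    then show "\<exists>y\<in>carrier M. y \<oplus>\<^bsub>M\<^esub> x = \<zero>\<^bsub>M\<^esub>"
      by (intro bexI[of _ "(- 1) \<odot>\<^bsub>M\<^esub> x"] emb_inj) (simp_all add: emb)
    show "\<zero>\<^bsub>M\<^esub> \<oplus>\<^bsub>M\<^esub> x = x"
      using x by (intro emb_inj) (simp_all add: emb)
  qed (simp_all add: closed)
  then show ?thesis
    unfolding cmodule_def
    by (intro Module.moduleI cring_complex_ring; (assumption | intro emb_inj)?)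
      (simp_all add: emb scale_left_distrib scale_right_distrib)
qed

text \<open>Turns the record-based finite sums, in which the series operations are written, into
  ordinary sums of values.\<close>

lemma emb_finsum:
  assumes "finite I" "\<And>j. j \<in> I \<Longrightarrow> f j \<in> carrier M"
  shows "\<iota> (\<Oplus>\<^bsub>M\<^esub>j\<in>I. f j) i = (\<Sum>j\<in>I. \<iota> (f j) i)" "(\<Oplus>\<^bsub>M\<^esub>j\<in>I. f j) \<in> carrier M"
proof -
  interpret cmodule M by (rule cmodule)
  show "\<iota> (\<Oplus>\<^bsub>M\<^esub>j\<in>I. f j) i = (\<Sum>j\<in>I. \<iota> (f j) i)"
    using assms
  proof (induction I)
    case (insert j I)
    then have "(\<Oplus>\<^bsub>M\<^esub>j\<in>insert j I. f j) = f j \<oplus>\<^bsub>M\<^esub> (\<Oplus>\<^bsub>M\<^esub>j\<in>I. f j)"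
      by (intro finsum_insert) auto
    moreover have "(\<Oplus>\<^bsub>M\<^esub>j\<in>I. f j) \<in> carrier M"
      using insert by (intro finsum_closed) auto
    ultimately show ?case using insert by (simp add: emb_add)
  qed (simp add: emb_zero)
  show "(\<Oplus>\<^bsub>M\<^esub>j\<in>I. f j) \<in> carrier M"
    using assms by (intro finsum_closed) auto
qed

end

definition const_series :: "(complex, 'a) module \<Rightarrow> 'a \<Rightarrow> 'a fps" where
  "const_series M x = Abs_fps (\<lambda>n. if n = 0 then x else \<zero>\<^bsub>M\<^esub>)"

text \<open>Multiplication by the formal parameter; \<open>smult_X\<close> identifies it with the
  scalar \<open>fps_X\<close>. Conversely \<open>shift_down\<close> divides by the parameter after
  dropping the constant term.\<close>

definition shift_up :: "(complex, 'a) module \<Rightarrow> 'a fps \<Rightarrow> 'a fps" where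
  "shift_up M x = Abs_fps (\<lambda>n. if n = 0 then \<zero>\<^bsub>M\<^esub> else fps_nth x (n - 1))"

definition shift_down :: "'a fps \<Rightarrow> 'a fps" where
  "shift_down x = Abs_fps (\<lambda>n. fps_nth x (Suc n))"

lemma series_nth [simp]:
  "fps_nth \<zero>\<^bsub>series M\<^esub> n = \<zero>\<^bsub>M\<^esub>"
  "fps_nth (x \<oplus>\<^bsub>series M\<^esub> y) n = fps_nth x n \<oplus>\<^bsub>M\<^esub> fps_nth y n"
  "fps_nth (const_series M a) n = (if n = 0 then a else \<zero>\<^bsub>M\<^esub>)"
  "fps_nth (shift_up M x) n = (if n = 0 then \<zero>\<^bsub>M\<^esub> else fps_nth x (n - 1))"
  "fps_nth (shift_down x) n = fps_nth x (Suc n)"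
  by (simp_all add: series_def const_series_def shift_up_def shift_down_def)

lemma carrier_series: "x \<in> carrier (series M) \<longleftrightarrow> (\<forall>n. fps_nth x n \<in> carrier M)"
  by (simp add: series_def)

lemma carrier_seriesD [simp]: "x \<in> carrier (series M) \<Longrightarrow> fps_nth x n \<in> carrier M"
  by (simp add: carrier_series)

lemma shift_down_closed [simp]: "x \<in> carrier (series M) \<Longrightarrow> shift_down x \<in> carrier (series M)"
  by (simp add: carrier_series)

lemma nth_smult_series:
  "fps_nth (c \<odot>\<^bsub>series M\<^esub> x) n = (\<Oplus>\<^bsub>M\<^esub>i\<in>{..n}. fps_nth c i \<odot>\<^bsub>M\<^esub> fps_nth x (n - i))"
  by (simp only: series_def module.select_convs fps_nth_Abs_fps)

context cmodule
begin

lemma series_closed [simp]: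
  "\<zero>\<^bsub>series M\<^esub> \<in> carrier (series M)"
  "x \<in> carrier (series M) \<Longrightarrow> y \<in> carrier (series M) \<Longrightarrow> x \<oplus>\<^bsub>series M\<^esub> y \<in> carrier (series M)"
  "a \<in> carrier M \<Longrightarrow> const_series M a \<in> carrier (series M)"
  "x \<in> carrier (series M) \<Longrightarrow> shift_up M x \<in> carrier (series M)"
  by (simp_all add: carrier_series)

lemma smult_series_closed [simp]: "x \<in> carrier (series M) \<Longrightarrow> c \<odot>\<^bsub>series M\<^esub> x \<in> carrier (series M)"
  by (auto simp: carrier_series nth_smult_series intro!: finsum_closed)

lemma nth_smult_const:
  assumes "x \<in> carrier (series M)"
  shows "fps_nth (fps_const a \<odot>\<^bsub>series M\<^esub> x) n = a \<odot>\<^bsub>M\<^esub> fps_nth x n"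
proof -
  have "(\<Oplus>\<^bsub>M\<^esub>i\<in>{..n}. fps_nth (fps_const a) i \<odot>\<^bsub>M\<^esub> fps_nth x (n - i)) =
      (\<Oplus>\<^bsub>M\<^esub>i\<in>{..n}. if 0 = i then a \<odot>\<^bsub>M\<^esub> fps_nth x (n - i) else \<zero>\<^bsub>M\<^esub>)"
    using assms by (intro finsum_cong') auto
  also have "\<dots> = a \<odot>\<^bsub>M\<^esub> fps_nth x (n - 0)"
    using assms by (intro finsum_singleton) auto
  finally show ?thesis by (simp add: nth_smult_series)
qed

lemma smult_X:
  assumes "x \<in> carrier (series M)"
  shows "fps_X \<odot>\<^bsub>series M\<^esub> x = shift_up M x"
proof (rule fps_ext)
  fix n
  show "fps_nth (fps_X \<odot>\<^bsub>series M\<^esub> x) n = fps_nth (shift_up M x) n"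
  proof (cases n)
    case 0
    then show ?thesis using assms by (simp add: nth_smult_series)
  next
    case (Suc m)
    have "(\<Oplus>\<^bsub>M\<^esub>i\<in>{..n}. fps_nth fps_X i \<odot>\<^bsub>M\<^esub> fps_nth x (n - i)) =
        (\<Oplus>\<^bsub>M\<^esub>i\<in>{..n}. if 1 = i then fps_nth x (n - i) else \<zero>\<^bsub>M\<^esub>)"
      using assms by (intro finsum_cong') auto
    also have "\<dots> = fps_nth x (n - 1)"
      using assms Suc by (intro finsum_singleton) auto
    finally show ?thesis using Suc by (simp add: nth_smult_series)
  qed
qed

text \<open>Splits off the summand i = 0 of the Cauchy product; the remaining ones carry a factor of
  the formal parameter.\<close>

lemma smult_series_rec:
  assumes "x \<in> carrier (series M)"
  shows "c \<odot>\<^bsub>series M\<^esub> x =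
    fps_const (fps_nth c 0) \<odot>\<^bsub>series M\<^esub> x \<oplus>\<^bsub>series M\<^esub> shift_up M (shift_down c \<odot>\<^bsub>series M\<^esub> x)"
proof (rule fps_ext)
  fix n
  show "fps_nth (c \<odot>\<^bsub>series M\<^esub> x) n = fps_nth (fps_const (fps_nth c 0) \<odot>\<^bsub>series M\<^esub> x \<oplus>\<^bsub>series M\<^esub>
      shift_up M (shift_down c \<odot>\<^bsub>series M\<^esub> x)) n"
  proof (cases n)
    case 0
    then show ?thesis using assms by (simp add: nth_smult_const) (simp add: nth_smult_series)
  next
    case (Suc m)
    have "(\<Oplus>\<^bsub>M\<^esub>i\<in>{..Suc m}. fps_nth c i \<odot>\<^bsub>M\<^esub> fps_nth x (Suc m - i)) =
      (\<Oplus>\<^bsub>M\<^esub>i\<in>{..m}. fps_nth c (Suc i) \<odot>\<^bsub>M\<^esub> fps_nth x (Suc m - Suc i)) \<oplus>\<^bsub>M\<^esub> fps_nth c 0 \<odot>\<^bsub>M\<^esub> fps_nth x (Suc m - 0)"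
      using assms by (intro finsum_Suc2) auto
    then show ?thesis
      using assms Suc by (simp add: nth_smult_const) (simp add: nth_smult_series a_comm assms)
  qed
qed

lemma series_decompose:
  assumes "x \<in> carrier (series M)"
  shows "x = const_series M (fps_nth x 0) \<oplus>\<^bsub>series M\<^esub> shift_up M (shift_down x)"
  using assms by (intro fps_ext) (simp add: carrier_series)

lemma smult_minus_series:
  assumes "x \<in> carrier (series M)" "y \<in> carrier (series M)"
  shows "x = y \<oplus>\<^bsub>series M\<^esub> (x \<oplus>\<^bsub>series M\<^esub> fps_const (- 1) \<odot>\<^bsub>series M\<^esub> y)"
proof (rule fps_ext)
  fix n
  have "fps_nth y n \<oplus>\<^bsub>M\<^esub> (fps_nth x n \<oplus>\<^bsub>M\<^esub> (- 1) \<odot>\<^bsub>M\<^esub> fps_nth y n) =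
      fps_nth x n \<oplus>\<^bsub>M\<^esub> (fps_nth y n \<oplus>\<^bsub>M\<^esub> (- 1) \<odot>\<^bsub>M\<^esub> fps_nth y n)"
    using assms by (intro a_lcomm) auto
  then show "fps_nth x n = fps_nth (y \<oplus>\<^bsub>series M\<^esub> (x \<oplus>\<^bsub>series M\<^esub> fps_const (- 1) \<odot>\<^bsub>series M\<^esub> y)) n"
    using assms by (simp add: nth_smult_const smult_minus)
qed

end

section \<open>Linear maps of series modules and lifting order by order\<close>

lemma linear_map_closed: "linear_map M N T \<Longrightarrow> x \<in> carrier M \<Longrightarrow> T x \<in> carrier N"
  unfolding linear_map_def by blast

lemma linear_map_add:
  "linear_map M N T \<Longrightarrow> x \<in> carrier M \<Longrightarrow> y \<in> carrier M \<Longrightarrow> T (x \<oplus>\<^bsub>M\<^esub> y) = T x \<oplus>\<^bsub>N\<^esub> T y"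
  unfolding linear_map_def by blast

lemma linear_map_smult: "linear_map M N T \<Longrightarrow> x \<in> carrier M \<Longrightarrow> T (c \<odot>\<^bsub>M\<^esub> x) = c \<odot>\<^bsub>N\<^esub> T x"
  unfolding linear_map_def by blast

text \<open>Writing \<open>c = c\<^sub>0 + \<lambda> c'\<close>, homogeneity for \<open>c\<close> follows order by order from \<open>const\<close> and \<open>X\<close>.\<close>

lemma linear_map_seriesI:
  assumes "cmodule M" "cmodule N"
    and closed: "\<And>x. x \<in> carrier (series M) \<Longrightarrow> T x \<in> carrier (series N)"
    and add: "\<And>x y. x \<in> carrier (series M) \<Longrightarrow> y \<in> carrier (series M) \<Longrightarrow>
      T (x \<oplus>\<^bsub>series M\<^esub> y) = T x \<oplus>\<^bsub>series N\<^esub> T y"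
    and const: "\<And>x a. x \<in> carrier (series M) \<Longrightarrow>
      T (fps_const a \<odot>\<^bsub>series M\<^esub> x) = fps_const a \<odot>\<^bsub>series N\<^esub> T x"
    and X: "\<And>x. x \<in> carrier (series M) \<Longrightarrow> T (shift_up M x) = shift_up N (T x)"
  shows "linear_map (series M) (series N) T"
proof -
  interpret M: cmodule M by fact
  interpret N: cmodule N by fact
  have "fps_nth (T (c \<odot>\<^bsub>series M\<^esub> x)) n = fps_nth (c \<odot>\<^bsub>series N\<^esub> T x) n"
    if "x \<in> carrier (series M)" for c x n
    using that
  proof (induction n arbitrary: c x rule: less_induct)
    case (less n)
    have "T (c \<odot>\<^bsub>series M\<^esub> x) = fps_const (fps_nth c 0) \<odot>\<^bsub>series N\<^esub> T x \<oplus>\<^bsub>series N\<^esub>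
        shift_up N (T (shift_down c \<odot>\<^bsub>series M\<^esub> x))"
      using less.prems by (subst M.smult_series_rec) (simp_all add: add const X)
    moreover have "c \<odot>\<^bsub>series N\<^esub> T x = fps_const (fps_nth c 0) \<odot>\<^bsub>series N\<^esub> T x \<oplus>\<^bsub>series N\<^esub>
        shift_up N (shift_down c \<odot>\<^bsub>series N\<^esub> T x)"
      using less.prems by (intro N.smult_series_rec closed)
    \<comment> \<open>At n = 0 both shifted terms have coefficient zero; for positive n their
      coefficient has order n - 1, where the induction hypothesis applies.\<close>
    ultimately show ?case
      using less.IH[of "n - 1" x "shift_down c"] less.prems by simp
  qed
  then have "T (c \<odot>\<^bsub>series M\<^esub> x) = c \<odot>\<^bsub>series N\<^esub> T x" if "x \<in> carrier (series M)" for c x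
    using that by (intro fps_ext)
  then show ?thesis unfolding linear_map_def using closed add by blast
qed

text \<open>The remainder is divided by the formal parameter and the process repeated. The index \<open>i\<close>
  allows one to match a linear map at all its arguments simultaneously.\<close>

lemma series_lifting:
  assumes "cmodule X" "cmodule Y"
    and lin: "\<And>i. i \<in> I \<Longrightarrow> linear_map (series X) (series Y) (\<Phi> i)"
    and closed: "\<And>t i. t \<in> \<T> \<Longrightarrow> i \<in> I \<Longrightarrow> t i \<in> carrier (series Y)"
    and step: "\<And>t. t \<in> \<T> \<Longrightarrow> \<exists>x\<in>carrier X. \<exists>t'\<in>\<T>. \<forall>i\<in>I.
      t i = \<Phi> i (const_series X x) \<oplus>\<^bsub>series Y\<^esub> shift_up Y (t' i)"
    and t: "t \<in> \<T>"
  obtains x where "x \<in> carrier (series X)" "\<And>i. i \<in> I \<Longrightarrow> t i = \<Phi> i x"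
proof -
  interpret X: cmodule X by fact
  interpret Y: cmodule Y by fact
  \<comment> \<open>A choice function giving for each target its lowest coefficient and the
    remainder already divided by the parameter.\<close>
  obtain f0 where f0: "\<And>t. t \<in> \<T> \<Longrightarrow> fst (f0 t) \<in> carrier X \<and> snd (f0 t) \<in> \<T> \<and> (\<forall>i\<in>I.
      t i = \<Phi> i (const_series X (fst (f0 t))) \<oplus>\<^bsub>series Y\<^esub> shift_up Y (snd (f0 t) i))"
  proof -
    have "\<exists>p. fst p \<in> carrier X \<and> snd p \<in> \<T> \<and> (\<forall>i\<in>I.
      t i = \<Phi> i (const_series X (fst p)) \<oplus>\<^bsub>series Y\<^esub> shift_up Y (snd p i))" if "t \<in> \<T>" for t
    proof -
      obtain x t' where "x \<in> carrier X" "t' \<in> \<T>" "\<forall>i\<in>I.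
          t i = \<Phi> i (const_series X x) \<oplus>\<^bsub>series Y\<^esub> shift_up Y (t' i)"
        using step[OF \<open>t \<in> \<T>\<close>] by (elim bexE) (rule that)
      then show ?thesis by (intro exI[of _ "(x, t')"]) simp
    qed
    then show ?thesis by (intro that[of "\<lambda>t. SOME p. fst p \<in> carrier X \<and> snd p \<in> \<T> \<and> (\<forall>i\<in>I.
      t i = \<Phi> i (const_series X (fst p)) \<oplus>\<^bsub>series Y\<^esub> shift_up Y (snd p i))"]) (rule someI_ex)
  qed
  \<comment> \<open>\<open>u n\<close> is what is left of t after n divisions; its lowest
    coefficient \<open>x n\<close> becomes the n-th coefficient of the solution.\<close>
  define u where "u n = ((\<lambda>t. snd (f0 t)) ^^ n) t" for n
  have u: "u n \<in> \<T>" for n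
    by (induction n) (use t f0 in \<open>auto simp: u_def\<close>)
  define x where "x n = fst (f0 (u n))" for n
  have x: "x n \<in> carrier X" for n
    using f0[OF u] by (simp add: x_def)
  have rec: "u n i = \<Phi> i (const_series X (x n)) \<oplus>\<^bsub>series Y\<^esub> shift_up Y (u (Suc n) i)" if "i \<in> I" for n i
    using f0[OF u] that by (simp add: x_def u_def)
  define tail where "tail n = Abs_fps (\<lambda>k. x (n + k))" for n
  have tail: "tail n \<in> carrier (series X)" for n
    using x by (simp add: tail_def carrier_series)
  have tail_rec: "tail n = const_series X (x n) \<oplus>\<^bsub>series X\<^esub> shift_up X (tail (Suc n))" for n
    using x by (intro fps_ext) (simp add: tail_def)
  \<comment> \<open>The remainder \<open>u n\<close> should be solved by the tail of the series from
    n on. Linearity in the parameter reduces order k of this claim to order k - 1 of the claim for n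
    + 1, so it is proved for all n together and no limit is involved.\<close>
  have "fps_nth (u n i) k = fps_nth (\<Phi> i (tail n)) k" if i: "i \<in> I" for n i k
  proof (induction k arbitrary: n rule: less_induct)
    case (less k)
    have "\<Phi> i (tail n) = \<Phi> i (const_series X (x n)) \<oplus>\<^bsub>series Y\<^esub> \<Phi> i (fps_X \<odot>\<^bsub>series X\<^esub> tail (Suc n))"
      using linear_map_add[OF lin[OF i]] tail_rec[of n] tail[of "Suc n"] x by (simp add: X.smult_X)
    also have "\<Phi> i (fps_X \<odot>\<^bsub>series X\<^esub> tail (Suc n)) = shift_up Y (\<Phi> i (tail (Suc n)))"
      using linear_map_smult[OF lin[OF i] tail] linear_map_closed[OF lin[OF i] tail] by (simp add: Y.smult_X)
    finally show ?case using rec[OF i, of n] less.IH[of "k - 1" "Suc n"] by simp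
  qed
  then have "u 0 i = \<Phi> i (tail 0)" if "i \<in> I" for i
    using that by (intro fps_ext)
  then show ?thesis using that[OF tail] by (simp add: u_def)
qed


section \<open>Deformed bimodules over power series\<close>

text \<open>\<open>K\<close> and \<open>B\<close> are left actions on the series over \<open>Sec\<close>,
  both commuting with the right multiplications \<open>r a\<close>; \<open>B\<close> deforms the evaluation \<open>ev\<close>. The
  assumption \<open>tensorial\<close> says that in lowest order nothing but \<open>Eop\<close> commutes with the right
  multiplications, and \<open>lowest_onto\<close> that \<open>K\<close> reaches all of \<open>Eop\<close> in lowest order.\<close>

locale deformed_commutant =
  I: cmodule Iop + E: cmodule Eop + S: cmodule Sec
  for Iop :: "(complex, 'i) module" and Eop :: "(complex, 'e) module" and Sec :: "(complex, 's) module" +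
  fixes K :: "'i fps \<Rightarrow> 's fps \<Rightarrow> 's fps" and B :: "'e fps \<Rightarrow> 's fps \<Rightarrow> 's fps"
    and ev :: "'e \<Rightarrow> 's \<Rightarrow> 's" and r :: "'a \<Rightarrow> 's fps \<Rightarrow> 's fps" and Alg :: "'a set"
  assumes K: "bilinear_map (series Iop) (series Sec) (series Sec) K"
    and B: "bilinear_map (series Eop) (series Sec) (series Sec) B"
    and r: "a \<in> Alg \<Longrightarrow> linear_map (series Sec) (series Sec) (r a)"
    and K_r: "D \<in> carrier (series Iop) \<Longrightarrow> s \<in> carrier (series Sec) \<Longrightarrow> a \<in> Alg \<Longrightarrow>
      K D (r a s) = r a (K D s)"
    and B_r: "A \<in> carrier (series Eop) \<Longrightarrow> s \<in> carrier (series Sec) \<Longrightarrow> a \<in> Alg \<Longrightarrow>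
      B A (r a s) = r a (B A s)"
    and B_lowest: "A \<in> carrier (series Eop) \<Longrightarrow> s \<in> carrier (series Sec) \<Longrightarrow>
      fps_nth (B A s) 0 = ev (fps_nth A 0) (fps_nth s 0)"
    and tensorial: "linear_map (series Sec) (series Sec) T \<Longrightarrow>
      (\<And>s a. s \<in> carrier (series Sec) \<Longrightarrow> a \<in> Alg \<Longrightarrow> T (r a s) = r a (T s)) \<Longrightarrow>
      \<exists>e\<in>carrier Eop. \<forall>s\<in>carrier (series Sec). fps_nth (T s) 0 = ev e (fps_nth s 0)"
    and faithful: "e \<in> carrier Eop \<Longrightarrow> e' \<in> carrier Eop \<Longrightarrow>
      (\<And>x. x \<in> carrier Sec \<Longrightarrow> ev e x = ev e' x) \<Longrightarrow> e = e'"
    and lowest_onto: "e \<in> carrier Eop \<Longrightarrow> \<exists>d\<in>carrier Iop. \<forall>x\<in>carrier Sec.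
      fps_nth (K (const_series Iop d) (const_series Sec x)) 0 = ev e x"
begin

abbreviation "SI \<equiv> series Iop"
abbreviation "SE \<equiv> series Eop"
abbreviation "SS \<equiv> series Sec"

lemma B_linear:
  "A \<in> carrier SE \<Longrightarrow> linear_map SS SS (B A)"
  "s \<in> carrier SS \<Longrightarrow> linear_map SE SS (\<lambda>A. B A s)"
  using B unfolding bilinear_map_def by blast+

lemma K_linear:
  "D \<in> carrier SI \<Longrightarrow> linear_map SS SS (K D)"
  "s \<in> carrier SS \<Longrightarrow> linear_map SI SS (\<lambda>D. K D s)"
  using K unfolding bilinear_map_def by blast+

lemma B_closed: "A \<in> carrier SE \<Longrightarrow> s \<in> carrier SS \<Longrightarrow> B A s \<in> carrier SS"
  by (rule linear_map_closed[OF B_linear(1)])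

lemma K_closed: "D \<in> carrier SI \<Longrightarrow> s \<in> carrier SS \<Longrightarrow> K D s \<in> carrier SS"
  by (rule linear_map_closed[OF K_linear(1)])

lemma B_decompose:
  assumes "A \<in> carrier SE" "s \<in> carrier SS"
  shows "B A s = B (const_series Eop (fps_nth A 0)) s \<oplus>\<^bsub>SS\<^esub> shift_up Sec (B (shift_down A) s)"
proof -
  have "B A s = B (const_series Eop (fps_nth A 0)) s \<oplus>\<^bsub>SS\<^esub> B (fps_X \<odot>\<^bsub>SE\<^esub> shift_down A) s"
    using linear_map_add[OF B_linear(2)[OF assms(2)], of "const_series Eop (fps_nth A 0)" "shift_up Eop (shift_down A)"]
      E.series_decompose[OF assms(1)] assms by (simp add: E.smult_X)
  then show ?thesis
    using linear_map_smult[OF B_linear(2)[OF assms(2)]] assms B_closed by (simp add: S.smult_X)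
qed

text \<open>Constant terms agree by \<open>faithful\<close>. Cancelling them and dividing by the
  parameter gives the same situation for the shifted series, so induction on the order, general in
  both series, finishes.\<close>

lemma B_inj:
  assumes "A \<in> carrier SE" "A' \<in> carrier SE"
    "\<And>s. s \<in> carrier SS \<Longrightarrow> B A s = B A' s"
  shows "A = A'"
proof -
  have low: "fps_nth A 0 = fps_nth A' 0"
    if "A \<in> carrier SE" "A' \<in> carrier SE"
      "\<And>s. s \<in> carrier SS \<Longrightarrow> B A s = B A' s" for A A'
  proof (rule faithful)
    fix s assume s: "s \<in> carrier Sec"
    then show "ev (fps_nth A 0) s = ev (fps_nth A' 0) s"
      using B_lowest[OF that(1), of "const_series Sec s"] B_lowest[OF that(2), of "const_series Sec s"]
        that(3)[of "const_series Sec s"] by simp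
  qed (use that in auto)
  have "fps_nth A n = fps_nth A' n" for n
    using assms
  proof (induction n arbitrary: A A')
    case 0
    then show ?case by (intro low)
  next
    case (Suc n)
    have "fps_nth (shift_down A) n = fps_nth (shift_down A') n"
    proof (rule Suc.IH)
      fix s assume s: "s \<in> carrier SS"
      note closed = B_closed[OF shift_down_closed[OF Suc.prems(1)] s] B_closed[OF shift_down_closed[OF Suc.prems(2)] s]
        B_closed[OF E.series_closed(3)[OF carrier_seriesD[OF Suc.prems(2), of 0]] s]
      have "B (const_series Eop (fps_nth A' 0)) s \<oplus>\<^bsub>SS\<^esub> shift_up Sec (B (shift_down A) s) =
          B (const_series Eop (fps_nth A' 0)) s \<oplus>\<^bsub>SS\<^esub> shift_up Sec (B (shift_down A') s)"
        using B_decompose[OF Suc.prems(1) s] B_decompose[OF Suc.prems(2) s] Suc.prems(3)[OF s]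
          low[OF Suc.prems] by simp
      then have "fps_nth (B (const_series Eop (fps_nth A' 0)) s) (Suc k) \<oplus>\<^bsub>Sec\<^esub> fps_nth (B (shift_down A) s) k =
          fps_nth (B (const_series Eop (fps_nth A' 0)) s) (Suc k) \<oplus>\<^bsub>Sec\<^esub> fps_nth (B (shift_down A') s) k" for k
        by (metis series_nth(2,4) diff_Suc_1 nat.distinct(1))
      then show "B (shift_down A) s = B (shift_down A') s"
        using closed by (intro fps_ext) (simp add: carrier_series)
    qed (use Suc.prems in auto)
    then show ?case by simp
  qed
  then show ?thesis by (rule fps_ext)
qed

lemma commutant_eq:
  assumes T: "linear_map SS SS T"
    "\<And>s a. s \<in> carrier SS \<Longrightarrow> a \<in> Alg \<Longrightarrow> T (r a s) = r a (T s)"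
  shows "\<exists>A\<in>carrier SE. \<forall>s\<in>carrier SS. T s = B A s"
proof -
  \<comment> \<open>All linear operators commuting with the right multiplications. The process can
    be iterated because the divided remainder belongs to this set again.\<close>
  define \<T> where "\<T> = {T. linear_map SS SS T \<and>
    (\<forall>s\<in>carrier SS. \<forall>a\<in>Alg. T (r a s) = r a (T s))}"
  have step: "\<exists>A\<in>carrier Eop. \<exists>T'\<in>\<T>. \<forall>s\<in>carrier SS.
      T s = B (const_series Eop A) s \<oplus>\<^bsub>SS\<^esub> shift_up Sec (T' s)" if "T \<in> \<T>" for T
  proof -
    have Tl: "linear_map SS SS T" and
      Tr: "\<And>s a. s \<in> carrier SS \<Longrightarrow> a \<in> Alg \<Longrightarrow> T (r a s) = r a (T s)"
      using that unfolding \<T>_def by auto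
    obtain A where A: "A \<in> carrier Eop"
      and low: "\<And>s. s \<in> carrier SS \<Longrightarrow> fps_nth (T s) 0 = ev A (fps_nth s 0)"
      using tensorial[OF Tl Tr] by blast
    let ?A = "const_series Eop A"
    have A': "?A \<in> carrier SE" using A by simp
    \<comment> \<open>By the choice of A the constant term of \<open>U s\<close> vanishes for every
      s, so \<open>U\<close> is divisible by the parameter.\<close>
    define U where "U s = T s \<oplus>\<^bsub>SS\<^esub> fps_const (- 1) \<odot>\<^bsub>SS\<^esub> B ?A s" for s
    note Tc = linear_map_closed[OF Tl] and Bc = B_closed[OF A']
    have Uc: "U s \<in> carrier SS" if "s \<in> carrier SS" for s
      using that by (simp add: U_def Tc Bc)
    have U0: "U s = shift_up Sec (shift_down (U s))" if s: "s \<in> carrier SS" for s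
    proof -
      have "fps_nth (U s) 0 = \<zero>\<^bsub>Sec\<^esub>"
        using s low[OF s] B_lowest[OF A' s] S.smult_minus[OF carrier_seriesD[OF Tc[OF s], of 0]]
        by (simp add: U_def S.nth_smult_const Tc Bc carrier_seriesD[OF Tc])
      then show ?thesis by (intro fps_ext) simp
    qed
    have Uadd: "U (s \<oplus>\<^bsub>SS\<^esub> t) = U s \<oplus>\<^bsub>SS\<^esub> U t"
      if "s \<in> carrier SS" "t \<in> carrier SS" for s t
      using that linear_map_add[OF Tl that] linear_map_add[OF B_linear(1)[OF A'] that]
      by (intro fps_ext) (simp add: U_def S.nth_smult_const Tc Bc S.smult_r_distr S.a_ac)
    have Uconst: "U (fps_const c \<odot>\<^bsub>SS\<^esub> s) = fps_const c \<odot>\<^bsub>SS\<^esub> U s"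
      if "s \<in> carrier SS" for s c
      using that linear_map_smult[OF Tl that] linear_map_smult[OF B_linear(1)[OF A'] that]
        S.smult_assoc1[of c "- 1"] S.smult_assoc1[of "- 1" c]
      by (intro fps_ext) (simp add: U_def S.nth_smult_const Tc Bc S.smult_r_distr)
    have UX: "U (shift_up Sec s) = shift_up Sec (U s)" if "s \<in> carrier SS" for s
    proof -
      have "T (shift_up Sec s) = shift_up Sec (T s)" "B ?A (shift_up Sec s) = shift_up Sec (B ?A s)"
        using linear_map_smult[OF Tl that, of fps_X] linear_map_smult[OF B_linear(1)[OF A'] that, of fps_X] that
        by (simp_all add: S.smult_X Tc Bc)
      then show ?thesis
        using that by (intro fps_ext) (simp add: U_def S.nth_smult_const Tc Bc)
    qed
    have Ur: "U (r a s) = r a (U s)" if "s \<in> carrier SS" "a \<in> Alg" for s a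
      using that linear_map_add[OF r[OF that(2)]] linear_map_smult[OF r[OF that(2)]]
      by (simp add: U_def Tr B_r[OF A'] Tc Bc)
    \<comment> \<open>\<open>U\<close> divided by the parameter. Its linearity and its commutation
      with \<open>r a\<close> come from those of \<open>U\<close>, because all maps involved commute
      with multiplication by the parameter, which can then be cancelled.\<close>
    define T' where "T' s = shift_down (U s)" for s
    have T'c: "T' s \<in> carrier SS" if "s \<in> carrier SS" for s
      using that Uc by (simp add: T'_def)
    have "linear_map SS SS T'"
    proof (rule linear_map_seriesI[OF S.cmodule_axioms S.cmodule_axioms T'c])
      show "T' (s \<oplus>\<^bsub>SS\<^esub> t) = T' s \<oplus>\<^bsub>SS\<^esub> T' t"
        if "s \<in> carrier SS" "t \<in> carrier SS" for s t
        using that by (intro fps_ext) (simp add: T'_def Uadd)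
      show "T' (fps_const c \<odot>\<^bsub>SS\<^esub> s) = fps_const c \<odot>\<^bsub>SS\<^esub> T' s"
        if "s \<in> carrier SS" for s c
        using that T'c[OF that] Uc[OF that]
        by (intro fps_ext) (simp add: S.nth_smult_const T'_def Uconst)
      show "T' (shift_up Sec s) = shift_up Sec (T' s)" if "s \<in> carrier SS" for s
        using U0[OF that] unfolding T'_def UX[OF that] by (intro fps_ext) simp
    qed
    moreover have "T' (r a s) = r a (T' s)" if s: "s \<in> carrier SS" and a: "a \<in> Alg" for s a
    proof -
      have "r a (shift_up Sec (T' s)) = shift_up Sec (r a (T' s))"
        using linear_map_smult[OF r[OF a] T'c[OF s], of fps_X] T'c[OF s] linear_map_closed[OF r[OF a]]
        by (simp add: S.smult_X)
      then have "U (r a s) = shift_up Sec (r a (T' s))"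
        using Ur[OF s a] U0[OF s] by (simp add: T'_def)
      then show ?thesis by (intro fps_ext) (simp add: T'_def)
    qed
    ultimately have "T' \<in> \<T>" by (simp add: \<T>_def)
    moreover have "T s = B ?A s \<oplus>\<^bsub>SS\<^esub> shift_up Sec (T' s)" if "s \<in> carrier SS" for s
      using S.smult_minus_series[OF Tc[OF that] Bc[OF that]] U0[OF that] by (simp add: U_def T'_def)
    ultimately show ?thesis using A by blast
  qed
  have T: "T \<in> \<T>" using T by (simp add: \<T>_def)
  have closed: "t s \<in> carrier SS" if "t \<in> \<T>" "s \<in> carrier SS" for t s
    using that linear_map_closed by (auto simp: \<T>_def)
  show ?thesis
  \<comment> \<open>The index set consists of all sections: a single series A must reproduce T on
    every one of them.\<close>
  proof (rule series_lifting[where \<Phi> = "\<lambda>s A. B A s" and I = "carrier SS"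
        and X = Eop and Y = Sec and \<T> = \<T> and t = T])
    show "linear_map SE SS (\<lambda>A. B A s)" if "s \<in> carrier SS" for s
      using that by (rule B_linear(2))
    show "t s \<in> carrier SS" if "t \<in> \<T>" "s \<in> carrier SS" for t s
      using that by (rule closed)
    show "\<exists>A\<in>carrier Eop. \<exists>T'\<in>\<T>. \<forall>s\<in>carrier SS.
        t s = B (const_series Eop A) s \<oplus>\<^bsub>SS\<^esub> shift_up Sec (T' s)" if "t \<in> \<T>" for t
      using that by (rule step)
  qed (use T E.cmodule_axioms S.cmodule_axioms in auto)
qed

section \<open>The homomorphism determined by the two left actions\<close>

definition \<phi> :: "'i fps \<Rightarrow> 'e fps" where
  "\<phi> D = (THE A. A \<in> carrier SE \<and> (\<forall>s\<in>carrier SS. K D s = B A s))"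

lemma phi_unique:
  "A \<in> carrier SE \<Longrightarrow> (\<And>s. s \<in> carrier SS \<Longrightarrow> K D s = B A s) \<Longrightarrow> \<phi> D = A"
  unfolding \<phi>_def by (rule the_equality) (auto intro: B_inj)

lemma phi:
  assumes "D \<in> carrier SI"
  shows "\<phi> D \<in> carrier SE" "s \<in> carrier SS \<Longrightarrow> K D s = B (\<phi> D) s"
proof -
  obtain A where A: "A \<in> carrier SE" "\<And>s. s \<in> carrier SS \<Longrightarrow> K D s = B A s"
    using commutant_eq[OF K_linear(1)[OF assms] K_r[OF assms]] by blast
  then have "\<phi> D = A" by (rule phi_unique)
  then show "\<phi> D \<in> carrier SE" "s \<in> carrier SS \<Longrightarrow> K D s = B (\<phi> D) s"
    using A by auto
qed

lemma phi_linear: "linear_map SI SE \<phi>"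
  unfolding linear_map_def
proof (intro conjI ballI allI)
  fix D D' c assume D: "D \<in> carrier SI" and D': "D' \<in> carrier SI"
  show "\<phi> (D \<oplus>\<^bsub>SI\<^esub> D') = \<phi> D \<oplus>\<^bsub>SE\<^esub> \<phi> D'"
  proof (rule phi_unique)
    fix s assume s: "s \<in> carrier SS"
    show "K (D \<oplus>\<^bsub>SI\<^esub> D') s = B (\<phi> D \<oplus>\<^bsub>SE\<^esub> \<phi> D') s"
      using linear_map_add[OF K_linear(2)[OF s] D D'] linear_map_add[OF B_linear(2)[OF s] phi(1)[OF D] phi(1)[OF D']]
        phi(2)[OF D s] phi(2)[OF D' s] by simp
  qed (use phi D D' in auto)
next
  fix D c assume D: "D \<in> carrier SI"
  show "\<phi> (c \<odot>\<^bsub>SI\<^esub> D) = c \<odot>\<^bsub>SE\<^esub> \<phi> D"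
  proof (rule phi_unique)
    fix s assume s: "s \<in> carrier SS"
    show "K (c \<odot>\<^bsub>SI\<^esub> D) s = B (c \<odot>\<^bsub>SE\<^esub> \<phi> D) s"
      using linear_map_smult[OF K_linear(2)[OF s] D] linear_map_smult[OF B_linear(2)[OF s] phi(1)[OF D]]
        phi(2)[OF D s] by simp
  qed (use phi D in auto)
qed (use phi in auto)

text \<open>A constant series d that acts in lowest order like the constant term of A has an image
  with that constant term, by \<open>faithful\<close>. The rest is the lifting with a one-element
  index set, since only one element has to be reached.\<close>

lemma phi_surj: "\<phi> ` carrier SI = carrier SE"
proof
  show "\<phi> ` carrier SI \<subseteq> carrier SE" using phi(1) by auto
  show "carrier SE \<subseteq> \<phi> ` carrier SI"
  proof
    fix A assume A: "A \<in> carrier SE"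
    have step: "\<exists>D\<in>carrier Iop. \<exists>t'\<in>{t. t () \<in> carrier SE}. \<forall>i\<in>{()}.
        t i = \<phi> (const_series Iop D) \<oplus>\<^bsub>SE\<^esub> shift_up Eop (t' i)"
      if "t \<in> {t. t () \<in> carrier SE}" for t
    proof -
      let ?A = "t ()"
      have A: "?A \<in> carrier SE" using that by auto
      obtain D where D: "D \<in> carrier Iop"
        and low: "\<And>s. s \<in> carrier Sec \<Longrightarrow>
          fps_nth (K (const_series Iop D) (const_series Sec s)) 0 = ev (fps_nth ?A 0) s"
        using lowest_onto[of "fps_nth ?A 0"] A by auto
      let ?D = "const_series Iop D"
      have D': "?D \<in> carrier SI" using D by simp
      note p = phi[OF D']
      have "fps_nth (\<phi> ?D) 0 = fps_nth ?A 0"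
      proof (rule faithful)
        fix s assume s: "s \<in> carrier Sec"
        then show "ev (fps_nth (\<phi> ?D) 0) s = ev (fps_nth ?A 0) s"
          using low[OF s] p(2)[of "const_series Sec s"] B_lowest[OF p(1), of "const_series Sec s"] by simp
      qed (use A p in auto)
      define U where "U = ?A \<oplus>\<^bsub>SE\<^esub> fps_const (- 1) \<odot>\<^bsub>SE\<^esub> \<phi> ?D"
      have "fps_nth U 0 = \<zero>\<^bsub>Eop\<^esub>"
        using \<open>fps_nth (\<phi> ?D) 0 = _\<close> p(1) A by (simp add: U_def E.nth_smult_const E.smult_minus)
      then have "U = shift_up Eop (shift_down U)" by (intro fps_ext) simp
      then have "?A = \<phi> ?D \<oplus>\<^bsub>SE\<^esub> shift_up Eop (shift_down U)"
        using E.smult_minus_series[OF A p(1)] by (simp add: U_def)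
      moreover have "shift_down U \<in> carrier SE" using A p(1) by (simp add: U_def)
      ultimately show ?thesis using D by (intro bexI[of _ D] bexI[of _ "\<lambda>_. shift_down U"]) auto
    qed
    show "A \<in> \<phi> ` carrier SI"
    proof (rule series_lifting[where \<Phi> = "\<lambda>_. \<phi>" and I = "{()}" and t = "\<lambda>_. A"
          and X = Iop and Y = Eop and \<T> = "{t. t () \<in> carrier SE}"])
      show "\<exists>D\<in>carrier Iop. \<exists>t'\<in>{t. t () \<in> carrier SE}. \<forall>i\<in>{()}.
          t i = \<phi> (const_series Iop D) \<oplus>\<^bsub>SE\<^esub> shift_up Eop (t' i)"
        if "t \<in> {t. t () \<in> carrier SE}" for t
        using that by (rule step)
    qed (use A I.cmodule_axioms E.cmodule_axioms phi_linear in auto)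
  qed
qed

text \<open>Both products enter only through their actions: \<open>D''\<close> stands for the
  product of D and D', and A for the product of their images. Both then act as the same composition,
  and uniqueness applies.\<close>

lemma phi_mult:
  assumes "\<And>s. s \<in> carrier SS \<Longrightarrow> K D'' s = K D (K D' s)"
    and "\<And>s. s \<in> carrier SS \<Longrightarrow> B A s = B (\<phi> D) (B (\<phi> D') s)"
    and "D \<in> carrier SI" "D' \<in> carrier SI" "A \<in> carrier SE"
  shows "\<phi> D'' = A"
  using assms phi K_closed by (intro phi_unique) auto

end


section \<open>Associated bundles\<close>

locale assoc_bundle =
  fixes PB :: "('p::{t2_space,second_countable_topology}, 'm::{t2_space,second_countable_topology},
      'g::{t2_space,second_countable_topology},
      'ep::real_inner, 'em::real_inner, 'eg::real_inner) pfb"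
    and R :: "('g, 'v::ab_group_add) grep"
  assumes principal: "principal_bundle PB" and representation: "representation_of PB R"
begin

abbreviation "pr \<equiv> proj PB"
abbreviation "ac \<equiv> act PB"
abbreviation "rp \<equiv> rep R"
abbreviation "sc \<equiv> scl R"
abbreviation "co \<equiv> vcoord R"
abbreviation gmul (infixl "\<star>" 70) where "g \<star> h \<equiv> g \<otimes>\<^bsub>grp PB\<^esub> h"
abbreviation "gone \<equiv> \<one>\<^bsub>grp PB\<^esub>"
abbreviation "ginv g \<equiv> inv\<^bsub>grp PB\<^esub> g"
abbreviation "smooth_P \<equiv> smooth_fun (tot PB)"
abbreviation "smooth_M \<equiv> smooth_fun (base PB)"
abbreviation "EndE \<equiv> end_sections PB R"
abbreviation "SecE \<equiv> sections PB R"
abbreviation "InvOps \<equiv> inv_ops PB R"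
abbreviation "Fib \<equiv> fibre PB R"
abbreviation "fvec \<equiv> fib_vec PB R"
abbreviation "apt \<equiv> assoc_pt PB R"
abbreviation "to_fun \<equiv> sec_to_fun PB R"
abbreviation "to_sec \<equiv> fun_to_sec PB R"
abbreviation "VF \<equiv> vfns PB R"

lemma manifold_P: "manifold (tot PB)" and manifold_M: "manifold (base PB)"
  and lie: "lie_group (grp PB) (grp_atlas PB)"
  and smooth_pr: "smooth_map_on UNIV (tot PB) (base PB) pr"
  and smooth_ac: "smooth_map_on UNIV (prod_atlas (tot PB) (grp_atlas PB)) (tot PB) (\<lambda>(q, g). ac q g)"
  and ac_one [simp]: "ac q gone = q"
  and ac_ac: "ac (ac q g) h = ac q (g \<star> h)"
  and pr_ac [simp]: "pr (ac q g) = pr q"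
  and trivialization_ex: "\<exists>U \<Theta>. m \<in> U \<and> local_trivialization PB U \<Theta>"
  using principal unfolding principal_bundle_def by auto

lemma manifold_G: "manifold (grp_atlas PB)"
  and group_G: "Group.group (grp PB)" and carrier_G [simp]: "carrier (grp PB) = UNIV"
  and smooth_gmul: "smooth_map_on UNIV (prod_atlas (grp_atlas PB) (grp_atlas PB)) (grp_atlas PB) (\<lambda>(g, h). g \<star> h)"
  and smooth_ginv: "smooth_map_on UNIV (grp_atlas PB) (grp_atlas PB) (\<lambda>g. ginv g)"
  using lie unfolding lie_group_def by auto

lemmas charted_P = manifold_charted[OF manifold_P]
lemmas charted_M = manifold_charted[OF manifold_M]
lemmas charted_G = manifold_charted[OF manifold_G]

sublocale G: Group.group "grp PB" by (rule group_G)

sublocale V: finite_dimensional_vector_space "scl R" "bas R"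
  using representation unfolding representation_of_def by blast

section \<open>The representation and its matrix coefficients\<close>

lemma rp_linear: "Vector_Spaces.linear sc sc (rp g)"
  and rp_one [simp]: "rp gone v = v"
  and rp_mul: "rp (g \<star> h) v = rp g (rp h v)"
  and smooth_rp: "b \<in> bas R \<Longrightarrow> smooth_map_on UNIV (grp_atlas PB) std_atlas (\<lambda>g. co b (rp g v))"
  using representation unfolding representation_of_def by auto

lemma rp_add: "rp g (v + w) = rp g v + rp g w"
  and rp_sc: "rp g (sc c v) = sc c (rp g v)"
  and rp_sum: "rp g (\<Sum>i\<in>I. f i) = (\<Sum>i\<in>I. rp g (f i))"
  and rp_zero [simp]: "rp g 0 = 0"
proof -
  have "module_hom sc sc (rp g)"
    using rp_linear[of g] by (simp add: Vector_Spaces.linear_def)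
  note module_hom.add[OF this] module_hom.scale[OF this] module_hom.sum[OF this] module_hom.zero[OF this]
  then show "rp g (v + w) = rp g v + rp g w" "rp g (sc c v) = sc c (rp g v)"
    "rp g (\<Sum>i\<in>I. f i) = (\<Sum>i\<in>I. rp g (f i))" "rp g 0 = 0"
    by simp_all
qed

lemma rp_inv [simp]: "rp (ginv g) (rp g v) = v" "rp g (rp (ginv g) v) = v"
  using rp_mul[of "ginv g" g v] rp_mul[of g "ginv g" v] by simp_all

lemma co_linear: "co b (v + w) = co b v + co b w" "co b (sc c v) = c * co b v" "co b 0 = 0"
  "co b (\<Sum>i\<in>I. f i) = (\<Sum>i\<in>I. co b (f i))"
proof -
  note s = V.independent_Basis V.span_Basis
  show "co b (v + w) = co b v + co b w" "co b (sc c v) = c * co b v" "co b 0 = 0"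
    using s by (simp_all add: vcoord_def V.representation_add V.representation_scale V.representation_zero)
  show "co b (\<Sum>i\<in>I. f i) = (\<Sum>i\<in>I. co b (f i))"
    using s by (simp add: vcoord_def V.representation_sum)
qed

lemma co_basis: "b \<in> bas R \<Longrightarrow> co c b = (if c = b then 1 else 0)"
  using V.representation_basis[OF V.independent_Basis, of b] by (simp add: vcoord_def)

lemma co_expand: "(\<Sum>b\<in>bas R. sc (co b v) b) = v"
  unfolding vcoord_def
  by (rule V.sum_representation_eq[OF V.independent_Basis]) (auto simp: V.span_Basis V.finite_Basis)

lemma co_eqI: "(\<And>b. b \<in> bas R \<Longrightarrow> co b v = co b w) \<Longrightarrow> v = w"
  using co_expand[of v] co_expand[of w] by (metis (no_types, lifting) sum.cong)

lemma co_sum_basis: "b \<in> bas R \<Longrightarrow> co b (\<Sum>c\<in>bas R. sc (f c) c) = f b"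
  by (simp add: co_linear co_basis if_distrib[of "\<lambda>x. _ * x"] sum.delta V.finite_Basis cong: if_cong)

lemma co_rp: "co b (rp g v) = (\<Sum>c\<in>bas R. co c v * co b (rp g c))"
  by (subst co_expand[of v, symmetric]) (simp add: rp_sum rp_sc co_linear)

lemma vfns_iff: "f \<in> VF \<longleftrightarrow> (\<forall>b\<in>bas R. smooth_P UNIV (\<lambda>q. co b (f q)))"
  by (simp add: vfns_def smooth_fns_iff)

subsection \<open>Local sections\<close>

lemma fibre_transitive: "pr q = pr q' \<Longrightarrow> \<exists>g. q' = ac q g"
  and fibre_free: "ac q g = ac q h \<Longrightarrow> g = h"
  and lift_ex: "\<exists>q. pr q = m"
proof -
  have triv: "\<exists>U \<Theta>. m \<in> U \<and> bij_betw \<Theta> (pr -` U) (U \<times> UNIV) \<and>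
      (\<forall>q. pr q \<in> U \<longrightarrow> fst (\<Theta> q) = pr q \<and> (\<forall>g. \<Theta> (ac q g) = (pr q, snd (\<Theta> q) \<star> g)))" for m
  proof -
    obtain U \<Theta> where "m \<in> U" "local_trivialization PB U \<Theta>" using trivialization_ex by blast
    then show ?thesis
      by (intro exI[of _ U] exI[of _ \<Theta>]) (simp add: local_trivialization_def)
  qed
  show "\<exists>g. q' = ac q g" if "pr q = pr q'"
  proof -
    obtain U \<Theta> where U: "pr q \<in> U" and bij: "bij_betw \<Theta> (pr -` U) (U \<times> UNIV)"
      and \<Theta>: "\<forall>q. pr q \<in> U \<longrightarrow> fst (\<Theta> q) = pr q \<and> (\<forall>g. \<Theta> (ac q g) = (pr q, snd (\<Theta> q) \<star> g))"
      using triv[of "pr q"] by (elim exE conjE) (rule that)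
    \<comment> \<open>In a trivialization G acts by right translation on the second component, so
      the element carrying q to q' is the quotient of their second components.\<close>
    let ?g = "ginv (snd (\<Theta> q)) \<star> snd (\<Theta> q')"
    have "\<Theta> (ac q ?g) = (pr q, snd (\<Theta> q'))"
      using \<Theta> U by (simp add: G.m_assoc[symmetric])
    also have "\<dots> = \<Theta> q'" using \<Theta> U that by (simp add: prod_eq_iff)
    finally have "ac q ?g = q'"
      by (rule inj_onD[OF bij_betw_imp_inj_on[OF bij]]) (use U that in simp_all)
    then show ?thesis by (intro exI[of _ ?g]) simp
  qed
  show "g = h" if "ac q g = ac q h"
  proof -
    obtain U \<Theta> where U: "pr q \<in> U"
      and \<Theta>: "\<forall>q. pr q \<in> U \<longrightarrow> fst (\<Theta> q) = pr q \<and> (\<forall>g. \<Theta> (ac q g) = (pr q, snd (\<Theta> q) \<star> g))"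
      using triv[of "pr q"] by (elim exE conjE) (rule that)
    have eq: "\<Theta> (ac q k) = (pr q, snd (\<Theta> q) \<star> k)" for k
      using \<Theta> U by simp
    have "\<Theta> (ac q g) = \<Theta> (ac q h)" using that by (rule arg_cong)
    then have "snd (\<Theta> q) \<star> g = snd (\<Theta> q) \<star> h" unfolding eq by (simp only: prod.inject)
    then have "ginv (snd (\<Theta> q)) \<star> (snd (\<Theta> q) \<star> g) = ginv (snd (\<Theta> q)) \<star> (snd (\<Theta> q) \<star> h)"
      by (rule arg_cong)
    then show ?thesis by (simp add: G.m_assoc[symmetric])
  qed
  obtain U \<Theta> where U: "m \<in> U" and bij: "bij_betw \<Theta> (pr -` U) (U \<times> UNIV)"
    and \<Theta>: "\<forall>q. pr q \<in> U \<longrightarrow> fst (\<Theta> q) = pr q \<and> (\<forall>g. \<Theta> (ac q g) = (pr q, snd (\<Theta> q) \<star> g))"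
    using triv[of m] by (elim exE conjE) (rule that)
  have "(m, gone) \<in> \<Theta> ` (pr -` U)" using U bij_betw_imp_surj_on[OF bij] by simp
  then obtain q where q: "(m, gone) = \<Theta> q" "pr q \<in> U" by (elim imageE) simp
  have "fst (\<Theta> q) = pr q" using \<Theta> q(2) by simp
  then have "pr q = m" using q(1)[symmetric] by simp
  then show "\<exists>q. pr q = m" by (rule exI)
qed

lemma pr_some_lift [simp]: "pr (some_lift PB m) = m"
  unfolding some_lift_def by (rule someI_ex[OF lift_ex])

text \<open>Meaningful only for \<open>q\<close> and \<open>q'\<close> in the same fibre.\<close>

definition gdiff :: "'p \<Rightarrow> 'p \<Rightarrow> 'g" where
  "gdiff q q' = (THE g. q' = ac q g)"

lemma gdiff_ac [simp]: "gdiff q (ac q g) = g"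
  unfolding gdiff_def using fibre_free by blast

lemma ac_gdiff: "pr q = pr q' \<Longrightarrow> ac q (gdiff q q') = q'"
  using fibre_transitive[of q q'] by auto

lemma gdiff_refl [simp]: "gdiff q q = gone"
  using gdiff_ac[of q gone] by simp

lemma gdiff_ac2: "pr q = pr q' \<Longrightarrow> gdiff q (ac q' g) = gdiff q q' \<star> g"
  by (metis ac_ac ac_gdiff gdiff_ac)

lemma open_pr_vimage: "open U \<Longrightarrow> open (pr -` U)"
  using continuous_open_preimage[OF smooth_map_on_continuous[OF smooth_pr] open_UNIV] by simp

lemma local_sectionD:
  assumes "local_section PB U \<sigma>"
  shows "open U" "smooth_map_on U (base PB) (tot PB) \<sigma>" "m \<in> U \<Longrightarrow> pr (\<sigma> m) = m"
  using assms unfolding local_section_def by auto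

text \<open>A trivialization yields the section sending m to the point with coordinates (m,
  1).\<close>

lemma local_section_ex: "\<exists>U \<sigma>. m \<in> U \<and> local_section PB U \<sigma>"
proof -
  obtain U \<Theta> where m: "m \<in> U" and tr: "local_trivialization PB U \<Theta>" using trivialization_ex by blast
  then have U: "open U" and bij: "bij_betw \<Theta> (pr -` U) (U \<times> UNIV)"
    and sm: "smooth_map_on (U \<times> UNIV) (prod_atlas (base PB) (grp_atlas PB)) (tot PB) (inv_into (pr -` U) \<Theta>)"
    and fst: "\<And>q. q \<in> pr -` U \<Longrightarrow> fst (\<Theta> q) = pr q"
    unfolding local_trivialization_def by auto
  define \<sigma> where "\<sigma> m = inv_into (pr -` U) \<Theta> (m, gone)" for m
  have pair: "smooth_map_on U (base PB) (prod_atlas (base PB) (grp_atlas PB)) (\<lambda>m. (m, gone))"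
    by (intro smooth_map_on_Pair charted_M charted_G U smooth_map_on_ident manifold_M smooth_map_on_const)
  have "smooth_map_on U (base PB) (tot PB) (\<lambda>m. inv_into (pr -` U) \<Theta> (m, gone))"
    by (rule smooth_map_on_compose[OF charted_M charted_prod_atlas[OF charted_M charted_G] charted_P U _ _ pair sm])
      (auto simp: U open_Times)
  moreover have "pr (\<sigma> m) = m" if "m \<in> U" for m
  proof -
    have "(m, gone) \<in> \<Theta> ` (pr -` U)" using bij that unfolding bij_betw_def by blast
    then have "\<sigma> m \<in> pr -` U" "\<Theta> (\<sigma> m) = (m, gone)"
      unfolding \<sigma>_def by (rule inv_into_into, rule f_inv_into_f)
    then show ?thesis using fst[of "\<sigma> m"] by simp
  qed
  ultimately have "local_section PB U \<sigma>"
    unfolding local_section_def using U by (simp add: \<sigma>_def[abs_def])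
  then show ?thesis using m by blast
qed

text \<open>The definition of \<open>gdiff\<close> by description shows no smoothness. In a
  trivialization, however, it is the inverse of the group component of
  \<open>\<sigma> (pr q)\<close> times that of q, a composition of smooth maps.\<close>

lemma smooth_gdiff:
  assumes \<sigma>: "local_section PB U \<sigma>"
  shows "smooth_map_on (pr -` U) (tot PB) (grp_atlas PB) (\<lambda>q. gdiff (\<sigma> (pr q)) q)"
proof (rule smooth_map_on_local[OF charted_P charted_G])
  fix q assume q: "q \<in> pr -` U"
  obtain W \<Theta> where m: "pr q \<in> W" and tr: "local_trivialization PB W \<Theta>" using trivialization_ex by blast
  then have W: "open W"
    and sm: "smooth_map_on (pr -` W) (tot PB) (prod_atlas (base PB) (grp_atlas PB)) \<Theta>"
    and \<Theta>: "\<And>q g. q \<in> pr -` W \<Longrightarrow> \<Theta> (ac q g) = (pr q, snd (\<Theta> q) \<star> g)"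
    unfolding local_trivialization_def by auto
  let ?T = "pr -` (U \<inter> W)"
  note U = local_sectionD(1)[OF \<sigma>]
  have T: "open ?T" using open_pr_vimage U W by blast
  have oW: "open (pr -` W)" using open_pr_vimage W by blast
  note MG = charted_prod_atlas[OF charted_M charted_G] and GG = charted_prod_atlas[OF charted_G charted_G]
  have snd\<Theta>: "smooth_map_on (pr -` W) (tot PB) (grp_atlas PB) (\<lambda>q. snd (\<Theta> q))"
    by (rule smooth_map_on_compose[OF charted_P MG charted_G oW open_UNIV subset_UNIV sm
          smooth_map_on_snd[OF charted_M manifold_G]])
  have \<sigma>p: "smooth_map_on ?T (tot PB) (tot PB) (\<lambda>q. \<sigma> (pr q))"
    by (rule smooth_map_on_compose[OF charted_P charted_M charted_P T U _
          smooth_map_on_subset[OF smooth_pr subset_UNIV] local_sectionD(2)[OF \<sigma>]]) auto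
  have "smooth_map_on ?T (tot PB) (grp_atlas PB) (\<lambda>q. snd (\<Theta> (\<sigma> (pr q))))"
    by (rule smooth_map_on_compose[OF charted_P charted_P charted_G T oW _ \<sigma>p snd\<Theta>])
      (auto simp: local_sectionD(3)[OF \<sigma>])
  then have "smooth_map_on ?T (tot PB) (grp_atlas PB) (\<lambda>q. ginv (snd (\<Theta> (\<sigma> (pr q)))))"
    by (rule smooth_map_on_compose[OF charted_P charted_G charted_G T open_UNIV subset_UNIV _ smooth_ginv])
  moreover have "smooth_map_on ?T (tot PB) (grp_atlas PB) (\<lambda>q. snd (\<Theta> q))"
    by (rule smooth_map_on_subset[OF snd\<Theta>]) auto
  ultimately have "smooth_map_on ?T (tot PB) (prod_atlas (grp_atlas PB) (grp_atlas PB))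
      (\<lambda>q. (ginv (snd (\<Theta> (\<sigma> (pr q)))), snd (\<Theta> q)))"
    by (rule smooth_map_on_Pair[OF charted_P charted_G charted_G T])
  from smooth_map_on_compose[OF charted_P GG charted_G T open_UNIV subset_UNIV this smooth_gmul]
  have "smooth_map_on ?T (tot PB) (grp_atlas PB) (\<lambda>q. ginv (snd (\<Theta> (\<sigma> (pr q)))) \<star> snd (\<Theta> q))"
    by simp
  then have "smooth_map_on ?T (tot PB) (grp_atlas PB) (\<lambda>q. gdiff (\<sigma> (pr q)) q)"
  proof (rule smooth_map_on_cong[OF charted_P charted_G T, rotated])
    fix q assume q: "q \<in> ?T"
    then have e: "pr (\<sigma> (pr q)) = pr q" using local_sectionD(3)[OF \<sigma>] by simp
    have "\<Theta> q = (pr q, snd (\<Theta> (\<sigma> (pr q))) \<star> gdiff (\<sigma> (pr q)) q)"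
      using \<Theta>[of "\<sigma> (pr q)" "gdiff (\<sigma> (pr q)) q"] q e ac_gdiff[OF e] by simp
    then show "ginv (snd (\<Theta> (\<sigma> (pr q)))) \<star> snd (\<Theta> q) = gdiff (\<sigma> (pr q)) q"
      by (metis G.inv_solve_left UNIV_I carrier_G snd_conv)
  qed
  then show "\<exists>T. open T \<and> q \<in> T \<and> smooth_map_on T (tot PB) (grp_atlas PB) (\<lambda>q. gdiff (\<sigma> (pr q)) q)"
    using T q m by blast
qed

lemma smooth_rp_gdiff:
  assumes \<sigma>: "local_section PB U \<sigma>" and b: "b \<in> bas R"
  shows "smooth_P (pr -` U) (\<lambda>q. co b (rp (gdiff (\<sigma> (pr q)) q) v))"
    "smooth_P (pr -` U) (\<lambda>q. co b (rp (ginv (gdiff (\<sigma> (pr q)) q)) v))"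
proof -
  note o = open_pr_vimage[OF local_sectionD(1)[OF \<sigma>]]
  show "smooth_P (pr -` U) (\<lambda>q. co b (rp (gdiff (\<sigma> (pr q)) q) v))"
    by (rule smooth_fun_compose[OF charted_P charted_G o open_UNIV subset_UNIV smooth_gdiff[OF \<sigma>] smooth_rp[OF b]])
  have "smooth_map_on (pr -` U) (tot PB) (grp_atlas PB) (\<lambda>q. ginv (gdiff (\<sigma> (pr q)) q))"
    by (rule smooth_map_on_compose[OF charted_P charted_G charted_G o open_UNIV subset_UNIV smooth_gdiff[OF \<sigma>] smooth_ginv])
  from smooth_fun_compose[OF charted_P charted_G o open_UNIV subset_UNIV this smooth_rp[OF b]]
  show "smooth_P (pr -` U) (\<lambda>q. co b (rp (ginv (gdiff (\<sigma> (pr q)) q)) v))" .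
qed

lemma smooth_pullback:
  assumes "open U" "smooth_M U f"
  shows "smooth_P (pr -` U) (\<lambda>q. f (pr q))"
  by (rule smooth_fun_compose[OF charted_P charted_M open_pr_vimage[OF assms(1)] assms(1) _
        smooth_map_on_subset[OF smooth_pr subset_UNIV] assms(2)]) auto

lemma smooth_along_section:
  assumes \<sigma>: "local_section PB U \<sigma>" and f: "smooth_P UNIV f"
  shows "smooth_M U (\<lambda>m. f (\<sigma> m))"
  by (rule smooth_fun_compose[OF charted_M charted_P local_sectionD(1)[OF \<sigma>] open_UNIV subset_UNIV
        local_sectionD(2)[OF \<sigma>] f])

lemma smooth_ac_right: "smooth_map_on UNIV (tot PB) (tot PB) (\<lambda>q. ac q g)"
proof -
  have "smooth_map_on UNIV (tot PB) (prod_atlas (tot PB) (grp_atlas PB)) (\<lambda>q. (q, g))"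
    by (intro smooth_map_on_Pair charted_P charted_G open_UNIV smooth_map_on_ident manifold_P smooth_map_on_const)
  from smooth_map_on_compose[OF charted_P charted_prod_atlas[OF charted_P charted_G] charted_P open_UNIV open_UNIV
      subset_UNIV this smooth_ac]
  show ?thesis by simp
qed

lemma smooth_pull_fun: "smooth_P UNIV f \<Longrightarrow> smooth_P UNIV (pull_fun PB g f)"
  unfolding pull_fun_def
  by (rule smooth_fun_compose[OF charted_P charted_P open_UNIV open_UNIV subset_UNIV smooth_ac_right])

subsection \<open>Fibres of the associated bundle\<close>

text \<open>The two orbits are the same set, reparametrized by the left translation sending h to g
  h.\<close>

lemma assoc_pt_ac: "apt (ac q g) v = apt q (rp g v)"
proof -
  have "(ac (ac q g) h, rp (ginv h) v) = (ac q (g \<star> h), rp (ginv (g \<star> h)) (rp g v))" for h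
    by (simp add: ac_ac G.inv_mult_group rp_mul)
  moreover have "range (\<lambda>h. (ac q (g \<star> h), rp (ginv (g \<star> h)) (rp g v))) =
      range (\<lambda>k. (ac q k, rp (ginv k) (rp g v)))" (is "range (\<lambda>h. ?F (g \<star> h)) = range ?F")
  proof (intro subset_antisym image_subsetI)
    show "?F (g \<star> h) \<in> range ?F" for h by blast
    have k: "g \<star> (ginv g \<star> k) = k" for k by (simp add: G.m_assoc[symmetric])
    show "?F k \<in> range (\<lambda>h. ?F (g \<star> h))" for k
      by (rule range_eqI[of _ _ "ginv g \<star> k"]) (simp only: k)
  qed
  ultimately show ?thesis unfolding assoc_pt_def by (simp only:)
qed

text \<open>The action on P is free: an orbit contains only one element whose first component is
  q.\<close>

lemma assoc_pt_inj: "apt q v = apt q w \<Longrightarrow> v = w"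
proof -
  assume "apt q v = apt q w"
  moreover have "(q, v) \<in> apt q v"
    unfolding assoc_pt_def by (rule range_eqI[of _ _ gone]) simp
  ultimately have "(q, v) \<in> apt q w" by simp
  then obtain g where "(q, v) = (ac q g, rp (ginv g) w)" unfolding assoc_pt_def by (rule rangeE)
  then have g: "ac q g = q" "v = rp (ginv g) w" by (simp_all only: prod.inject)
  have "g = gone" by (rule fibre_free[of q]) (simp only: ac_one g(1))
  then show ?thesis using g(2) by simp
qed

lemma fib_vec_assoc_pt [simp]: "fvec q (apt q v) = v"
  unfolding fib_vec_def
proof (rule the_equality)
  show "w = v" if "apt q v = apt q w" for w
    using assoc_pt_inj[OF that] by (rule sym)
qed (rule refl)

lemma carrier_fibre: "carrier (Fib m) = {apt p v |p v. pr p = m}"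
  by (simp add: fibre_def Let_def)

lemma assoc_pt_fibre [simp]: "pr q = m \<Longrightarrow> apt q v \<in> carrier (Fib m)"
  unfolding carrier_fibre by blast

lemma assoc_pt_fib_vec:
  assumes "e \<in> carrier (Fib m)" "pr q = m"
  shows "apt q (fvec q e) = e"
proof -
  obtain p v where p: "e = apt p v" "pr p = m" using assms(1) unfolding carrier_fibre by blast
  then obtain g where "p = ac q g" using fibre_transitive assms(2) by metis
  then have "e = apt q (rp g v)" using p assoc_pt_ac by simp
  then show ?thesis by simp
qed

lemma fib_vec_inj:
  "e \<in> carrier (Fib m) \<Longrightarrow> e' \<in> carrier (Fib m) \<Longrightarrow> pr q = m \<Longrightarrow>
   fvec q e = fvec q e' \<Longrightarrow> e = e'"
  by (metis assoc_pt_fib_vec)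

lemma fib_vec_ac:
  assumes "e \<in> carrier (Fib m)" "pr q = m"
  shows "fvec (ac q g) e = rp (ginv g) (fvec q e)"
proof -
  have "e = apt (ac q g) (rp (ginv g) (fvec q e))"
    using assoc_pt_fib_vec[OF assms] by (simp add: assoc_pt_ac)
  then show ?thesis by (metis fib_vec_assoc_pt)
qed

lemma fibre_ops:
  "\<zero>\<^bsub>Fib m\<^esub> = apt (some_lift PB m) 0"
  "e \<oplus>\<^bsub>Fib m\<^esub> e' = apt (some_lift PB m)
     (fvec (some_lift PB m) e + fvec (some_lift PB m) e')"
  "c \<odot>\<^bsub>Fib m\<^esub> e = apt (some_lift PB m) (sc c (fvec (some_lift PB m) e))"
  by (simp_all add: fibre_def Let_def)

lemma fibre_closed [simp]:
  "\<zero>\<^bsub>Fib m\<^esub> \<in> carrier (Fib m)"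
  "e \<oplus>\<^bsub>Fib m\<^esub> e' \<in> carrier (Fib m)"
  "c \<odot>\<^bsub>Fib m\<^esub> e \<in> carrier (Fib m)"
  by (simp_all only: fibre_ops assoc_pt_fibre pr_some_lift)

text \<open>The operations of \<open>fibre\<close> are defined through \<open>some_lift\<close>; they agree at every other point over \<open>m\<close>.\<close>

lemma fib_vec_fibre:
  assumes "pr q = m"
  shows "fvec q \<zero>\<^bsub>Fib m\<^esub> = 0"
    "e \<in> carrier (Fib m) \<Longrightarrow> e' \<in> carrier (Fib m) \<Longrightarrow>
      fvec q (e \<oplus>\<^bsub>Fib m\<^esub> e') = fvec q e + fvec q e'"
    "e \<in> carrier (Fib m) \<Longrightarrow> fvec q (c \<odot>\<^bsub>Fib m\<^esub> e) = sc c (fvec q e)"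
proof -
  let ?l = "some_lift PB m"
  obtain g where g: "q = ac ?l g" using fibre_transitive[of ?l q] assms by auto
  \<comment> \<open>Passing from the chosen lift to q applies the linear map
    \<open>rp (ginv g)\<close>, so the operations may be computed at either point.\<close>
  have q: "fvec q e = rp (ginv g) (fvec ?l e)" if "e \<in> carrier (Fib m)" for e
    unfolding g by (rule fib_vec_ac[OF that]) simp
  show "fvec q \<zero>\<^bsub>Fib m\<^esub> = 0"
    unfolding q[OF fibre_closed(1)] unfolding fibre_ops by simp
  show "fvec q (e \<oplus>\<^bsub>Fib m\<^esub> e') = fvec q e + fvec q e'"
    if "e \<in> carrier (Fib m)" "e' \<in> carrier (Fib m)"
    unfolding q[OF fibre_closed(2)] q[OF that(1)] q[OF that(2)] unfolding fibre_ops by (simp add: rp_add)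
  show "fvec q (c \<odot>\<^bsub>Fib m\<^esub> e) = sc c (fvec q e)"
    if "e \<in> carrier (Fib m)"
    unfolding q[OF fibre_closed(3)] q[OF that(1)] unfolding fibre_ops by (simp add: rp_sc)
qed

lemma assoc_pt_linear:
  assumes "pr q = m"
  shows "apt q (v + w) = apt q v \<oplus>\<^bsub>Fib m\<^esub> apt q w"
    "apt q (sc c v) = c \<odot>\<^bsub>Fib m\<^esub> apt q v"
    "apt q 0 = \<zero>\<^bsub>Fib m\<^esub>"
  by (rule fib_vec_inj[OF _ _ assms]; simp add: assms fib_vec_fibre[OF assms])+

subsection \<open>Sections as equivariant functions\<close>

text \<open>Invariance under \<open>vact\<close> for all g, solved for the value at the translated
  point. Accordingly \<open>Gam\<close> consists of the G-invariants in the smooth functions from P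
  to V.\<close>

definition equivariant :: "('p \<Rightarrow> 'v) \<Rightarrow> bool" where
  "equivariant f \<longleftrightarrow> (\<forall>q g. f (ac q g) = rp (ginv g) (f q))"

definition Gam :: "('p \<Rightarrow> 'v) set" where
  "Gam = {f \<in> VF. equivariant f}"

lemma equivariantD: "equivariant f \<Longrightarrow> f (ac q g) = rp (ginv g) (f q)"
  unfolding equivariant_def by blast

lemma Gam_iff: "f \<in> Gam \<longleftrightarrow> f \<in> VF \<and> equivariant f"
  by (simp add: Gam_def)

lemma equivariant_local:
  assumes "equivariant f" "local_section PB U \<sigma>" "pr q \<in> U"
  shows "f q = rp (ginv (gdiff (\<sigma> (pr q)) q)) (f (\<sigma> (pr q)))"
proof -
  have "ac (\<sigma> (pr q)) (gdiff (\<sigma> (pr q)) q) = q"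
    using local_sectionD(3)[OF assms(2,3)] by (rule ac_gdiff)
  then show ?thesis using equivariantD[OF assms(1), of "\<sigma> (pr q)" "gdiff (\<sigma> (pr q)) q"] by simp
qed

text \<open>Over U an equivariant f is determined by its values along \<open>\<sigma>\<close>: at q
  it is the value at \<open>\<sigma> (pr q)\<close> moved by the inverse of \<open>gdiff\<close>,
  whose matrix entries are smooth. Hence smoothness along all local sections amounts to smoothness
  on P.\<close>

lemma equivariant_smooth_iff:
  assumes f: "equivariant f"
  shows "f \<in> VF \<longleftrightarrow>
    (\<forall>U \<sigma>. \<forall>b\<in>bas R. local_section PB U \<sigma> \<longrightarrow> smooth_M U (\<lambda>m. co b (f (\<sigma> m))))"
proof
  assume v: "f \<in> VF"
  have "smooth_M U (\<lambda>m. co b (f (\<sigma> m)))" if "b \<in> bas R" "local_section PB U \<sigma>" for U \<sigma> b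
    using smooth_along_section[OF that(2), of "\<lambda>q. co b (f q)"] v that(1) by (simp add: vfns_iff)
  then show "\<forall>U \<sigma>. \<forall>b\<in>bas R. local_section PB U \<sigma> \<longrightarrow> smooth_M U (\<lambda>m. co b (f (\<sigma> m)))"
    by blast
next
  assume R: "\<forall>U \<sigma>. \<forall>b\<in>bas R. local_section PB U \<sigma> \<longrightarrow> smooth_M U (\<lambda>m. co b (f (\<sigma> m)))"
  have "smooth_P UNIV (\<lambda>q. co b (f q))" if b: "b \<in> bas R" for b
  proof (rule smooth_fun_local[OF charted_P])
    fix q
    obtain U \<sigma> where q: "pr q \<in> U" and \<sigma>: "local_section PB U \<sigma>" using local_section_ex by blast
    note U = local_sectionD(1)[OF \<sigma>]
    note oU = open_pr_vimage[OF U]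
    have "smooth_P (pr -` U) (\<lambda>q. \<Sum>c\<in>bas R. co c (f (\<sigma> (pr q))) * co b (rp (ginv (gdiff (\<sigma> (pr q)) q)) c))"
      using R \<sigma> by (intro smooth_fun_sum[OF charted_P oU] smooth_fun_mult[OF charted_P oU]
        smooth_pullback[OF U, of "\<lambda>m. co _ (f (\<sigma> m))"] smooth_rp_gdiff(2)[OF \<sigma> b]) blast
    then have "smooth_P (pr -` U) (\<lambda>q. co b (f q))"
    proof (rule smooth_fun_cong[OF charted_P oU, rotated])
      fix q assume "q \<in> pr -` U"
      then show "(\<Sum>c\<in>bas R. co c (f (\<sigma> (pr q))) * co b (rp (ginv (gdiff (\<sigma> (pr q)) q)) c)) = co b (f q)"
        using equivariant_local[OF f \<sigma>, of q] co_rp[of b "ginv (gdiff (\<sigma> (pr q)) q)" "f (\<sigma> (pr q))"] by simp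
    qed
    then show "\<exists>T. open T \<and> q \<in> T \<and> smooth_P T (\<lambda>q. co b (f q))"
      using oU q by (intro exI[of _ "pr -` U"]) simp
  qed
  then show "f \<in> VF" by (simp add: vfns_iff)
qed

lemma vfns_add: "f \<in> VF \<Longrightarrow> g \<in> VF \<Longrightarrow> (\<lambda>q. f q + g q) \<in> VF"
  by (simp add: vfns_iff co_linear smooth_fun_add[OF charted_P open_UNIV])

lemma vfns_sc: "f \<in> VF \<Longrightarrow> smooth_P UNIV a \<Longrightarrow> (\<lambda>q. sc (a q) (f q)) \<in> VF"
  by (simp add: vfns_iff co_linear smooth_fun_mult[OF charted_P open_UNIV])

lemma vfns_zero: "(\<lambda>q. 0) \<in> VF"
  by (simp add: vfns_iff co_linear smooth_fun_const)

lemma Gam_zero: "(\<lambda>q. 0) \<in> Gam"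
  by (simp add: Gam_iff vfns_zero equivariant_def)

lemma Gam_add: "f \<in> Gam \<Longrightarrow> g \<in> Gam \<Longrightarrow> (\<lambda>q. f q + g q) \<in> Gam"
  by (simp add: Gam_iff vfns_add equivariant_def rp_add)

lemma Gam_sc_const: "f \<in> Gam \<Longrightarrow> (\<lambda>q. sc c (f q)) \<in> Gam"
  using vfns_sc[OF _ smooth_fun_const, of f c] by (simp add: Gam_iff equivariant_def rp_sc)

lemma Gam_sc: "f \<in> Gam \<Longrightarrow> smooth_M UNIV a \<Longrightarrow> (\<lambda>q. sc (a (pr q)) (f q)) \<in> Gam"
  using vfns_sc[of f "\<lambda>q. a (pr q)"] smooth_pullback[OF open_UNIV, of a]
  by (simp add: Gam_iff equivariant_def rp_sc)

lemma Gam_sum: "(\<And>i. i \<in> I \<Longrightarrow> f i \<in> Gam) \<Longrightarrow> (\<lambda>q. \<Sum>i\<in>I. f i q) \<in> Gam"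
  by (induction I rule: infinite_finite_induct) (simp_all add: Gam_zero Gam_add)

lemma sec_to_fun_along_section:
  "local_section PB U \<sigma> \<Longrightarrow> m \<in> U \<Longrightarrow> to_fun s (\<sigma> m) = fvec (\<sigma> m) (s m)"
  by (simp add: sec_to_fun_def local_sectionD(3))

text \<open>From here on the smoothness of a section is that of a single globally defined function
  on P, and local sections are needed only for localization and for endomorphisms.\<close>

lemma sections_iff:
  "s \<in> carrier SecE \<longleftrightarrow> (\<forall>m. s m \<in> carrier (Fib m)) \<and> to_fun s \<in> Gam"
proof (cases "\<forall>m. s m \<in> carrier (Fib m)")
  case True
  then have eq: "equivariant (to_fun s)"
    by (auto simp: equivariant_def sec_to_fun_def fib_vec_ac[OF _ refl])
  have "smooth_M U (\<lambda>m. co b (fvec (\<sigma> m) (s m))) \<longleftrightarrow> smooth_M U (\<lambda>m. co b (to_fun s (\<sigma> m)))"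
    if "local_section PB U \<sigma>" for U \<sigma> b
  proof
    note cong = smooth_fun_cong[OF charted_M local_sectionD(1)[OF that], rotated]
    show "smooth_M U (\<lambda>m. co b (fvec (\<sigma> m) (s m))) \<Longrightarrow> smooth_M U (\<lambda>m. co b (to_fun s (\<sigma> m)))"
      by (erule cong) (simp add: sec_to_fun_along_section[OF that])
    show "smooth_M U (\<lambda>m. co b (to_fun s (\<sigma> m))) \<Longrightarrow> smooth_M U (\<lambda>m. co b (fvec (\<sigma> m) (s m)))"
      by (erule cong) (simp add: sec_to_fun_along_section[OF that])
  qed
  then show ?thesis
    using True by (simp add: sections_def Gam_iff eq equivariant_smooth_iff[OF eq])
next
  case False
  then show ?thesis by (simp only: sections_def partial_object.simps mem_Collect_eq) blast
qed

lemma fun_to_sec_fibre [simp]: "to_sec f m \<in> carrier (Fib m)"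
  by (simp add: fun_to_sec_def)

lemma sec_to_fun_to_sec:
  assumes "equivariant f"
  shows "to_fun (to_sec f) = f"
proof
  fix q
  let ?l = "some_lift PB (pr q)"
  obtain g where g: "q = ac ?l g" using fibre_transitive[of ?l q] by auto
  have "fvec (ac ?l g) (to_sec f (pr q)) = f (ac ?l g)"
    by (subst fib_vec_ac[OF fun_to_sec_fibre]) (simp_all add: fun_to_sec_def equivariantD[OF assms])
  then show "to_fun (to_sec f) q = f q"
    unfolding sec_to_fun_def by (simp add: g[symmetric])
qed

lemma fun_to_sec_to_fun: "(\<And>m. s m \<in> carrier (Fib m)) \<Longrightarrow> to_sec (to_fun s) = s"
  by (rule ext) (simp add: fun_to_sec_def sec_to_fun_def assoc_pt_fib_vec[OF _ pr_some_lift])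

lemma sections_fibre: "s \<in> carrier SecE \<Longrightarrow> s m \<in> carrier (Fib m)"
  and sec_to_fun_Gam: "s \<in> carrier SecE \<Longrightarrow> to_fun s \<in> Gam"
  by (simp_all add: sections_iff)

lemma fun_to_sec_sections: "f \<in> Gam \<Longrightarrow> to_sec f \<in> carrier SecE"
  by (simp add: sections_iff sec_to_fun_to_sec Gam_iff)

lemma sec_to_fun_inverse [simp]: "f \<in> Gam \<Longrightarrow> to_fun (to_sec f) = f"
  by (simp add: sec_to_fun_to_sec Gam_iff)

lemma fun_to_sec_inverse [simp]:
  "s \<in> carrier SecE \<Longrightarrow> to_sec (to_fun s) = s"
  by (simp add: fun_to_sec_to_fun sections_fibre)

lemma sections_ops:
  "\<zero>\<^bsub>SecE\<^esub> = (\<lambda>m. \<zero>\<^bsub>Fib m\<^esub>)"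
  "s \<oplus>\<^bsub>SecE\<^esub> t = (\<lambda>m. s m \<oplus>\<^bsub>Fib m\<^esub> t m)"
  "c \<odot>\<^bsub>SecE\<^esub> s = (\<lambda>m. c \<odot>\<^bsub>Fib m\<^esub> s m)"
  by (simp_all add: sections_def)

lemma sec_to_fun_ops:
  "to_fun \<zero>\<^bsub>SecE\<^esub> = (\<lambda>q. 0)"
  "s \<in> carrier SecE \<Longrightarrow> t \<in> carrier SecE \<Longrightarrow>
    to_fun (s \<oplus>\<^bsub>SecE\<^esub> t) = (\<lambda>q. to_fun s q + to_fun t q)"
  "s \<in> carrier SecE \<Longrightarrow>
    to_fun (c \<odot>\<^bsub>SecE\<^esub> s) = (\<lambda>q. sc c (to_fun s q))"
  by (rule ext; simp add: sec_to_fun_def sections_ops fib_vec_fibre sections_fibre)+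

sublocale Sec: cmodule_embedding "scl R" "SecE" "to_fun"
proof unfold_locales
  show "x = y" if "x \<in> carrier SecE" "y \<in> carrier SecE"
    "\<And>i. to_fun x i = to_fun y i" for x y
    using fun_to_sec_inverse[OF that(1)] fun_to_sec_inverse[OF that(2)] that(3) by (metis ext)
  show "\<zero>\<^bsub>SecE\<^esub> \<in> carrier SecE"
    unfolding sections_iff sec_to_fun_ops by (simp add: sections_ops Gam_zero)
  show "x \<oplus>\<^bsub>SecE\<^esub> y \<in> carrier SecE"
    if "x \<in> carrier SecE" "y \<in> carrier SecE" for x y
    using that sec_to_fun_ops(2)[OF that] by (simp add: sections_iff Gam_add) (simp add: sections_ops)
  show "c \<odot>\<^bsub>SecE\<^esub> x \<in> carrier SecE" if "x \<in> carrier SecE" for x c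
    using that sec_to_fun_ops(3)[OF that] by (simp add: sections_iff Gam_sc_const) (simp add: sections_ops)
qed (simp_all add: sec_to_fun_ops)

lemma fun_to_sec_ops:
  "f \<in> Gam \<Longrightarrow> g \<in> Gam \<Longrightarrow>
    to_sec (\<lambda>q. f q + g q) = to_sec f \<oplus>\<^bsub>SecE\<^esub> to_sec g"
  "f \<in> Gam \<Longrightarrow> to_sec (\<lambda>q. sc (a (pr q)) (f q)) = (\<lambda>m. a m \<odot>\<^bsub>Fib m\<^esub> to_sec f m)"
  by (rule ext; simp add: fun_to_sec_def sections_ops assoc_pt_linear[OF pr_some_lift])+

subsection \<open>Sections of the endomorphism bundle\<close>

text \<open>The equivariant function from P to the endomorphisms of V that belongs to A: the map A
  read in the frame q.\<close>

definition end_fun :: "('m \<Rightarrow> ('p \<times> 'v) set \<Rightarrow> ('p \<times> 'v) set) \<Rightarrow> 'p \<Rightarrow> 'v \<Rightarrow> 'v" where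
  "end_fun A q v = fvec q (A (pr q) (apt q v))"

lemma end_sections_iff:
  "A \<in> carrier EndE \<longleftrightarrow>
    (\<forall>m. linear_map (Fib m) (Fib m) (A m) \<and> A m \<in> extensional (carrier (Fib m))) \<and>
    (\<forall>U \<sigma>. \<forall>b\<in>bas R. \<forall>c\<in>bas R. local_section PB U \<sigma> \<longrightarrow> smooth_M U (\<lambda>m. co b (end_fun A (\<sigma> m) c)))"
proof -
  have "smooth_M U (\<lambda>m. co b (end_fun A (\<sigma> m) c)) \<longleftrightarrow>
      smooth_M U (\<lambda>m. co b (fvec (\<sigma> m) (A m (apt (\<sigma> m) c))))"
    if \<sigma>: "local_section PB U \<sigma>" for U \<sigma> b c
  proof
    note cong = smooth_fun_cong[OF charted_M local_sectionD(1)[OF \<sigma>], rotated]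
    have eq: "co b (end_fun A (\<sigma> m) c) = co b (fvec (\<sigma> m) (A m (apt (\<sigma> m) c)))" if "m \<in> U" for m
      using local_sectionD(3)[OF \<sigma> that] by (simp add: end_fun_def)
    show "smooth_M U (\<lambda>m. co b (end_fun A (\<sigma> m) c)) \<Longrightarrow>
        smooth_M U (\<lambda>m. co b (fvec (\<sigma> m) (A m (apt (\<sigma> m) c))))"
      by (erule cong) (simp add: eq)
    show "smooth_M U (\<lambda>m. co b (fvec (\<sigma> m) (A m (apt (\<sigma> m) c)))) \<Longrightarrow>
        smooth_M U (\<lambda>m. co b (end_fun A (\<sigma> m) c))"
      by (erule cong) (simp add: eq)
  qed
  then show ?thesis by (simp add: end_sections_def)
qed

lemma end_sections_linear:
  assumes "A \<in> carrier EndE"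
  shows "linear_map (Fib m) (Fib m) (A m)"
  using assms by (simp add: end_sections_iff)

lemma end_sections_fibre [simp]:
  "A \<in> carrier EndE \<Longrightarrow> e \<in> carrier (Fib m) \<Longrightarrow> A m e \<in> carrier (Fib m)"
  using linear_map_closed[OF end_sections_linear] .

lemma end_fun_linear:
  assumes A: "A \<in> carrier EndE"
  shows "end_fun A q (v + w) = end_fun A q v + end_fun A q w"
    "end_fun A q (sc c v) = sc c (end_fun A q v)"
    "end_fun A q 0 = 0"
    "end_fun A q (\<Sum>i\<in>I. f i) = (\<Sum>i\<in>I. end_fun A q (f i))"
proof -
  note l = end_sections_linear[OF A, of "pr q"]
  show add: "end_fun A q (v + w) = end_fun A q v + end_fun A q w" for v w
    using linear_map_add[OF l, of "apt q v" "apt q w"] A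
    by (simp add: end_fun_def assoc_pt_linear[OF refl] fib_vec_fibre)
  show "end_fun A q (sc c v) = sc c (end_fun A q v)"
    using linear_map_smult[OF l, of "apt q v" c] A
    by (simp add: end_fun_def assoc_pt_linear[OF refl] fib_vec_fibre)
  show zero: "end_fun A q 0 = 0"
    using add[of 0 0] by simp
  show "end_fun A q (\<Sum>i\<in>I. f i) = (\<Sum>i\<in>I. end_fun A q (f i))"
    by (induction I rule: infinite_finite_induct) (simp_all add: add zero)
qed

lemma end_fun_ac:
  assumes A: "A \<in> carrier EndE"
  shows "end_fun A (ac q g) v = rp (ginv g) (end_fun A q (rp g v))"
  using A by (simp add: end_fun_def assoc_pt_ac fib_vec_ac[OF _ refl])

lemma end_fun_fib_vec:
  assumes "A \<in> carrier EndE" "e \<in> carrier (Fib (pr q))"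
  shows "end_fun A q (fvec q e) = fvec q (A (pr q) e)"
  using assms by (simp add: end_fun_def assoc_pt_fib_vec[OF _ refl])

text \<open>Equivariance writes \<open>end_fun A q\<close> as the conjugate of its value at
  \<open>\<sigma> (pr q)\<close> by \<open>rp\<close> of \<open>gdiff\<close>. Its entries are
  therefore sums of products of three smooth factors.\<close>

lemma smooth_end_fun:
  assumes A: "A \<in> carrier EndE" and b: "b \<in> bas R" and c: "c \<in> bas R"
  shows "smooth_P UNIV (\<lambda>q. co b (end_fun A q c))"
proof (rule smooth_fun_local[OF charted_P])
  fix q
  obtain U \<sigma> where q: "pr q \<in> U" and \<sigma>: "local_section PB U \<sigma>" using local_section_ex by blast
  note U = local_sectionD(1)[OF \<sigma>]
  note oU = open_pr_vimage[OF U]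
  let ?h = "\<lambda>q. gdiff (\<sigma> (pr q)) q"
  have "smooth_M U (\<lambda>m. co d (end_fun A (\<sigma> m) e))" if "d \<in> bas R" "e \<in> bas R" for d e
    using A \<sigma> that by (simp add: end_sections_iff)
  then have "smooth_P (pr -` U) (\<lambda>q. \<Sum>d\<in>bas R. (\<Sum>e\<in>bas R. co e (rp (?h q) c) * co d (end_fun A (\<sigma> (pr q)) e)) *
      co b (rp (ginv (?h q)) d))"
    by (intro smooth_fun_sum[OF charted_P oU] smooth_fun_mult[OF charted_P oU]
        smooth_pullback[OF U, of "\<lambda>m. co _ (end_fun A (\<sigma> m) _)"] smooth_rp_gdiff[OF \<sigma>] b) simp_all
  then have "smooth_P (pr -` U) (\<lambda>q. co b (end_fun A q c))"
  proof (rule smooth_fun_cong[OF charted_P oU, rotated])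
    fix q assume "q \<in> pr -` U"
    then have q: "ac (\<sigma> (pr q)) (?h q) = q" using local_sectionD(3)[OF \<sigma>] by (simp add: ac_gdiff)
    have "end_fun A q c = rp (ginv (?h q)) (end_fun A (\<sigma> (pr q)) (rp (?h q) c))"
      using end_fun_ac[OF A, of "\<sigma> (pr q)" "?h q" c] q by simp
    then have "co b (end_fun A q c) =
        (\<Sum>d\<in>bas R. co d (end_fun A (\<sigma> (pr q)) (rp (?h q) c)) * co b (rp (ginv (?h q)) d))"
      by (rule ssubst) (rule co_rp)
    moreover have "co d (end_fun A (\<sigma> (pr q)) (rp (?h q) c)) =
        (\<Sum>e\<in>bas R. co e (rp (?h q) c) * co d (end_fun A (\<sigma> (pr q)) e))" for d
      by (subst co_expand[of "rp (?h q) c", symmetric]) (simp only: end_fun_linear[OF A] co_linear)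
    ultimately show "(\<Sum>d\<in>bas R. (\<Sum>e\<in>bas R. co e (rp (?h q) c) * co d (end_fun A (\<sigma> (pr q)) e)) *
        co b (rp (ginv (?h q)) d)) = co b (end_fun A q c)"
      by (simp only:)
  qed
  then show "\<exists>T. open T \<and> q \<in> T \<and> smooth_P T (\<lambda>q. co b (end_fun A q c))"
    using oU q by (intro exI[of _ "pr -` U"]) simp
qed

lemma end_sections_ops:
  "\<zero>\<^bsub>EndE\<^esub> = (\<lambda>m. \<lambda>e\<in>carrier (Fib m). \<zero>\<^bsub>Fib m\<^esub>)"
  "A \<oplus>\<^bsub>EndE\<^esub> B = (\<lambda>m. \<lambda>e\<in>carrier (Fib m). A m e \<oplus>\<^bsub>Fib m\<^esub> B m e)"
  "c \<odot>\<^bsub>EndE\<^esub> A = (\<lambda>m. \<lambda>e\<in>carrier (Fib m). c \<odot>\<^bsub>Fib m\<^esub> A m e)"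
  by (simp_all add: end_sections_def)

lemma linear_map_fibreI:
  assumes "\<And>e. e \<in> carrier (Fib m) \<Longrightarrow> T e \<in> carrier (Fib m)"
    and "\<And>e f. e \<in> carrier (Fib m) \<Longrightarrow> f \<in> carrier (Fib m) \<Longrightarrow>
      T (e \<oplus>\<^bsub>Fib m\<^esub> f) = T e \<oplus>\<^bsub>Fib m\<^esub> T f"
    and "\<And>c e. e \<in> carrier (Fib m) \<Longrightarrow> T (c \<odot>\<^bsub>Fib m\<^esub> e) = c \<odot>\<^bsub>Fib m\<^esub> T e"
  shows "linear_map (Fib m) (Fib m) T"
  using assms unfolding linear_map_def by blast

lemma end_fun_ops:
  "end_fun \<zero>\<^bsub>EndE\<^esub> q v = 0"
  "A \<in> carrier EndE \<Longrightarrow> B \<in> carrier EndE \<Longrightarrow>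
    end_fun (A \<oplus>\<^bsub>EndE\<^esub> B) q v = end_fun A q v + end_fun B q v"
  "A \<in> carrier EndE \<Longrightarrow> end_fun (c \<odot>\<^bsub>EndE\<^esub> A) q v = sc c (end_fun A q v)"
  by (simp_all add: end_fun_def end_sections_ops fib_vec_fibre)

lemma fibre_eqI:
  "e \<in> carrier (Fib m) \<Longrightarrow> f \<in> carrier (Fib m) \<Longrightarrow>
   fvec (some_lift PB m) e = fvec (some_lift PB m) f \<Longrightarrow> e = f"
  by (rule fib_vec_inj[OF _ _ pr_some_lift])

sublocale End: cmodule_embedding "scl R" "EndE" "\<lambda>A (q, v). end_fun A q v"
proof unfold_locales
  note fv = fib_vec_fibre[OF pr_some_lift]
  fix A B c assume A: "A \<in> carrier EndE"
  show "A = B" if B: "B \<in> carrier EndE"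
    and eq: "\<And>i. (case i of (q, v) \<Rightarrow> end_fun A q v) = (case i of (q, v) \<Rightarrow> end_fun B q v)"
  \<comment> \<open>\<open>end_fun\<close> sees A on the fibres only; off the fibres both maps are
    fixed by extensionality.\<close>
  proof (rule ext, rule extensionalityI)
    fix m e assume e: "e \<in> carrier (Fib m)"
    let ?l = "some_lift PB m"
    have "end_fun A ?l (fvec ?l e) = end_fun B ?l (fvec ?l e)"
      using eq[of "(?l, fvec ?l e)"] by simp
    then have "fvec ?l (A m e) = fvec ?l (B m e)"
      using A B e by (simp add: end_fun_fib_vec)
    then show "A m e = B m e"
      by (rule fibre_eqI[where m = m, rotated 2]) (use A B e in simp_all)
  qed (use A B in \<open>simp_all add: end_sections_iff\<close>)
  show "A \<oplus>\<^bsub>EndE\<^esub> B \<in> carrier EndE" if B: "B \<in> carrier EndE"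
    unfolding end_sections_iff
  proof (intro conjI allI ballI impI)
    show "linear_map (Fib m) (Fib m) ((A \<oplus>\<^bsub>EndE\<^esub> B) m)" for m
    proof (rule linear_map_fibreI)
      fix e f assume e: "e \<in> carrier (Fib m)" and f: "f \<in> carrier (Fib m)"
      show "(A \<oplus>\<^bsub>EndE\<^esub> B) m (e \<oplus>\<^bsub>Fib m\<^esub> f) =
          (A \<oplus>\<^bsub>EndE\<^esub> B) m e \<oplus>\<^bsub>Fib m\<^esub> (A \<oplus>\<^bsub>EndE\<^esub> B) m f"
        by (rule fibre_eqI[where m = m]) (use A B e f linear_map_add[OF end_sections_linear[OF A] e f]
            linear_map_add[OF end_sections_linear[OF B] e f] in \<open>simp_all add: end_sections_ops fv add_ac\<close>)
    next
      fix c e assume e: "e \<in> carrier (Fib m)"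
      show "(A \<oplus>\<^bsub>EndE\<^esub> B) m (c \<odot>\<^bsub>Fib m\<^esub> e) =
          c \<odot>\<^bsub>Fib m\<^esub> (A \<oplus>\<^bsub>EndE\<^esub> B) m e"
        by (rule fibre_eqI[where m = m]) (use A B e linear_map_smult[OF end_sections_linear[OF A] e]
            linear_map_smult[OF end_sections_linear[OF B] e]
            in \<open>simp_all add: end_sections_ops fv V.scale_right_distrib\<close>)
    qed (simp add: end_sections_ops)
    show "smooth_M U (\<lambda>m. co b (end_fun (A \<oplus>\<^bsub>EndE\<^esub> B) (\<sigma> m) c))"
      if "b \<in> bas R" "c \<in> bas R" "local_section PB U \<sigma>" for U \<sigma> b c
      unfolding end_fun_ops(2)[OF A B] co_linear using A B that
      by (intro smooth_fun_add[OF charted_M local_sectionD(1)[OF that(3)]]) (simp_all add: end_sections_iff)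
  qed (simp add: end_sections_ops)
  show "c \<odot>\<^bsub>EndE\<^esub> A \<in> carrier EndE"
    unfolding end_sections_iff
  proof (intro conjI allI ballI impI)
    show "linear_map (Fib m) (Fib m) ((c \<odot>\<^bsub>EndE\<^esub> A) m)" for m
    proof (rule linear_map_fibreI)
      fix e f assume e: "e \<in> carrier (Fib m)" and f: "f \<in> carrier (Fib m)"
      show "(c \<odot>\<^bsub>EndE\<^esub> A) m (e \<oplus>\<^bsub>Fib m\<^esub> f) =
          (c \<odot>\<^bsub>EndE\<^esub> A) m e \<oplus>\<^bsub>Fib m\<^esub> (c \<odot>\<^bsub>EndE\<^esub> A) m f"
        by (rule fibre_eqI[where m = m]) (use A e f linear_map_add[OF end_sections_linear[OF A] e f]
            in \<open>simp_all add: end_sections_ops fv V.scale_right_distrib\<close>)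
    next
      fix d e assume e: "e \<in> carrier (Fib m)"
      show "(c \<odot>\<^bsub>EndE\<^esub> A) m (d \<odot>\<^bsub>Fib m\<^esub> e) =
          d \<odot>\<^bsub>Fib m\<^esub> (c \<odot>\<^bsub>EndE\<^esub> A) m e"
        by (rule fibre_eqI[where m = m]) (use A e linear_map_smult[OF end_sections_linear[OF A] e]
            in \<open>simp_all add: end_sections_ops fv mult.commute\<close>)
    qed (simp add: A end_sections_ops)
    show "smooth_M U (\<lambda>m. co b (end_fun (c \<odot>\<^bsub>EndE\<^esub> A) (\<sigma> m) d))"
      if "b \<in> bas R" "d \<in> bas R" "local_section PB U \<sigma>" for U \<sigma> b d
      unfolding end_fun_ops(3)[OF A] co_linear using A that
      by (intro smooth_fun_mult[OF charted_M local_sectionD(1)[OF that(3)]] smooth_fun_const)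
        (simp add: end_sections_iff)
  qed (simp add: end_sections_ops)
next
  note fv = fib_vec_fibre[OF pr_some_lift]
  show "\<zero>\<^bsub>EndE\<^esub> \<in> carrier EndE"
    unfolding end_sections_iff
  proof (intro conjI allI ballI impI)
    show "linear_map (Fib m) (Fib m) (\<zero>\<^bsub>EndE\<^esub> m)" for m
      by (rule linear_map_fibreI; (rule fibre_eqI[where m = m])?) (simp_all add: end_sections_ops fv)
    show "smooth_M U (\<lambda>m. co b (end_fun \<zero>\<^bsub>EndE\<^esub> (\<sigma> m) c))" for U \<sigma> b c
      unfolding end_fun_ops(1) by (rule smooth_fun_const)
  qed (simp add: end_sections_ops)
qed (auto simp: end_fun_ops)

subsection \<open>Localization\<close>

text \<open>The equivariant function of the local section \<open>m \<mapsto> [\<sigma> m, \<theta> m v]\<close>, for a bump function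
  \<open>\<theta>\<close> supported in the domain of \<open>\<sigma>\<close>.\<close>

definition frame :: "'m set \<Rightarrow> ('m \<Rightarrow> 'p) \<Rightarrow> ('m \<Rightarrow> complex) \<Rightarrow> 'v \<Rightarrow> 'p \<Rightarrow> 'v" where
  "frame U \<sigma> \<theta> v q =
     (if pr q \<in> U then sc (\<theta> (pr q)) (rp (ginv (gdiff (\<sigma> (pr q)) q)) v) else 0)"

context
  fixes U \<sigma> \<theta> K
  assumes \<sigma>: "local_section PB U \<sigma>" and \<theta>: "smooth_M UNIV \<theta>"
    and K: "closed K" "K \<subseteq> U" "\<And>m. m \<notin> K \<Longrightarrow> \<theta> m = 0"
begin

lemma frame_Gam: "frame U \<sigma> \<theta> v \<in> Gam"
  unfolding Gam_iff
proof
  note U = local_sectionD(1)[OF \<sigma>]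
  show "frame U \<sigma> \<theta> v \<in> VF"
    unfolding vfns_iff
  proof
    fix b assume b: "b \<in> bas R"
    have "open (pr -` (- K))" using K(1) by (intro open_pr_vimage) auto
    then have "closed (pr -` K)" by (simp add: closed_def vimage_Compl)
    then show "smooth_P UNIV (\<lambda>q. co b (frame U \<sigma> \<theta> v q))"
    proof (rule smooth_fun_extend_zero[OF charted_P open_pr_vimage[OF U], where
          f = "\<lambda>q. co b (rp (ginv (gdiff (\<sigma> (pr q)) q)) v)" and \<theta> = "\<lambda>q. \<theta> (pr q)"])
      show "pr -` K \<subseteq> pr -` U" using K(2) by (rule vimage_mono)
      show "smooth_P UNIV (\<lambda>q. \<theta> (pr q))" using smooth_pullback[OF open_UNIV \<theta>] by simp
    qed (simp_all add: frame_def co_linear K smooth_rp_gdiff(2)[OF \<sigma> b])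
  qed
  show "equivariant (frame U \<sigma> \<theta> v)"
    unfolding equivariant_def
    by (simp add: frame_def gdiff_ac2 local_sectionD(3)[OF \<sigma>] G.inv_mult_group rp_mul rp_sc)
qed

lemma frame_along_section: "m \<in> U \<Longrightarrow> frame U \<sigma> \<theta> v (\<sigma> m) = sc (\<theta> m) v"
  by (simp add: frame_def local_sectionD(3)[OF \<sigma>])

lemma fun_to_sec_frame:
  assumes "m \<in> U"
  shows "to_sec (frame U \<sigma> \<theta> v) m = apt (\<sigma> m) (sc (\<theta> m) v)"
  using sec_to_fun_along_section[OF \<sigma> assms, of "to_sec (frame U \<sigma> \<theta> v)"]
    frame_along_section[OF assms, of v] frame_Gam[of v] local_sectionD(3)[OF \<sigma> assms]
    assoc_pt_fib_vec[OF fun_to_sec_fibre local_sectionD(3)[OF \<sigma> assms], of "frame U \<sigma> \<theta> v"] by simp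

text \<open>The local frame and the local coefficients both have to become global objects. One
  factor \<open>\<theta>\<close> extends the coefficient function to M and the other extends the
  frame section, which explains the square on the left.\<close>

lemma frame_expansion:
  assumes f: "f \<in> Gam"
  defines "a \<equiv> \<lambda>c m. if m \<in> U then \<theta> m * co c (f (\<sigma> m)) else 0"
  shows "c \<in> bas R \<Longrightarrow> smooth_M UNIV (a c)"
    "sc (\<theta> (pr q) * \<theta> (pr q)) (f q) = (\<Sum>c\<in>bas R. sc (a c (pr q)) (frame U \<sigma> \<theta> c q))"
proof -
  note U = local_sectionD(1)[OF \<sigma>]
  show "smooth_M UNIV (a c)" if "c \<in> bas R"
  proof (rule smooth_fun_extend_zero[OF charted_M U K(1,2) _ \<theta> K(3)])
    show "smooth_M U (\<lambda>m. co c (f (\<sigma> m)))"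
      using f that smooth_along_section[OF \<sigma>, of "\<lambda>q. co c (f q)"] by (simp add: Gam_iff vfns_iff)
  qed (simp_all add: a_def)
  show "sc (\<theta> (pr q) * \<theta> (pr q)) (f q) = (\<Sum>c\<in>bas R. sc (a c (pr q)) (frame U \<sigma> \<theta> c q))"
  proof (cases "pr q \<in> U")
    case True
    let ?g = "ginv (gdiff (\<sigma> (pr q)) q)"
    have "f q = rp ?g (f (\<sigma> (pr q)))"
      using f True by (intro equivariant_local[OF _ \<sigma>]) (simp_all add: Gam_iff)
    also have "\<dots> = (\<Sum>c\<in>bas R. sc (co c (f (\<sigma> (pr q)))) (rp ?g c))"
      by (subst co_expand[of "f (\<sigma> (pr q))", symmetric]) (simp only: rp_sum rp_sc)
    finally have fq: "f q = (\<Sum>c\<in>bas R. sc (co c (f (\<sigma> (pr q)))) (rp ?g c))" .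
    have "sc (\<theta> (pr q) * \<theta> (pr q)) (f q) =
        (\<Sum>c\<in>bas R. sc (\<theta> (pr q) * \<theta> (pr q)) (sc (co c (f (\<sigma> (pr q)))) (rp ?g c)))"
      unfolding fq by (rule V.scale_sum_right)
    then show ?thesis
      using True by (simp add: a_def frame_def mult_ac)
  next
    case False
    then have "\<theta> (pr q) = 0" using K by blast
    then show ?thesis using False by (simp add: frame_def)
  qed
qed

end

lemma section_bump_ex:
  obtains U \<sigma> \<theta> K where "m \<in> U" "local_section PB U \<sigma>" "smooth_M UNIV \<theta>" "\<theta> m \<noteq> 0"
    "closed K" "K \<subseteq> U" "\<And>m. m \<notin> K \<Longrightarrow> \<theta> m = 0"
proof -
  obtain U \<sigma> where U: "m \<in> U" "local_section PB U \<sigma>" using local_section_ex by blast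
  show ?thesis
    using manifold_bump[OF manifold_M local_sectionD(1)[OF U(2)] U(1)] that[OF U] by metis
qed

lemma section_through:
  assumes e: "e \<in> carrier (Fib m)"
  shows "\<exists>s\<in>carrier SecE. s m = e"
proof -
  obtain U \<sigma> \<theta> K where U: "m \<in> U" and \<sigma>: "local_section PB U \<sigma>" and \<theta>: "smooth_M UNIV \<theta>" "\<theta> m \<noteq> 0"
    and K: "closed K" "K \<subseteq> U" "\<And>m. m \<notin> K \<Longrightarrow> \<theta> m = 0"
    using section_bump_ex[of m] by blast
  \<comment> \<open>Dividing by \<open>\<theta> m\<close> compensates the value of the bump at
    m.\<close>
  let ?f = "frame U \<sigma> \<theta> (sc (inverse (\<theta> m)) (fvec (\<sigma> m) e))"
  have "to_sec ?f m = apt (\<sigma> m) (sc (\<theta> m) (sc (inverse (\<theta> m)) (fvec (\<sigma> m) e)))"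
    by (rule fun_to_sec_frame[OF \<sigma> \<theta>(1) K U])
  also have "\<dots> = e"
    using \<theta>(2) assoc_pt_fib_vec[OF e local_sectionD(3)[OF \<sigma> U]] by simp
  finally show ?thesis
    using fun_to_sec_sections[OF frame_Gam[OF \<sigma> \<theta>(1) K]] by blast
qed

lemma end_sections_faithful:
  assumes A: "A \<in> carrier EndE" and B: "B \<in> carrier EndE"
    and eq: "\<And>s. s \<in> carrier SecE \<Longrightarrow> (\<lambda>m. A m (s m)) = (\<lambda>m. B m (s m))"
  shows "A = B"
proof (rule ext, rule extensionalityI)
  fix m e assume "e \<in> carrier (Fib m)"
  then obtain s where "s \<in> carrier SecE" "s m = e" using section_through by blast
  then show "A m e = B m e" using fun_cong[OF eq, of s m] by simp
qed (use A B in \<open>simp_all add: end_sections_iff\<close>)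

text \<open>Multiply f by the squared bump and expand along global frame sections. T passes through
  the coefficients, all of which vanish at \<open>pr q\<close>, while the bump does not.\<close>

lemma Gam_tensorial:
  assumes T: "\<And>f. f \<in> Gam \<Longrightarrow> T f \<in> Gam"
    and add: "\<And>f g. f \<in> Gam \<Longrightarrow> g \<in> Gam \<Longrightarrow> T (\<lambda>q. f q + g q) = (\<lambda>q. T f q + T g q)"
    and mult: "\<And>a f. smooth_M UNIV a \<Longrightarrow> f \<in> Gam \<Longrightarrow> T (\<lambda>q. sc (a (pr q)) (f q)) = (\<lambda>q. sc (a (pr q)) (T f q))"
    and f: "f \<in> Gam" and q: "f q = 0"
  shows "T f q = 0"
proof -
  have T0: "T (\<lambda>q. 0) = (\<lambda>q. 0)"
    using mult[OF smooth_fun_const[of _ _ 0] Gam_zero] by simp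
  have Tsum: "T (\<lambda>q. \<Sum>i\<in>I. g i q) = (\<lambda>q. \<Sum>i\<in>I. T (g i) q)" if "\<And>i. i \<in> I \<Longrightarrow> g i \<in> Gam" for I :: "'v set" and g
    using that
  proof (induction I rule: infinite_finite_induct)
    case (insert i I)
    then have "T (\<lambda>q. g i q + (\<Sum>i\<in>I. g i q)) = (\<lambda>q. T (g i) q + T (\<lambda>q. \<Sum>i\<in>I. g i q) q)"
      by (intro add Gam_sum) simp_all
    then show ?case using insert by simp
  qed (simp_all add: T0)
  obtain U \<sigma> \<theta> K where U: "pr q \<in> U" and \<sigma>: "local_section PB U \<sigma>" and \<theta>: "smooth_M UNIV \<theta>" "\<theta> (pr q) \<noteq> 0"
    and K: "closed K" "K \<subseteq> U" "\<And>m. m \<notin> K \<Longrightarrow> \<theta> m = 0"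
    using section_bump_ex[of "pr q"] by blast
  define a where "a = (\<lambda>c m. if m \<in> U then \<theta> m * co c (f (\<sigma> m)) else 0)"
  have exp: "\<And>c. c \<in> bas R \<Longrightarrow> smooth_M UNIV (a c)"
    "\<And>q. sc (\<theta> (pr q) * \<theta> (pr q)) (f q) = (\<Sum>c\<in>bas R. sc (a c (pr q)) (frame U \<sigma> \<theta> c q))"
    unfolding a_def by (rule frame_expansion[OF \<sigma> \<theta>(1) K f]; assumption)+
  note fr = frame_Gam[OF \<sigma> \<theta>(1) K]
  \<comment> \<open>By equivariance the zero of f at q spreads over the whole orbit and so reaches
    \<open>\<sigma> (pr q)\<close>, where the coefficients are evaluated.\<close>
  have "ac q (gdiff q (\<sigma> (pr q))) = \<sigma> (pr q)"
    using local_sectionD(3)[OF \<sigma> U] by (intro ac_gdiff) simp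
  then have "f (\<sigma> (pr q)) = rp (ginv (gdiff q (\<sigma> (pr q)))) (f q)"
    using equivariantD[of f q "gdiff q (\<sigma> (pr q))"] f by (simp add: Gam_iff)
  then have a0: "a c (pr q) = 0" for c
    using q U by (simp add: a_def co_linear)
  have \<theta>2: "smooth_M UNIV (\<lambda>m. \<theta> m * \<theta> m)"
    by (intro smooth_fun_mult[OF charted_M open_UNIV] \<theta>(1))
  have "sc (\<theta> (pr q) * \<theta> (pr q)) (T f q) = T (\<lambda>q. sc (\<theta> (pr q) * \<theta> (pr q)) (f q)) q"
    using mult[OF \<theta>2 f] by (rule fun_cong[symmetric])
  also have "\<dots> = T (\<lambda>q. \<Sum>c\<in>bas R. sc (a c (pr q)) (frame U \<sigma> \<theta> c q)) q"
    by (simp only: exp(2))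
  also have "\<dots> = (\<Sum>c\<in>bas R. T (\<lambda>q. sc (a c (pr q)) (frame U \<sigma> \<theta> c q)) q)"
    using Tsum[of "bas R" "\<lambda>c q. sc (a c (pr q)) (frame U \<sigma> \<theta> c q)"] Gam_sc[OF fr exp(1)] by simp
  also have "\<dots> = (\<Sum>c\<in>bas R. sc (a c (pr q)) (T (frame U \<sigma> \<theta> c) q))"
    by (intro sum.cong refl) (simp add: mult[OF exp(1) fr])
  also have "\<dots> = 0" by (simp add: a0)
  finally show ?thesis using \<theta>(2) by simp
qed

text \<open>\<open>Gam_tensorial\<close>, applied to the difference of two sections with the same
  value at m, shows that \<open>T s m\<close> depends on \<open>s m\<close> alone. Evaluating T on
  any global section through a fibre vector therefore defines A.\<close>

lemma sections_tensorial:
  assumes T: "\<And>s. s \<in> carrier SecE \<Longrightarrow> T s \<in> carrier SecE"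
    and add: "\<And>s t. s \<in> carrier SecE \<Longrightarrow> t \<in> carrier SecE \<Longrightarrow>
      T (s \<oplus>\<^bsub>SecE\<^esub> t) = T s \<oplus>\<^bsub>SecE\<^esub> T t"
    and mult: "\<And>a s. smooth_M UNIV a \<Longrightarrow> s \<in> carrier SecE \<Longrightarrow>
      T (\<lambda>m. a m \<odot>\<^bsub>Fib m\<^esub> s m) = (\<lambda>m. a m \<odot>\<^bsub>Fib m\<^esub> T s m)"
  shows "\<exists>A\<in>carrier EndE. \<forall>s\<in>carrier SecE. T s = (\<lambda>m. A m (s m))"
proof -
  define T' where "T' f = to_fun (T (to_sec f))" for f
  have T'_Gam: "T' f \<in> Gam" if "f \<in> Gam" for f
    using that by (simp add: T'_def sec_to_fun_Gam T fun_to_sec_sections)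
  have T'_add: "T' (\<lambda>q. f q + g q) = (\<lambda>q. T' f q + T' g q)" if "f \<in> Gam" "g \<in> Gam" for f g
    using that by (simp add: T'_def fun_to_sec_ops add fun_to_sec_sections sec_to_fun_ops T)
  have T'_mult: "T' (\<lambda>q. sc (a (pr q)) (f q)) = (\<lambda>q. sc (a (pr q)) (T' f q))"
    if "smooth_M UNIV a" "f \<in> Gam" for a f
    unfolding T'_def fun_to_sec_ops(2)[OF that(2)] mult[OF that(1) fun_to_sec_sections[OF that(2)]]
    by (rule ext) (simp add: sec_to_fun_def fib_vec_fibre sections_fibre T fun_to_sec_sections that(2))
  have local: "T s m = T t m"
    if s: "s \<in> carrier SecE" and t: "t \<in> carrier SecE" and eq: "s m = t m" for s t m
  proof -
    let ?q = "some_lift PB m"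
    let ?f = "to_fun s" and ?g = "to_fun t"
    note fg = sec_to_fun_Gam[OF s] sec_to_fun_Gam[OF t]
    have g': "(\<lambda>q. sc (- 1) (?g q)) \<in> Gam" by (rule Gam_sc_const[OF fg(2)])
    have "?f ?q = ?g ?q" by (simp add: sec_to_fun_def eq)
    then have "?f ?q + sc (- 1) (?g ?q) = 0" by simp
    then have "T' (\<lambda>q. ?f q + sc (- 1) (?g q)) ?q = 0"
      using T'_Gam T'_add T'_mult Gam_add[OF fg(1) g']
      by (intro Gam_tensorial[where T = T' and f = "\<lambda>q. ?f q + sc (- 1) (?g q)"])
    then have "T' ?f ?q = T' ?g ?q"
      using T'_add[OF fg(1) g'] T'_mult[OF smooth_fun_const[of _ _ "- 1"] fg(2)] by simp
    then have "fvec ?q (T s m) = fvec ?q (T t m)"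
      using s t by (simp add: T'_def) (simp add: sec_to_fun_def)
    then show ?thesis
      by (rule fibre_eqI[where m = m, rotated 2]) (simp_all add: sections_fibre T s t)
  qed
  \<comment> \<open>The choice of the section through e does not matter, by \<open>local\<close>;
    the restriction provides the required extensionality.\<close>
  define A where "A m = (\<lambda>e\<in>carrier (Fib m). T (SOME s. s \<in> carrier SecE \<and> s m = e) m)" for m
  have A: "A m (s m) = T s m" if s: "s \<in> carrier SecE" for s m
  proof -
    let ?P = "\<lambda>t. t \<in> carrier SecE \<and> t m = s m"
    have "?P (SOME t. ?P t)" by (rule someI[of ?P s]) (simp add: s)
    then have "T (SOME t. ?P t) m = T s m" by (intro local s) simp_all
    then show ?thesis using s by (simp add: A_def sections_fibre)
  qed
  have "linear_map (Fib m) (Fib m) (A m)" for m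
  proof (rule linear_map_fibreI)
    fix e assume "e \<in> carrier (Fib m)"
    then obtain s where s: "s \<in> carrier SecE" "s m = e" using section_through by blast
    show "A m e \<in> carrier (Fib m)"
      using A[OF s(1), of m] s by (simp add: sections_fibre T)
    show "A m (c \<odot>\<^bsub>Fib m\<^esub> e) = c \<odot>\<^bsub>Fib m\<^esub> A m e" for c
      using A[OF Sec.emb_smult_closed[OF s(1), of c], of m] A[OF s(1), of m] s
        fun_cong[OF mult[OF smooth_fun_const[of _ _ c] s(1)], of m] by (simp add: sections_ops)
    fix f assume "f \<in> carrier (Fib m)"
    then obtain t where t: "t \<in> carrier SecE" "t m = f" using section_through by blast
    show "A m (e \<oplus>\<^bsub>Fib m\<^esub> f) = A m e \<oplus>\<^bsub>Fib m\<^esub> A m f"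
      using A[OF Sec.emb_add_closed[OF s(1) t(1)], of m] A[OF s(1), of m] A[OF t(1), of m] s(2) t(2)
        fun_cong[OF add[OF s(1) t(1)], of m] by (simp add: sections_ops)
  qed
  moreover have "smooth_M U (\<lambda>m. co b (end_fun A (\<sigma> m) c))"
    if b: "b \<in> bas R" and c: "c \<in> bas R" and \<sigma>: "local_section PB U \<sigma>" for U \<sigma> b c
  proof (rule smooth_fun_local[OF charted_M])
    fix m assume m: "m \<in> U"
    note U = local_sectionD(1)[OF \<sigma>]
    obtain \<theta> K where \<theta>: "smooth_M UNIV \<theta>" "\<theta> m \<noteq> 0" and K: "closed K" "K \<subseteq> U" "\<And>x. x \<notin> K \<Longrightarrow> \<theta> x = 0"
      using manifold_bump[OF manifold_M U m] by blast
    define s where "s = to_sec (frame U \<sigma> \<theta> c)"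
    have s: "s \<in> carrier SecE"
      unfolding s_def by (rule fun_to_sec_sections[OF frame_Gam[OF \<sigma> \<theta>(1) K]])
    \<comment> \<open>Near m the frame section s is a nonvanishing multiple of the basis vector c.
      There A applied to c is \<open>T s\<close> divided by \<open>\<theta>\<close>, which is
      visibly smooth.\<close>
    define W where "W = U \<inter> \<theta> -` (- {0})"
    have "open (\<theta> -` (- {0}))"
      using continuous_open_preimage[OF smooth_map_on_continuous[OF \<theta>(1)] open_UNIV, of "- {0}"]
      by (simp add: open_Compl)
    then have W: "open W" using U by (simp add: W_def open_Int)
    have "smooth_M U (\<lambda>m. co b (to_fun (T s) (\<sigma> m)))"
      using smooth_along_section[OF \<sigma>, of "\<lambda>q. co b (to_fun (T s) q)"] sec_to_fun_Gam[OF T[OF s]] b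
      by (simp add: Gam_iff vfns_iff)
    then have sTs: "smooth_M W (\<lambda>m. co b (to_fun (T s) (\<sigma> m)))"
      by (rule smooth_map_on_subset) (auto simp: W_def)
    have "smooth_M W (\<lambda>m. inverse (\<theta> m))"
      by (rule smooth_fun_inverse[OF charted_M W smooth_map_on_subset[OF \<theta>(1) subset_UNIV]]) (simp add: W_def)
    from smooth_fun_mult[OF charted_M W this sTs]
    have "smooth_M W (\<lambda>m. co b (end_fun A (\<sigma> m) c))"
    proof (rule smooth_fun_cong[OF charted_M W, rotated])
      fix x assume "x \<in> W"
      then have x: "x \<in> U" "\<theta> x \<noteq> 0" by (simp_all add: W_def)
      note px = local_sectionD(3)[OF \<sigma> x(1)]
      have "s x = \<theta> x \<odot>\<^bsub>Fib x\<^esub> apt (\<sigma> x) c"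
        unfolding s_def assoc_pt_linear(2)[OF px, symmetric] by (rule fun_to_sec_frame[OF \<sigma> \<theta>(1) K x(1)])
      then have "T s x = \<theta> x \<odot>\<^bsub>Fib x\<^esub> A x (apt (\<sigma> x) c)"
        using A[OF s, of x] linear_map_smult[OF \<open>linear_map (Fib x) (Fib x) (A x)\<close>, of "apt (\<sigma> x) c" "\<theta> x"] px
        by simp
      then have "to_fun (T s) (\<sigma> x) = sc (\<theta> x) (end_fun A (\<sigma> x) c)"
        using linear_map_closed[OF \<open>linear_map (Fib x) (Fib x) (A x)\<close>, of "apt (\<sigma> x) c"]
        by (simp add: sec_to_fun_def end_fun_def px fib_vec_fibre[OF px])
      then show "inverse (\<theta> x) * co b (to_fun (T s) (\<sigma> x)) = co b (end_fun A (\<sigma> x) c)"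
        using x(2) by (simp add: co_linear)
    qed
    then show "\<exists>W. open W \<and> m \<in> W \<and> smooth_M W (\<lambda>m. co b (end_fun A (\<sigma> m) c))"
      using W m \<theta>(2) by (intro exI[of _ W]) (simp add: W_def)
  qed
  ultimately have "A \<in> carrier EndE"
    unfolding end_sections_iff by (simp add: A_def)
  moreover have "T s = (\<lambda>m. A m (s m))" if "s \<in> carrier SecE" for s
    using A[OF that] by simp
  ultimately show ?thesis by blast
qed

end


section \<open>Linear maps of power series\<close>

lemma (in cmodule_embedding) emb_series_eqI:
  assumes "x \<in> carrier (series M)" "y \<in> carrier (series M)"
    "\<And>n i. \<iota> (fps_nth x n) i = \<iota> (fps_nth y n) i"
  shows "x = y"
  using assms by (intro fps_ext emb_inj) simp_all

text \<open>Through the embedding of the target, the conditions of \<open>linear_map_seriesI\<close>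
  become identities between ordinary sums.\<close>

lemma linear_map_lin_series:
  assumes M: "cmodule M" and N: "cmodule_embedding t N \<kappa>"
    and T: "\<And>r. linear_map M N (T r)"
  shows "linear_map (series M) (series N) (lin_series N T)"
proof -
  interpret M: cmodule M by fact
  interpret N: cmodule_embedding t N \<kappa> by fact
  interpret N': cmodule N by (rule N.cmodule)
  have Tc: "T r x \<in> carrier N" if "x \<in> carrier M" for r x
    using linear_map_closed[OF T that] .
  have nth: "fps_nth (lin_series N T x) n = (\<Oplus>\<^bsub>N\<^esub>r\<in>{..n}. T r (fps_nth x (n - r)))" for x n
    by (simp add: lin_series_def)
  have emb: "\<kappa> (fps_nth (lin_series N T x) n) j = (\<Sum>r\<le>n. \<kappa> (T r (fps_nth x (n - r))) j)"
    "fps_nth (lin_series N T x) n \<in> carrier N" if "x \<in> carrier (series M)" for x n j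
    unfolding nth using that by (auto intro!: N.emb_finsum Tc)
  have closed: "lin_series N T x \<in> carrier (series N)" if "x \<in> carrier (series M)" for x
    using emb(2)[OF that] by (simp add: carrier_series)
  have T0: "T r \<zero>\<^bsub>M\<^esub> = \<zero>\<^bsub>N\<^esub>" for r
    using linear_map_smult[OF T, of "\<zero>\<^bsub>M\<^esub>" r 0] Tc[of "\<zero>\<^bsub>M\<^esub>" r] by simp
  show ?thesis
  proof (rule linear_map_seriesI[OF M N'.cmodule_axioms closed])
    fix x y assume x: "x \<in> carrier (series M)" and y: "y \<in> carrier (series M)"
    show "lin_series N T (x \<oplus>\<^bsub>series M\<^esub> y) = lin_series N T x \<oplus>\<^bsub>series N\<^esub> lin_series N T y"
    proof (rule N.emb_series_eqI)
      fix n i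
      have "\<kappa> (T r (fps_nth x (n - r) \<oplus>\<^bsub>M\<^esub> fps_nth y (n - r))) i =
          \<kappa> (T r (fps_nth x (n - r))) i + \<kappa> (T r (fps_nth y (n - r))) i" for r
        using x y by (simp add: linear_map_add[OF T] N.emb_add Tc)
      then show "\<kappa> (fps_nth (lin_series N T (x \<oplus>\<^bsub>series M\<^esub> y)) n) i =
          \<kappa> (fps_nth (lin_series N T x \<oplus>\<^bsub>series N\<^esub> lin_series N T y) n) i"
        using x y by (simp add: emb N.emb_add sum.distrib)
    qed (use x y closed in simp_all)
  next
    fix x a assume x: "x \<in> carrier (series M)"
    show "lin_series N T (fps_const a \<odot>\<^bsub>series M\<^esub> x) = fps_const a \<odot>\<^bsub>series N\<^esub> lin_series N T x"
    proof (rule N.emb_series_eqI)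
      fix n i
      have "\<kappa> (T r (a \<odot>\<^bsub>M\<^esub> fps_nth x (n - r))) i = t a (\<kappa> (T r (fps_nth x (n - r))) i)" for r
        using x by (simp add: linear_map_smult[OF T] N.emb_smult Tc)
      then show "\<kappa> (fps_nth (lin_series N T (fps_const a \<odot>\<^bsub>series M\<^esub> x)) n) i =
          \<kappa> (fps_nth (fps_const a \<odot>\<^bsub>series N\<^esub> lin_series N T x) n) i"
        using x closed[OF x] by (simp add: emb M.nth_smult_const N'.nth_smult_const N.emb_smult N.scale_sum_right)
    qed (use x closed in simp_all)
    show "lin_series N T (shift_up M x) = shift_up N (lin_series N T x)"
    proof (rule N.emb_series_eqI)
      fix n i
      show "\<kappa> (fps_nth (lin_series N T (shift_up M x)) n) i = \<kappa> (fps_nth (shift_up N (lin_series N T x)) n) i"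
      proof (cases n)
        case (Suc k)
        \<comment> \<open>The summand r = k + 1 of the left side is omitted here: it applies
          \<open>T\<close> to the zero constant term of the shifted series.\<close>
        have "(\<Sum>r\<le>k. \<kappa> (T r (fps_nth (shift_up M x) (Suc k - r))) i) = (\<Sum>r\<le>k. \<kappa> (T r (fps_nth x (k - r))) i)"
          by (intro sum.cong refl) (auto simp: Suc_diff_le)
        then show ?thesis using x Suc by (simp add: emb T0 N.emb_zero del: series_nth(4)) (simp add: emb T0 N.emb_zero)
      qed (use x in \<open>simp add: emb T0 N.emb_zero\<close>)
    qed (use x closed in simp_all)
  qed
qed

text \<open>Used for expansions with matrix coefficients. The combination is given and returned as
  an identity of values, because in the applications x is defined by a formula and not as a sum in
  the module. Summands are removed one at a time by subtraction.\<close>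

lemma linear_comb:
  assumes M: "cmodule_embedding s M \<iota>" and N: "cmodule_embedding t N \<kappa>"
    and T: "linear_map (series M) (series N) T"
    and "finite I" "\<And>c. c \<in> I \<Longrightarrow> A c \<in> carrier (series M)" "x \<in> carrier (series M)"
    and "\<And>n i. \<iota> (fps_nth x n) i = (\<Sum>c\<in>I. s (k c) (\<iota> (fps_nth (A c) n) i))"
  shows "\<kappa> (fps_nth (T x) n) j = (\<Sum>c\<in>I. t (k c) (\<kappa> (fps_nth (T (A c)) n) j))"
proof -
  interpret M: cmodule_embedding s M \<iota> by fact
  interpret M': cmodule M by (rule M.cmodule)
  interpret N: cmodule_embedding t N \<kappa> by fact
  interpret N': cmodule N by (rule N.cmodule)
  note Tc = linear_map_closed[OF T]
  show ?thesis
    using assms(4-7)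
  proof (induction I arbitrary: x n j)
    case empty
    \<comment> \<open>Without summands all values of x are zero, so x is zero times itself, and a
      linear map sends it to something with vanishing values.\<close>
    have "x = 0 \<odot>\<^bsub>series M\<^esub> x"
    proof (rule M.emb_series_eqI)
      show "\<iota> (fps_nth x n) i = \<iota> (fps_nth (0 \<odot>\<^bsub>series M\<^esub> x) n) i" for n i
        using M'.nth_smult_const[OF empty(2), of 0 n] empty(2,3) by (simp add: M.emb_zero)
    qed (use empty in simp_all)
    then have "T x = fps_const 0 \<odot>\<^bsub>series N\<^esub> T x"
      using linear_map_smult[OF T empty(2), of 0] by simp
    then have "fps_nth (T x) n = 0 \<odot>\<^bsub>N\<^esub> fps_nth (T x) n"
      using N'.nth_smult_const[OF Tc[OF empty(2)], of 0 n] by metis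
    then show ?case
      using N.emb_smult[of "fps_nth (T x) n" 0 j] Tc[OF empty(2)] by simp
  next
    case (insert c I)
    have Ac: "A c \<in> carrier (series M)" and x: "x \<in> carrier (series M)" using insert by simp_all
    let ?y = "x \<oplus>\<^bsub>series M\<^esub> fps_const (- k c) \<odot>\<^bsub>series M\<^esub> A c"
    have y: "?y \<in> carrier (series M)" using Ac x by simp
    have y_nth: "\<iota> (fps_nth ?y n) i = (\<Sum>c\<in>I. s (k c) (\<iota> (fps_nth (A c) n) i))" for n i
      using insert.prems(3)[of n i] insert.hyps Ac x by (simp add: M'.nth_smult_const M.emb_add M.emb_smult)
    have "x = fps_const (k c) \<odot>\<^bsub>series M\<^esub> A c \<oplus>\<^bsub>series M\<^esub> ?y"
      by (rule M.emb_series_eqI) (use Ac x in \<open>simp_all add: M'.nth_smult_const M.emb_add M.emb_smult\<close>)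
    then have "T x = fps_const (k c) \<odot>\<^bsub>series N\<^esub> T (A c) \<oplus>\<^bsub>series N\<^esub> T ?y"
      using linear_map_add[OF T _ y] linear_map_smult[OF T Ac] Ac by (metis M'.smult_series_closed)
    then have "\<kappa> (fps_nth (T x) n) j = t (k c) (\<kappa> (fps_nth (T (A c)) n) j) + \<kappa> (fps_nth (T ?y) n) j"
      using Tc[OF Ac] Tc[OF y] by (simp add: N'.nth_smult_const N.emb_add N.emb_smult)
    also have "\<kappa> (fps_nth (T ?y) n) j = (\<Sum>c\<in>I. t (k c) (\<kappa> (fps_nth (T (A c)) n) j))"
      by (rule insert.IH[OF _ y y_nth]) (use insert in auto)
    finally show ?case using insert.hyps by simp
  qed
qed


section \<open>Differential operators\<close>

text \<open>Only values on F count, provided F is closed under products, since every commutator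
  evaluates the operator on products of members of F.\<close>

lemma diff_order_cong:
  assumes "\<And>a f. a \<in> F \<Longrightarrow> f \<in> F \<Longrightarrow> (\<lambda>x. a x * f x) \<in> F" "\<And>f. f \<in> F \<Longrightarrow> D f = E f" "diff_order \<pi> F k D"
  shows "diff_order \<pi> F k E"
  using assms(2,3)
proof (induction k arbitrary: D E)
  case 0
  then show ?case using assms(1) by simp
next
  case (Suc k)
  have "diff_order \<pi> F k (\<lambda>f y. E (\<lambda>x. a x * f x) y - a (\<pi> y) * E f y)" if "a \<in> F" for a
    by (rule Suc.IH[of "\<lambda>f y. D (\<lambda>x. a x * f x) y - a (\<pi> y) * D f y"])
      (use Suc.prems that assms(1) in auto)
  then show ?case by simp
qed

lemma diff_order_zero: "diff_order \<pi> F k (\<lambda>f x. 0)"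
  by (induction k) simp_all

lemma diff_order_add:
  "diff_order \<pi> F k D \<Longrightarrow> diff_order \<pi> F k E \<Longrightarrow> diff_order \<pi> F k (\<lambda>f x. D f x + E f x)"
proof (induction k arbitrary: D E)
  case 0
  then show ?case by (simp add: algebra_simps)
next
  case (Suc k)
  have "diff_order \<pi> F k (\<lambda>f y. (D (\<lambda>x. a x * f x) y + E (\<lambda>x. a x * f x) y) - a (\<pi> y) * (D f y + E f y))"
    if "a \<in> F" for a
  proof -
    have "diff_order \<pi> F k (\<lambda>f y. (D (\<lambda>x. a x * f x) y - a (\<pi> y) * D f y) + (E (\<lambda>x. a x * f x) y - a (\<pi> y) * E f y))"
      using Suc.prems that by (intro Suc.IH) simp_all
    then show ?thesis by (rule back_subst[where P = "diff_order \<pi> F k"]) (intro ext, simp add: algebra_simps)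
  qed
  then show ?case by simp
qed

lemma diff_order_smult: "diff_order \<pi> F k D \<Longrightarrow> diff_order \<pi> F k (\<lambda>f x. c * D f x)"
proof (induction k arbitrary: D)
  case 0
  then show ?case by (simp add: algebra_simps)
next
  case (Suc k)
  have "diff_order \<pi> F k (\<lambda>f y. c * D (\<lambda>x. a x * f x) y - a (\<pi> y) * (c * D f y))" if "a \<in> F" for a
  proof -
    have "diff_order \<pi> F k (\<lambda>f y. c * (D (\<lambda>x. a x * f x) y - a (\<pi> y) * D f y))"
      using Suc.prems that by (intro Suc.IH) simp
    then show ?thesis by (rule back_subst[where P = "diff_order \<pi> F k"]) (intro ext, simp add: algebra_simps)
  qed
  then show ?case by simp
qed

lemma diff_order_Suc:
  assumes "\<And>a f. a \<in> F \<Longrightarrow> f \<in> F \<Longrightarrow> (\<lambda>x. a x * f x) \<in> F" "diff_order \<pi> F k D"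
  shows "diff_order \<pi> F (Suc k) D"
  using assms(2)
proof (induction k arbitrary: D)
  case 0
  have "diff_order \<pi> F 0 (\<lambda>f y. D (\<lambda>x. a x * f x) y - a (\<pi> y) * D f y)" if "a \<in> F" for a
    by (rule diff_order_cong[OF assms(1) _ diff_order_zero]) (use 0 that in simp_all)
  then show ?case by simp
next
  case (Suc k)
  have "diff_order \<pi> F (Suc k) (\<lambda>f y. D (\<lambda>x. a x * f x) y - a (\<pi> y) * D f y)" if "a \<in> F" for a
    by (rule Suc.IH) (use Suc.prems that in simp)
  then show ?case by (subst diff_order.simps(2)) blast
qed

lemma diff_order_mono:
  assumes "\<And>a f. a \<in> F \<Longrightarrow> f \<in> F \<Longrightarrow> (\<lambda>x. a x * f x) \<in> F" "diff_order \<pi> F k D" "k \<le> l"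
  shows "diff_order \<pi> F l D"
  using assms(3)
proof (induction rule: dec_induct)
  case (step n)
  show ?case by (rule diff_order_Suc[OF assms(1) step.IH])
qed (rule assms(2))

context
  fixes A :: "('a::t2_space, 'e::real_inner) atlas"
  assumes A: "charted A"
begin

interpretation cmodule_embedding "(*)" "smooth_fns A" "\<lambda>f x. f x"
  by (rule cmodule_embedding.intro[OF vector_space_over_itself.vector_space_axioms], unfold_locales)
    (auto simp: smooth_fns_def intro: smooth_fun_const smooth_fun_add[OF A] smooth_fun_mult[OF A])

lemmas smooth_fns_embedding = cmodule_embedding_axioms

lemma smooth_fns_mult: "a \<in> carrier (smooth_fns A) \<Longrightarrow> f \<in> carrier (smooth_fns A) \<Longrightarrow> (\<lambda>x. a x * f x) \<in> carrier (smooth_fns A)"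
  by (simp add: smooth_fns_iff smooth_fun_mult[OF A])

lemma smooth_fns_ops:
  "\<zero>\<^bsub>smooth_fns A\<^esub> = (\<lambda>x. 0)" "f \<oplus>\<^bsub>smooth_fns A\<^esub> g = (\<lambda>x. f x + g x)" "c \<odot>\<^bsub>smooth_fns A\<^esub> f = (\<lambda>x. c * f x)"
  by (simp_all add: smooth_fns_def)

lemma smooth_fns_linear_iff:
  "linear_map (smooth_fns A) (smooth_fns A) D \<longleftrightarrow>
    (\<forall>f\<in>carrier (smooth_fns A). D f \<in> carrier (smooth_fns A)) \<and>
    (\<forall>f\<in>carrier (smooth_fns A). \<forall>g\<in>carrier (smooth_fns A). D (\<lambda>x. f x + g x) = (\<lambda>x. D f x + D g x)) \<and>
    (\<forall>c. \<forall>f\<in>carrier (smooth_fns A). D (\<lambda>x. c * f x) = (\<lambda>x. c * D f x))"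
  by (simp add: linear_map_def smooth_fns_ops Pi_iff)

lemma smooth_fns_linear_zero:
  assumes "linear_map (smooth_fns A) (smooth_fns A) D"
  shows "D (\<lambda>x. 0) = (\<lambda>x. 0)"
  using linear_map_smult[OF assms emb_zero_closed, of 0] by (simp add: smooth_fns_ops)

text \<open>The commutator of a with \<open>D \<circ> E\<close> is
  \<open>D \<circ> [E, a] + [D, a] \<circ> E\<close>. Each summand has a smaller total order, so
  induction on k + l applies.\<close>

lemma diff_order_compose:
  assumes "linear_map (smooth_fns A) (smooth_fns A) D" "linear_map (smooth_fns A) (smooth_fns A) E"
    and "diff_order id (carrier (smooth_fns A)) k D" "diff_order id (carrier (smooth_fns A)) l E"
  shows "diff_order id (carrier (smooth_fns A)) (k + l) (D \<circ> E)"
  using assms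
proof (induction "k + l" arbitrary: k l D E)
  case 0
  then show ?case by (simp add: smooth_fns_linear_iff)
next
  case (Suc n)
  let ?F = "carrier (smooth_fns A)"
  note mult = smooth_fns_mult
  define comm where "comm a D = (\<lambda>f y. D (\<lambda>x. a x * f x) y - a y * D f y)"
    for a and D :: "('a \<Rightarrow> complex) \<Rightarrow> 'a \<Rightarrow> complex"
  have comm_linear: "linear_map (smooth_fns A) (smooth_fns A) (comm a D)"
    if a: "a \<in> ?F" and D: "linear_map (smooth_fns A) (smooth_fns A) D" for a D
    unfolding smooth_fns_linear_iff
  proof (intro conjI ballI allI)
    note D = D[unfolded smooth_fns_linear_iff]
    fix f c assume f: "f \<in> ?F"
    have 1: "D (\<lambda>x. a x * f x) \<in> ?F" "(\<lambda>x. (- 1) * (a x * D f x)) \<in> ?F"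
      using D mult[OF a f] mult[OF a, of "D f"] f emb_smult_closed[of "\<lambda>x. a x * D f x" "- 1"]
      by (simp_all add: smooth_fns_ops)
    then show "comm a D f \<in> ?F"
      using emb_add_closed[OF 1] by (simp add: comm_def smooth_fns_ops)
    have "(\<lambda>x. a x * (c * f x)) = (\<lambda>x. c * (a x * f x))" by (simp add: mult_ac)
    then show "comm a D (\<lambda>x. c * f x) = (\<lambda>x. c * comm a D f x)"
      using D f mult[OF a f] by (simp add: comm_def algebra_simps)
    fix g assume g: "g \<in> ?F"
    show "comm a D (\<lambda>x. f x + g x) = (\<lambda>x. comm a D f x + comm a D g x)"
      using D f g mult[OF a f] mult[OF a g] by (simp add: comm_def distrib_left add_diff_add)
  qed
  have "diff_order id ?F n (comm a (D \<circ> E))" if a: "a \<in> ?F" for a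
  proof -
    note D = Suc.prems(1) and E = Suc.prems(2)
    have zero: "diff_order id ?F n H" if "\<And>f. f \<in> ?F \<Longrightarrow> H f = (\<lambda>x. 0)" for H
      by (rule diff_order_cong[OF mult _ diff_order_zero]) (simp_all add: that)
    note D0 = smooth_fns_linear_zero[OF D]
    \<comment> \<open>An operator of order zero has a commutator vanishing on F, which makes the
      summand zero there; otherwise its order drops by one and the total becomes n.\<close>
    have 1: "diff_order id ?F n (D \<circ> comm a E)"
    proof (cases l)
      case 0
      then have "comm a E f = (\<lambda>x. 0)" if "f \<in> ?F" for f
        using Suc.prems(4) a that by (simp add: comm_def)
      then show ?thesis by (intro zero) (simp add: D0)
    next
      case (Suc l')
      then have "diff_order id ?F l' (comm a E)" using Suc.prems(4) a by (simp add: comm_def)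
      moreover have n: "n = k + l'" using Suc.hyps(2) Suc by simp
      ultimately show ?thesis
        using Suc.hyps(1)[OF n D comm_linear[OF a E] Suc.prems(3)] by simp
    qed
    have 2: "diff_order id ?F n (comm a D \<circ> E)"
    proof (cases k)
      case 0
      then have "comm a D f = (\<lambda>x. 0)" if "f \<in> ?F" for f
        using Suc.prems(3) a that by (simp add: comm_def)
      then show ?thesis using E by (intro zero) (simp add: smooth_fns_linear_iff)
    next
      case (Suc k')
      then have "diff_order id ?F k' (comm a D)" using Suc.prems(3) a by (simp add: comm_def)
      moreover have n: "n = k' + l" using Suc.hyps(2) Suc by simp
      ultimately show ?thesis
        using Suc.hyps(1)[OF n comm_linear[OF a D] E _ Suc.prems(4)] by simp
    qed
    show ?thesis
    proof (rule diff_order_cong[OF mult _ diff_order_add[OF 1 2]])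
      fix f assume f: "f \<in> ?F"
      have Ef: "E f \<in> ?F" "E (\<lambda>x. a x * f x) \<in> ?F" using E f mult[OF a f] by (simp_all add: smooth_fns_linear_iff)
      have aE: "(\<lambda>x. a x * E f x) \<in> ?F" by (rule mult[OF a Ef(1)])
      have cE: "comm a E f \<in> ?F" using comm_linear[OF a E] f by (simp add: smooth_fns_linear_iff)
      have "E (\<lambda>x. a x * f x) = (\<lambda>x. comm a E f x + a x * E f x)" by (simp add: comm_def)
      then have "D (E (\<lambda>x. a x * f x)) = (\<lambda>x. D (comm a E f) x + D (\<lambda>x. a x * E f x) x)"
        using D cE aE by (simp only: smooth_fns_linear_iff)
      then show "(\<lambda>x. (D \<circ> comm a E) f x + (comm a D \<circ> E) f x) = comm a (D \<circ> E) f"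
        by (simp add: comm_def add_diff_eq)
    qed
  qed
  then have "diff_order id ?F (Suc n) (D \<circ> E)" by (simp add: comm_def comp_def)
  then show ?case using Suc.hyps(2) by simp
qed

lemma diff_ops_iff:
  "D \<in> carrier (diff_ops A) \<longleftrightarrow> linear_map (smooth_fns A) (smooth_fns A) D \<and>
    (\<exists>k. diff_order id (carrier (smooth_fns A)) k D) \<and> (\<forall>f. f \<notin> carrier (smooth_fns A) \<longrightarrow> D f = (\<lambda>x. 0))"
  by (simp add: diff_ops_def)

lemma diff_ops_ops:
  "\<zero>\<^bsub>diff_ops A\<^esub> = (\<lambda>f x. 0)" "D \<oplus>\<^bsub>diff_ops A\<^esub> E = (\<lambda>f x. D f x + E f x)"
  "c \<odot>\<^bsub>diff_ops A\<^esub> D = (\<lambda>f x. c * D f x)" "D \<otimes>\<^bsub>diff_ops A\<^esub> E = D \<circ> E"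
  by (simp_all add: diff_ops_def)

lemma diff_ops_compose:
  assumes D: "D \<in> carrier (diff_ops A)" and E: "E \<in> carrier (diff_ops A)"
  shows "D \<circ> E \<in> carrier (diff_ops A)"
  unfolding diff_ops_iff
proof (intro conjI allI impI)
  have l: "linear_map (smooth_fns A) (smooth_fns A) D" "linear_map (smooth_fns A) (smooth_fns A) E"
    using D E by (simp_all add: diff_ops_iff)
  then show "linear_map (smooth_fns A) (smooth_fns A) (D \<circ> E)"
    by (simp add: smooth_fns_linear_iff)
  show "\<exists>k. diff_order id (carrier (smooth_fns A)) k (D \<circ> E)"
    using D E diff_order_compose[OF l] unfolding diff_ops_iff by blast
  have "D (\<lambda>x. 0) = (\<lambda>x. 0)" by (rule smooth_fns_linear_zero[OF l(1)])
  then show "(D \<circ> E) f = (\<lambda>x. 0)" if "f \<notin> carrier (smooth_fns A)" for f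
    using E that by (simp add: diff_ops_iff)
qed

lemma diff_ops_embedding: "cmodule_embedding (*) (diff_ops A) (\<lambda>D (f, x). D f x)"
proof (rule cmodule_embedding.intro[OF vector_space_over_itself.vector_space_axioms], unfold_locales)
  note F = emb_zero_closed emb_add_closed emb_smult_closed
  show "\<zero>\<^bsub>diff_ops A\<^esub> \<in> carrier (diff_ops A)"
    unfolding diff_ops_iff diff_ops_ops
  proof (intro conjI exI)
    show "linear_map (smooth_fns A) (smooth_fns A) (\<lambda>f x. 0)"
      using F(1) by (simp add: smooth_fns_linear_iff) (simp add: smooth_fns_ops)
    show "diff_order id (carrier (smooth_fns A)) 0 (\<lambda>f x. 0)" by (rule diff_order_zero)
  qed simp
  fix D assume D: "D \<in> carrier (diff_ops A)"
  show "D = E" if "E \<in> carrier (diff_ops A)"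
    "\<And>i. (case i of (f, x) \<Rightarrow> D f x) = (case i of (f, x) \<Rightarrow> E f x)" for E
    using that(2) by (intro ext) (metis case_prod_conv)
  obtain k where k: "diff_order id (carrier (smooth_fns A)) k D" using D unfolding diff_ops_iff by blast
  show "c \<odot>\<^bsub>diff_ops A\<^esub> D \<in> carrier (diff_ops A)" for c
    unfolding diff_ops_iff diff_ops_ops
  proof (intro conjI exI)
    show "linear_map (smooth_fns A) (smooth_fns A) (\<lambda>f x. c * D f x)"
      using D F(3)[of "D _" c] by (simp add: diff_ops_iff smooth_fns_linear_iff smooth_fns_ops distrib_left mult_ac)
    show "diff_order id (carrier (smooth_fns A)) k (\<lambda>f x. c * D f x)" by (rule diff_order_smult[OF k])
  qed (use D in \<open>simp add: diff_ops_iff\<close>)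
  fix E assume E: "E \<in> carrier (diff_ops A)"
  obtain l where l: "diff_order id (carrier (smooth_fns A)) l E" using E unfolding diff_ops_iff by blast
  show "D \<oplus>\<^bsub>diff_ops A\<^esub> E \<in> carrier (diff_ops A)"
    unfolding diff_ops_iff diff_ops_ops
  proof (intro conjI exI)
    show "linear_map (smooth_fns A) (smooth_fns A) (\<lambda>f x. D f x + E f x)"
      using D E F(2)[of "D _" "E _"]
      by (simp add: diff_ops_iff smooth_fns_linear_iff smooth_fns_ops distrib_left add_ac)
    show "diff_order id (carrier (smooth_fns A)) (max k l) (\<lambda>f x. D f x + E f x)"
      by (intro diff_order_add diff_order_mono[OF smooth_fns_mult k] diff_order_mono[OF smooth_fns_mult l]) auto
  qed (use D E in \<open>simp add: diff_ops_iff\<close>)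
qed (auto simp: diff_ops_ops)

end

lemma (in cmodule_embedding) emb_nth_smult:
  assumes "x \<in> carrier (series M)"
  shows "\<iota> (fps_nth (c \<odot>\<^bsub>series M\<^esub> x) n) i = (\<Sum>k\<le>n. scale (fps_nth c k) (\<iota> (fps_nth x (n - k)) i))"
  unfolding nth_smult_series using assms by (subst emb_finsum) (simp_all add: emb_smult emb_smult_closed)

lemma linear_map_cong:
  assumes "linear_map (series M) (series N) T" "cmodule M" "\<And>x. x \<in> carrier (series M) \<Longrightarrow> T' x = T x"
  shows "linear_map (series M) (series N) T'"
proof -
  interpret cmodule M by fact
  show ?thesis
    using assms(1) unfolding linear_map_def by (auto simp: assms(3) Pi_iff)
qed

lemma coeffwise_nth [simp]: "fps_nth (coeffwise F x) n = F (fps_nth x n)"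
  by (simp add: coeffwise_def)


section \<open>The quantized bundle\<close>

locale quantized_bundle = assoc_bundle PB R
  for PB :: "('p::{t2_space,second_countable_topology}, 'm::{t2_space,second_countable_topology},
      'g::{t2_space,second_countable_topology},
      'ep::real_inner, 'em::real_inner, 'eg::real_inner) pfb"
    and R :: "('g, 'v::ab_group_add) grep" +
  fixes C \<rho> Q
  assumes quantization: "bundle_quantization PB C \<rho>" and bimodule: "vertical_bimodule PB \<rho> Q"
begin

abbreviation "slmod \<equiv> sec_lmod PB Q R"
abbreviation "srmod \<equiv> sec_rmod PB \<rho> R"
abbreviation "vl \<equiv> ver_lmod PB Q"
abbreviation "rm \<equiv> rmod PB \<rho>"
abbreviation "CP \<equiv> smooth_fns (tot PB)"
abbreviation "CM \<equiv> smooth_fns (base PB)"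
abbreviation "DP \<equiv> diff_ops (tot PB)"
abbreviation "VP \<equiv> ver_ops PB"

sublocale CP: cmodule_embedding "(*)" CP "\<lambda>f x. f x"
  by (rule smooth_fns_embedding[OF charted_P])

sublocale DP: cmodule_embedding "(*)" DP "\<lambda>D (f, x). D f x"
  by (rule diff_ops_embedding[OF charted_P])

lemma ver_ops_iff: "D \<in> carrier VP \<longleftrightarrow> D \<in> carrier DP \<and>
    (\<forall>f\<in>carrier CP. \<forall>a\<in>carrier CM. D (\<lambda>q. f q * a (pr q)) = (\<lambda>q. D f q * a (pr q)))"
  by (simp add: ver_ops_def)

lemma ver_ops_ops:
  "\<zero>\<^bsub>VP\<^esub> = \<zero>\<^bsub>DP\<^esub>" "D \<oplus>\<^bsub>VP\<^esub> E = D \<oplus>\<^bsub>DP\<^esub> E" "c \<odot>\<^bsub>VP\<^esub> D = c \<odot>\<^bsub>DP\<^esub> D"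
  by (simp_all add: ver_ops_def)

lemmas DP_ops = diff_ops_ops[OF charted_P]
lemmas CP_ops = smooth_fns_ops[OF charted_P]

sublocale VP: cmodule_embedding "(*)" VP "\<lambda>D (f, x). D f x"
proof unfold_locales
  note closed = DP.emb_zero_closed DP.emb_add_closed DP.emb_smult_closed
  show "\<zero>\<^bsub>VP\<^esub> \<in> carrier VP"
    using closed(1) by (simp add: ver_ops_iff ver_ops_ops) (simp add: DP_ops)
  fix D assume D: "D \<in> carrier VP"
  show "c \<odot>\<^bsub>VP\<^esub> D \<in> carrier VP" for c
    using D closed(3)[of D c] by (simp add: ver_ops_iff ver_ops_ops) (simp add: DP_ops mult.assoc)
  fix E assume E: "E \<in> carrier VP"
  show "D \<oplus>\<^bsub>VP\<^esub> E \<in> carrier VP"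
    using D E closed(2)[of D E] by (simp add: ver_ops_iff ver_ops_ops) (simp add: DP_ops distrib_right)
next
  show "D = E" if "\<And>i. (case i of (f, x) \<Rightarrow> D f x) = (case i of (f, x) \<Rightarrow> E f x)" for D E
    using that by (intro ext) (metis case_prod_conv)
qed (auto simp: ver_ops_ops DP_ops)

sublocale CPm: cmodule CP by (rule CP.cmodule)
sublocale DPm: cmodule DP by (rule DP.cmodule)
sublocale VPm: cmodule VP by (rule VP.cmodule)
sublocale Secm: cmodule "SecE" by (rule Sec.cmodule)
sublocale Endm: cmodule "EndE" by (rule End.cmodule)

lemma DP_linear: "D \<in> carrier DP \<Longrightarrow> linear_map CP CP D"
  by (simp add: diff_ops_iff[OF charted_P])

lemma DP_closed [simp]: "D \<in> carrier DP \<Longrightarrow> f \<in> carrier CP \<Longrightarrow> D f \<in> carrier CP"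
  by (rule linear_map_closed[OF DP_linear])

lemma DP_zero: "D \<in> carrier DP \<Longrightarrow> D (\<lambda>x. 0) = (\<lambda>x. 0)"
  by (rule smooth_fns_linear_zero[OF charted_P DP_linear])

lemma DP_outside: "D \<in> carrier DP \<Longrightarrow> f \<notin> carrier CP \<Longrightarrow> D f = (\<lambda>x. 0)"
  by (simp add: diff_ops_iff[OF charted_P])

lemma DP_comb:
  assumes D: "D \<in> carrier DP" and I: "finite I" and g: "\<And>j. j \<in> I \<Longrightarrow> g j \<in> carrier CP"
  shows "D (\<lambda>x. \<Sum>j\<in>I. k j * g j x) = (\<lambda>x. \<Sum>j\<in>I. k j * D (g j) x)" "(\<lambda>x. \<Sum>j\<in>I. k j * g j x) \<in> carrier CP"
proof -
  have "D (\<lambda>x. \<Sum>j\<in>I. k j * g j x) = (\<lambda>x. \<Sum>j\<in>I. k j * D (g j) x) \<and> (\<lambda>x. \<Sum>j\<in>I. k j * g j x) \<in> carrier CP"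
    using I g
  proof (induction I)
    case empty
    then show ?case using DP_zero[OF D] CP.emb_zero_closed by (simp add: CP_ops)
  next
    case (insert i I)
    have c: "(\<lambda>x. k i * g i x) \<in> carrier CP"
      using CP.emb_smult_closed[of "g i" "k i"] insert.prems by (simp add: CP_ops)
    have "D (\<lambda>x. k i * g i x + (\<Sum>j\<in>I. k j * g j x)) = (\<lambda>x. D (\<lambda>x. k i * g i x) x + D (\<lambda>x. \<Sum>j\<in>I. k j * g j x) x)"
      using linear_map_add[OF DP_linear[OF D] c, of "\<lambda>x. \<Sum>j\<in>I. k j * g j x"] insert by (simp add: CP_ops)
    moreover have "D (\<lambda>x. k i * g i x) = (\<lambda>x. k i * D (g i) x)"
      using linear_map_smult[OF DP_linear[OF D], of "g i" "k i"] insert.prems by (simp add: CP_ops)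
    moreover have "(\<lambda>x. k i * g i x + (\<Sum>j\<in>I. k j * g j x)) \<in> carrier CP"
      using CP.emb_add_closed[OF c, of "\<lambda>x. \<Sum>j\<in>I. k j * g j x"] insert by (simp add: CP_ops)
    ultimately show ?case using insert by simp
  qed
  then show "D (\<lambda>x. \<Sum>j\<in>I. k j * g j x) = (\<lambda>x. \<Sum>j\<in>I. k j * D (g j) x)"
    "(\<lambda>x. \<Sum>j\<in>I. k j * g j x) \<in> carrier CP" by blast+
qed

lemma DP_sum:
  assumes "D \<in> carrier DP" "finite I" "\<And>j. j \<in> I \<Longrightarrow> g j \<in> carrier CP"
  shows "D (\<lambda>x. \<Sum>j\<in>I. g j x) = (\<lambda>x. \<Sum>j\<in>I. D (g j) x)"
  using DP_comb(1)[OF assms, where k = "\<lambda>_. 1"] by simp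

lemma CP_sum: "finite I \<Longrightarrow> (\<And>j. j \<in> I \<Longrightarrow> g j \<in> carrier CP) \<Longrightarrow> (\<lambda>x. \<Sum>j\<in>I. g j x) \<in> carrier CP"
  by (simp add: smooth_fns_iff smooth_fun_sum[OF charted_P open_UNIV])

subsection \<open>Series of operators\<close>

lemma nth_op_apply:
  assumes "D \<in> carrier (series DP)" "f \<in> carrier (series CP)"
  shows "fps_nth (op_apply PB D f) n x = (\<Sum>r\<le>n. fps_nth D r (fps_nth f (n - r)) x)"
  unfolding op_apply_def lin_series_def fps_nth_Abs_fps using assms by (intro CP.emb_finsum) simp_all

lemma op_apply_linear:
  assumes "D \<in> carrier (series DP)"
  shows "linear_map (series CP) (series CP) (op_apply PB D)"
  unfolding op_apply_def
  by (rule linear_map_lin_series[OF CP.cmodule CP.cmodule_embedding_axioms]) (use assms in \<open>simp add: DP_linear\<close>)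

lemma op_apply_closed:
  "D \<in> carrier (series DP) \<Longrightarrow> f \<in> carrier (series CP) \<Longrightarrow> op_apply PB D f \<in> carrier (series CP)"
  by (rule linear_map_closed[OF op_apply_linear])

text \<open>The Cauchy sum is symmetric: read backwards it is the \<open>lin_series\<close> whose
  coefficients evaluate operators at the coefficients of f.\<close>

lemma op_apply_linear_left:
  assumes f: "f \<in> carrier (series CP)"
  shows "linear_map (series DP) (series CP) (\<lambda>D. op_apply PB D f)"
proof (rule linear_map_cong[OF _ DP.cmodule])
  let ?T = "\<lambda>r D. D (fps_nth f r)"
  have T: "linear_map DP CP (?T r)" for r
    using f by (simp add: linear_map_def DP_ops CP_ops Pi_iff)
  show "linear_map (series DP) (series CP) (lin_series CP ?T)"
    by (rule linear_map_lin_series[OF DP.cmodule CP.cmodule_embedding_axioms T])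
  fix D assume D: "D \<in> carrier (series DP)"
  show "op_apply PB D f = lin_series CP ?T D"
  proof (intro fps_ext ext)
    fix n x
    have "fps_nth (lin_series CP ?T D) n x = (\<Sum>r\<le>n. fps_nth D (n - r) (fps_nth f r) x)"
      unfolding lin_series_def fps_nth_Abs_fps using D f by (intro CP.emb_finsum) simp_all
    also have "\<dots> = (\<Sum>r\<le>n. fps_nth D r (fps_nth f (n - r)) x)"
      by (rule sum.reindex_bij_witness[of _ "\<lambda>r. n - r" "\<lambda>r. n - r"]) auto
    finally show "fps_nth (op_apply PB D f) n x = fps_nth (lin_series CP ?T D) n x"
      using nth_op_apply[OF D f] by simp
  qed
qed

lemma nth_mult_DP:
  assumes "D \<in> carrier (series DP)" "E \<in> carrier (series DP)"
  shows "fps_nth (D \<otimes>\<^bsub>series DP\<^esub> E) n f x = (\<Sum>i\<le>n. fps_nth D i (fps_nth E (n - i) f) x)"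
    "D \<otimes>\<^bsub>series DP\<^esub> E \<in> carrier (series DP)"
proof -
  have eq: "fps_nth (D \<otimes>\<^bsub>series DP\<^esub> E) n = (\<Oplus>\<^bsub>DP\<^esub>i\<in>{..n}. fps_nth D i \<circ> fps_nth E (n - i))" for n
    by (simp only: series_def monoid.simps ring.simps fps_nth_Abs_fps DP_ops)
  have c: "fps_nth D i \<circ> fps_nth E (n - i) \<in> carrier DP" for i n
    using assms by (intro diff_ops_compose[OF charted_P]) simp_all
  show "fps_nth (D \<otimes>\<^bsub>series DP\<^esub> E) n f x = (\<Sum>i\<le>n. fps_nth D i (fps_nth E (n - i) f) x)"
    using DP.emb_finsum(1)[of "{..n}" "\<lambda>i. fps_nth D i \<circ> fps_nth E (n - i)" "(f, x)"] c by (simp add: eq)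
  show "D \<otimes>\<^bsub>series DP\<^esub> E \<in> carrier (series DP)"
    unfolding carrier_series eq using c by (intro allI DP.emb_finsum(2)) simp_all
qed

lemma op_apply_mult:
  assumes D: "D \<in> carrier (series DP)" and E: "E \<in> carrier (series DP)" and f: "f \<in> carrier (series CP)"
  shows "op_apply PB (D \<otimes>\<^bsub>series DP\<^esub> E) f = op_apply PB D (op_apply PB E f)"
proof (intro fps_ext ext)
  fix n x
  have E': "fps_nth (op_apply PB E f) m = (\<lambda>x. \<Sum>j\<le>m. fps_nth E j (fps_nth f (m - j)) x)" for m
    by (rule ext) (simp add: nth_op_apply[OF E f])
  have D': "fps_nth D i (\<lambda>x. \<Sum>j\<le>m. fps_nth E j (fps_nth f (m - j)) x) =
      (\<lambda>x. \<Sum>j\<le>m. fps_nth D i (fps_nth E j (fps_nth f (m - j))) x)" for i m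
    by (rule DP_sum) (use D E f in simp_all)
  have "fps_nth (op_apply PB D (op_apply PB E f)) n x =
      (\<Sum>i\<le>n. \<Sum>j\<le>n - i. fps_nth D i (fps_nth E j (fps_nth f (n - i - j))) x)"
    unfolding nth_op_apply[OF D op_apply_closed[OF E f]] E' D' by simp
  \<comment> \<open>The same sum over triples with total n, regrouped so that the combined order r
    of the two operators is the outer index.\<close>
  also have "\<dots> = (\<Sum>r\<le>n. \<Sum>i\<le>r. fps_nth D i (fps_nth E (r - i) (fps_nth f (n - r))) x)"
    using fps_mult_assoc_lemma[of "\<lambda>i j k. fps_nth D i (fps_nth E j (fps_nth f k)) x" n n]
    by (simp add: atMost_atLeast0)
  also have "\<dots> = fps_nth (op_apply PB (D \<otimes>\<^bsub>series DP\<^esub> E) f) n x"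
    by (simp add: nth_op_apply[OF nth_mult_DP(2)[OF D E] f] nth_mult_DP(1)[OF D E])
  finally show "fps_nth (op_apply PB (D \<otimes>\<^bsub>series DP\<^esub> E) f) n x = fps_nth (op_apply PB D (op_apply PB E f)) n x" ..
qed

lemma Q_linear: "linear_map VP DP (Q r)"
  and Q_zero: "D \<in> carrier VP \<Longrightarrow> Q 0 D = D"
  and Q_bij: "bij_betw (qmap PB Q) (carrier (series VP)) (commutant PB \<rho>)"
  and Q_invariant: "A \<in> carrier (series VP) \<Longrightarrow> f \<in> carrier (series CP) \<Longrightarrow>
    coeffwise (pull_fun PB g) (vl A f) =
    vl (coeffwise (pull_op PB g) A) (coeffwise (pull_fun PB g) f)"
  using bimodule unfolding vertical_bimodule_def by blast+

lemma commutant_iff: "D \<in> commutant PB \<rho> \<longleftrightarrow> D \<in> carrier (series DP) \<and>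
    (\<forall>f\<in>carrier (series CP). \<forall>a\<in>carrier (series CM).
      op_apply PB D (rm f a) = rm (op_apply PB D f) a)"
  by (simp add: commutant_def)

text \<open>Closedness of the right action is a premise because it is derived only later, in
  \<open>rmod_closed\<close>.\<close>

lemma commutant_mult:
  assumes D: "D \<in> commutant PB \<rho>" and E: "E \<in> commutant PB \<rho>"
    and rmod: "\<And>f a. f \<in> carrier (series CP) \<Longrightarrow> a \<in> carrier (series CM) \<Longrightarrow> rm f a \<in> carrier (series CP)"
  shows "D \<otimes>\<^bsub>series DP\<^esub> E \<in> commutant PB \<rho>"
  using assms nth_mult_DP(2)[of D E] by (simp add: commutant_iff op_apply_mult op_apply_closed)

lemma qmap_commutant: "A \<in> carrier (series VP) \<Longrightarrow> qmap PB Q A \<in> commutant PB \<rho>"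
  using Q_bij by (rule bij_betw_apply)

lemma qmap_closed: "A \<in> carrier (series VP) \<Longrightarrow> qmap PB Q A \<in> carrier (series DP)"
  using qmap_commutant commutant_iff by blast

lemma qmap_linear: "linear_map (series VP) (series DP) (qmap PB Q)"
  unfolding qmap_def by (rule linear_map_lin_series[OF VP.cmodule DP.cmodule_embedding_axioms Q_linear])

lemma ver_lmod_linear:
  "A \<in> carrier (series VP) \<Longrightarrow> linear_map (series CP) (series CP) (vl A)"
  unfolding ver_lmod_def by (rule op_apply_linear[OF qmap_closed])

lemma ver_lmod_linear_left:
  "f \<in> carrier (series CP) \<Longrightarrow> linear_map (series VP) (series CP) (\<lambda>A. vl A f)"
  using op_apply_linear_left[of f] qmap_linear unfolding ver_lmod_def linear_map_def by (auto simp: Pi_iff)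

lemma ver_lmod_closed:
  "A \<in> carrier (series VP) \<Longrightarrow> f \<in> carrier (series CP) \<Longrightarrow> vl A f \<in> carrier (series CP)"
  by (rule linear_map_closed[OF ver_lmod_linear])

lemma ver_lmod_lowest:
  assumes "A \<in> carrier (series VP)" "f \<in> carrier (series CP)"
  shows "fps_nth (vl A f) 0 = fps_nth A 0 (fps_nth f 0)"
proof -
  have A0: "fps_nth A 0 \<in> carrier VP" "fps_nth A 0 \<in> carrier DP"
    using assms(1) carrier_seriesD[OF assms(1), of 0] by (simp_all add: ver_ops_iff)
  have "fps_nth (qmap PB Q A) 0 = fps_nth A 0"
    using A0 by (simp add: qmap_def lin_series_def Q_zero)
  then show ?thesis
    by (intro ext) (simp add: ver_lmod_def nth_op_apply[OF qmap_closed[OF assms(1)] assms(2)])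
qed

subsection \<open>The right module structure\<close>

lemma rho_bilinear: "bilinear_map CP CM CP (\<rho> r)"
  and rho_0: "h \<in> carrier CP \<Longrightarrow> b \<in> carrier CM \<Longrightarrow> \<rho> 0 h b = (\<lambda>q. h q * b (pr q))"
  and rho_invariant: "f \<in> carrier (series CP) \<Longrightarrow> a \<in> carrier (series CM) \<Longrightarrow>
    coeffwise (pull_fun PB g) (rm f a) = rm (coeffwise (pull_fun PB g) f) a"
  using quantization unfolding bundle_quantization_def bidifferential_def by blast+

lemma rho_linear: "a \<in> carrier CM \<Longrightarrow> linear_map CP CP (\<lambda>f. \<rho> r f a)"
  using rho_bilinear unfolding bilinear_map_def by blast

text \<open>For fixed a the sum over r + i + j = n is regrouped by r + j. The contributions with
  equal r + j form one linear map, and the right action becomes a \<open>lin_series\<close> of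
  these.\<close>

lemma rmod_linear:
  assumes a: "a \<in> carrier (series CM)"
  shows "linear_map (series CP) (series CP) (\<lambda>f. rm f a)"
proof (rule linear_map_cong[OF _ CP.cmodule])
  define T where "T r f = (\<lambda>q. \<Sum>j\<le>r. \<rho> (r - j) f (fps_nth a j) q)" for r f
  have \<rho>c: "\<rho> r f (fps_nth a j) \<in> carrier CP" if "f \<in> carrier CP" for r f j
    using a that by (intro linear_map_closed[OF rho_linear]) simp_all
  have \<rho>add: "\<rho> r (\<lambda>q. f q + g q) (fps_nth a j) = (\<lambda>q. \<rho> r f (fps_nth a j) q + \<rho> r g (fps_nth a j) q)"
    if "f \<in> carrier CP" "g \<in> carrier CP" for r f g j
    using linear_map_add[OF rho_linear[of "fps_nth a j"] that] a by (simp add: CP_ops)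
  have \<rho>sc: "\<rho> r (\<lambda>q. c * f q) (fps_nth a j) = (\<lambda>q. c * \<rho> r f (fps_nth a j) q)"
    if "f \<in> carrier CP" for r f c j
    using linear_map_smult[OF rho_linear[of "fps_nth a j"] that] a by (simp add: CP_ops)
  have Tc: "T r f \<in> carrier CP" if "f \<in> carrier CP" for r f
    unfolding T_def using \<rho>c[OF that] by (intro CP_sum) simp_all
  have T: "linear_map CP CP (T r)" for r
    using Tc by (simp add: linear_map_def CP_ops T_def \<rho>add \<rho>sc sum.distrib sum_distrib_left Pi_iff)
  show "linear_map (series CP) (series CP) (lin_series CP T)"
    by (rule linear_map_lin_series[OF CP.cmodule CP.cmodule_embedding_axioms T])
  fix f assume f: "f \<in> carrier (series CP)"
  show "rm f a = lin_series CP T f"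
  proof (intro fps_ext ext)
    fix n q
    have fin: "finite {(r, i, j). r + i + j = (n :: nat)}"
      by (rule finite_subset[of _ "{..n} \<times> {..n} \<times> {..n}"]) auto
    have "fps_nth (rm f a) n q =
        (\<Sum>p\<in>{(r, i, j). r + i + j = n}. (\<lambda>(r, i, j). \<rho> r (fps_nth f i) (fps_nth a j)) p q)"
      unfolding rmod_def bilin_series_def fps_nth_Abs_fps
      by (intro CP.emb_finsum fin) (use f \<rho>c in auto)
    also have "\<dots> = (\<Sum>(r, j)\<in>(SIGMA r:{..n}. {..r}). \<rho> (r - j) (fps_nth f (n - r)) (fps_nth a j) q)"
      by (rule sum.reindex_bij_witness[of _ "\<lambda>(r, j). (r - j, n - r, j)" "\<lambda>(r, i, j). (r + j, j)"]) auto
    also have "\<dots> = (\<Sum>r\<le>n. T r (fps_nth f (n - r)) q)"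
      unfolding T_def by (rule sum.Sigma[symmetric]) simp_all
    also have "\<dots> = fps_nth (lin_series CP T f) n q"
      unfolding lin_series_def fps_nth_Abs_fps
      by (rule CP.emb_finsum(1)[symmetric]) (use f Tc in simp_all)
    finally show "fps_nth (rm f a) n q = fps_nth (lin_series CP T f) n q" .
  qed
qed

lemma rmod_closed:
  "f \<in> carrier (series CP) \<Longrightarrow> a \<in> carrier (series CM) \<Longrightarrow> rm f a \<in> carrier (series CP)"
  by (rule linear_map_closed[OF rmod_linear])

lemma rmod_lowest:
  assumes "f \<in> carrier (series CP)" "a \<in> carrier (series CM)"
  shows "fps_nth (rm f a) 0 = (\<lambda>q. fps_nth f 0 q * fps_nth a 0 (pr q))"
proof -
  have set: "{(r, i, j). r + i + j = (0::nat)} = {(0, 0, 0)}" by auto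
  have "fps_nth (rm f a) 0 q =
      (\<Sum>p\<in>{(0, 0, 0)}. (\<lambda>(r, i, j). \<rho> r (fps_nth f i) (fps_nth a j)) p q)" for q
    unfolding rmod_def bilin_series_def fps_nth_Abs_fps set
    by (rule CP.emb_finsum(1)) (use assms linear_map_closed[OF rho_linear] in auto)
  then show ?thesis using assms by (intro ext) (simp add: rho_0)
qed

lemma ver_lmod_rmod:
  "A \<in> carrier (series VP) \<Longrightarrow> f \<in> carrier (series CP) \<Longrightarrow> a \<in> carrier (series CM) \<Longrightarrow>
    vl A (rm f a) = rm (vl A f) a"
  using qmap_commutant[of A] by (simp add: commutant_iff ver_lmod_def)

text \<open>The composed operators again lie in the commutant, which is the image of
  \<open>qmap\<close>. So \<open>inv_into\<close> is a genuine inverse there, and the product acts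
  by composition.\<close>

lemma ver_star:
  assumes A: "A \<in> carrier (series VP)" and B: "B \<in> carrier (series VP)"
  shows "ver_star PB Q A B \<in> carrier (series VP)"
    "f \<in> carrier (series CP) \<Longrightarrow> vl (ver_star PB Q A B) f = vl A (vl B f)"
proof -
  let ?X = "qmap PB Q A \<otimes>\<^bsub>series DP\<^esub> qmap PB Q B"
  have "?X \<in> commutant PB \<rho>"
    by (rule commutant_mult[OF qmap_commutant[OF A] qmap_commutant[OF B] rmod_closed])
  then have X: "?X \<in> qmap PB Q ` carrier (series VP)"
    using Q_bij by (simp add: bij_betw_def)
  show "ver_star PB Q A B \<in> carrier (series VP)"
    unfolding ver_star_def by (rule inv_into_into[OF X])
  have "qmap PB Q (ver_star PB Q A B) = ?X"
    unfolding ver_star_def by (rule f_inv_into_f[OF X])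
  then show "vl (ver_star PB Q A B) f = vl A (vl B f)"
    if "f \<in> carrier (series CP)"
    using that A B by (simp add: ver_lmod_def op_apply_mult qmap_closed)
qed

end

lemma linear_map_coeffwise:
  assumes "cmodule M" "cmodule N" "linear_map M N F"
  shows "linear_map (series M) (series N) (coeffwise F)"
proof -
  interpret M: cmodule M by fact
  interpret N: cmodule N by fact
  note Fc = linear_map_closed[OF assms(3)]
  have F0: "F \<zero>\<^bsub>M\<^esub> = \<zero>\<^bsub>N\<^esub>"
    using linear_map_smult[OF assms(3), of "\<zero>\<^bsub>M\<^esub>" 0] Fc[of "\<zero>\<^bsub>M\<^esub>"] by simp
  show ?thesis
  proof (rule linear_map_seriesI[OF assms(1,2)])
    show closed: "coeffwise F x \<in> carrier (series N)" if "x \<in> carrier (series M)" for x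
      using that Fc by (simp add: carrier_series)
    show "coeffwise F (x \<oplus>\<^bsub>series M\<^esub> y) = coeffwise F x \<oplus>\<^bsub>series N\<^esub> coeffwise F y"
      if "x \<in> carrier (series M)" "y \<in> carrier (series M)" for x y
      using that by (intro fps_ext) (simp add: linear_map_add[OF assms(3)])
    show "coeffwise F (fps_const a \<odot>\<^bsub>series M\<^esub> x) = fps_const a \<odot>\<^bsub>series N\<^esub> coeffwise F x"
      if "x \<in> carrier (series M)" for x a
      using that closed[OF that]
      by (intro fps_ext) (simp add: M.nth_smult_const N.nth_smult_const linear_map_smult[OF assms(3)])
    show "coeffwise F (shift_up M x) = shift_up N (coeffwise F x)" if "x \<in> carrier (series M)" for x
      by (intro fps_ext) (simp add: F0)
  qed
qed

context quantized_bundle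
begin

subsection \<open>Operators on vector valued functions\<close>

lemma VP_DP: "A \<in> carrier VP \<Longrightarrow> A \<in> carrier DP"
  by (simp add: ver_ops_iff)

lemma VP_comb:
  "finite I \<Longrightarrow> (\<And>i. i \<in> I \<Longrightarrow> A i \<in> carrier VP) \<Longrightarrow> (\<lambda>h q. \<Sum>i\<in>I. k i * A i h q) \<in> carrier VP"
proof (induction I rule: finite_induct)
  case empty
  then show ?case using VP.emb_zero_closed by (simp add: ver_ops_ops DP_ops)
next
  case (insert i I)
  then show ?case
    using VP.emb_add_closed[OF VP.emb_smult_closed[of "A i" "k i"], of "\<lambda>h q. \<Sum>i\<in>I. k i * A i h q"]
    by (simp add: ver_ops_ops DP_ops)
qed

lemma CP_iff: "f \<in> carrier CP \<longleftrightarrow> smooth_P UNIV f"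
  by (rule smooth_fns_iff)

lemma vfns_vcomp: "s \<in> VF \<longleftrightarrow> (\<forall>b\<in>bas R. vcomp R b s \<in> carrier CP)"
  by (simp add: vfns_def vcomp_def)

lemma vcomp_single: "c \<in> bas R \<Longrightarrow> vcomp R b (\<lambda>q. sc (h q) c) = (if b = c then h else (\<lambda>q. 0))"
  by (auto simp: vcomp_def co_linear co_basis)

text \<open>The equivalence matters for the convention of extension by zero: if h is not smooth,
  neither is its multiple of c, and operators on both sides give zero.\<close>

lemma single_vfns: "c \<in> bas R \<Longrightarrow> (\<lambda>q. sc (h q) c) \<in> VF \<longleftrightarrow> h \<in> carrier CP"
  using CP.emb_zero_closed by (auto simp: vfns_vcomp vcomp_single CP_ops)

lemma co_tensor_op:
  "s \<in> VF \<Longrightarrow> co b (tensor_op PB R A L s q) = (\<Sum>c\<in>bas R. A (vcomp R c s) q * co b (L c))"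
  by (simp add: tensor_op_def vcomp_def co_linear)

lemma tensor_op_outside: "s \<notin> VF \<Longrightarrow> tensor_op PB R A L s q = 0"
  by (simp add: tensor_op_def)

lemma co_tensor_op_single:
  assumes A: "A \<in> carrier DP" and c: "c \<in> bas R"
  shows "co b (tensor_op PB R A L (\<lambda>q. sc (h q) c) q) = A h q * co b (L c)"
proof (cases "h \<in> carrier CP")
  case True
  then have "co b (tensor_op PB R A L (\<lambda>q. sc (h q) c) q) =
      (\<Sum>c'\<in>bas R. if c' = c then A h q * co b (L c) else 0)"
    using c DP_zero[OF A] by (simp add: co_tensor_op single_vfns vcomp_single) (intro sum.cong; simp)
  then show ?thesis using c V.finite_Basis by (simp add: sum.delta)
next
  case False
  then show ?thesis
    using c DP_outside[OF A] by (simp add: tensor_op_outside single_vfns co_linear)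
qed

lemma ocomp_nth: "ocomp R b c D h q = co b (D (\<lambda>q. sc (h q) c) q)"
  by (simp add: ocomp_def vcomp_def)

lemma elem_end_linear: "Vector_Spaces.linear sc sc (elem_end R b c)"
proof -
  have "module_hom sc sc (elem_end R b c)"
    unfolding module_hom_iff
    by (simp add: elem_end_def co_linear V.scale_left_distrib V.module_axioms)
  then show ?thesis by (simp add: Vector_Spaces.linear_def V.vector_space_axioms)
qed

lemma co_elem_end: "b \<in> bas R \<Longrightarrow> co b' (elem_end R b c v) = (if b' = b then co c v else 0)"
  by (simp add: elem_end_def co_linear co_basis)

text \<open>Expansion over elementary endomorphisms. It trades the unspecified finite tensor sum of
  the definition for conditions on the components \<open>ocomp\<close>, which are determined by
  D.\<close>

lemma ver_end_ops_iff:
  "D \<in> carrier (ver_end_ops PB R) \<longleftrightarrow>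
    (\<forall>b\<in>bas R. \<forall>c\<in>bas R. ocomp R b c D \<in> carrier VP) \<and>
    (\<forall>s\<in>VF. \<forall>b\<in>bas R. \<forall>q. co b (D s q) = (\<Sum>c\<in>bas R. ocomp R b c D (vcomp R c s) q)) \<and>
    (\<forall>s. s \<notin> VF \<longrightarrow> D s = (\<lambda>q. 0))" (is "_ \<longleftrightarrow> ?R")
proof
  assume "D \<in> carrier (ver_end_ops PB R)"
  then have "\<exists>(n::nat) A L. D = (\<lambda>s q. \<Sum>i<n. tensor_op PB R (A i) (L i) s q) \<and> (\<forall>i<n. A i \<in> carrier VP)"
    by (simp add: ver_end_ops_def) blast
  then obtain n :: nat and A L where D: "D = (\<lambda>s q. \<Sum>i<n. tensor_op PB R (A i) (L i) s q)"
    and A: "\<forall>i<n. A i \<in> carrier VP" by (elim exE conjE) (rule that)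
  have oc: "ocomp R b c D = (\<lambda>h q. \<Sum>i\<in>{..<n}. co b (L i c) * A i h q)" if "c \<in> bas R" for b c
  proof (intro ext)
    fix h q
    have "ocomp R b c D h q = (\<Sum>i<n. co b (tensor_op PB R (A i) (L i) (\<lambda>q. sc (h q) c) q))"
      by (simp add: ocomp_nth D co_linear)
    also have "\<dots> = (\<Sum>i<n. co b (L i c) * A i h q)"
      using A that by (intro sum.cong refl) (simp add: co_tensor_op_single VP_DP mult.commute)
    finally show "ocomp R b c D h q = (\<Sum>i\<in>{..<n}. co b (L i c) * A i h q)" .
  qed
  show ?R
  proof (intro conjI ballI allI impI)
    show "ocomp R b c D \<in> carrier VP" if "b \<in> bas R" "c \<in> bas R" for b c
      unfolding oc[OF that(2)] using A by (intro VP_comb) simp_all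
    fix s assume s: "s \<in> VF"
    have "co b (D s q) = (\<Sum>i<n. \<Sum>c\<in>bas R. co b (L i c) * A i (vcomp R c s) q)" for b q
      using s by (simp add: D co_linear co_tensor_op mult.commute)
    also have "\<dots> b q = (\<Sum>c\<in>bas R. \<Sum>i<n. co b (L i c) * A i (vcomp R c s) q)" for b q
      by (rule sum.swap)
    finally show "co b (D s q) = (\<Sum>c\<in>bas R. ocomp R b c D (vcomp R c s) q)" for b q
      by (simp add: oc)
  next
    show "D s = (\<lambda>q. 0)" if "s \<notin> VF" for s
      using that by (simp add: D tensor_op_outside)
  qed
next
  assume R: ?R
  \<comment> \<open>The definition wants a sum over an initial segment of the natural numbers, so
    the pairs of basis vectors are enumerated.\<close>
  obtain h where h: "bij_betw h {0..<card (bas R \<times> bas R)} (bas R \<times> bas R)"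
    using ex_bij_betw_nat_finite[of "bas R \<times> bas R"] V.finite_Basis by auto
  let ?n = "card (bas R \<times> bas R)"
  let ?A = "\<lambda>i. ocomp R (fst (h i)) (snd (h i)) D" and ?L = "\<lambda>i. elem_end R (fst (h i)) (snd (h i))"
  have "D = (\<lambda>s q. \<Sum>i<?n. tensor_op PB R (?A i) (?L i) s q)"
  proof (intro ext)
    fix s q
    show "D s q = (\<Sum>i<?n. tensor_op PB R (?A i) (?L i) s q)"
    proof (cases "s \<in> VF")
      case True
      show ?thesis
      proof (rule co_eqI)
        fix b assume b: "b \<in> bas R"
        have "co b (\<Sum>i<?n. tensor_op PB R (?A i) (?L i) s q) =
            (\<Sum>i\<in>{0..<?n}. (\<lambda>(x, y). co b (tensor_op PB R (ocomp R x y D) (elem_end R x y) s q)) (h i))"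
          by (simp add: co_linear case_prod_unfold lessThan_atLeast0)
        also have "\<dots> = (\<Sum>(x, y)\<in>bas R \<times> bas R. co b (tensor_op PB R (ocomp R x y D) (elem_end R x y) s q))"
          by (rule sum.reindex_bij_betw[OF h])
        also have "\<dots> = (\<Sum>x\<in>bas R. \<Sum>y\<in>bas R. co b (tensor_op PB R (ocomp R x y D) (elem_end R x y) s q))"
          by (rule sum.cartesian_product[symmetric])
        also have "\<dots> = (\<Sum>x\<in>bas R. if x = b then (\<Sum>y\<in>bas R. ocomp R b y D (vcomp R y s) q) else 0)"
        proof (rule sum.cong[OF refl])
          fix x assume x: "x \<in> bas R"
          have "(\<Sum>c\<in>bas R. ocomp R x y D (vcomp R c s) q * co b (elem_end R x y c)) =
              (\<Sum>c\<in>bas R. if c = y then (if x = b then ocomp R b y D (vcomp R y s) q else 0) else 0)" if "y \<in> bas R" for y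
            using x that by (intro sum.cong refl) (simp add: co_elem_end co_basis)
          then have "co b (tensor_op PB R (ocomp R x y D) (elem_end R x y) s q) =
              (if x = b then ocomp R b y D (vcomp R y s) q else 0)" if "y \<in> bas R" for y
            using that V.finite_Basis by (simp add: co_tensor_op[OF True] sum.delta)
          then show "(\<Sum>y\<in>bas R. co b (tensor_op PB R (ocomp R x y D) (elem_end R x y) s q)) =
              (if x = b then (\<Sum>y\<in>bas R. ocomp R b y D (vcomp R y s) q) else 0)"
            by simp
        qed
        also have "\<dots> = (\<Sum>y\<in>bas R. ocomp R b y D (vcomp R y s) q)"
          using b V.finite_Basis by (simp add: sum.delta)
        also have "\<dots> = co b (D s q)" using R True b by simp
        finally show "co b (D s q) = co b (\<Sum>i<?n. tensor_op PB R (?A i) (?L i) s q)" ..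
      qed
    qed (use R in \<open>simp add: tensor_op_outside\<close>)
  qed
  moreover have "\<forall>i<?n. ?A i \<in> carrier VP \<and> Vector_Spaces.linear sc sc (?L i)"
  proof (intro allI impI)
    fix i assume "i < ?n"
    then have "h i \<in> bas R \<times> bas R" by (intro bij_betw_apply[OF h]) simp
    then show "?A i \<in> carrier VP \<and> Vector_Spaces.linear sc sc (?L i)"
      using R by (simp add: mem_Times_iff elem_end_linear)
  qed
  ultimately show "D \<in> carrier (ver_end_ops PB R)"
    unfolding ver_end_ops_def partial_object.simps mem_Collect_eq by (intro exI conjI)
qed

lemma inv_ops_iff:
  "D \<in> carrier InvOps \<longleftrightarrow> D \<in> carrier (ver_end_ops PB R) \<and> (\<forall>g. vact_op PB R g D = D)"
  by (simp add: inv_ops_def)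

lemma inv_ops_ops:
  "\<zero>\<^bsub>InvOps\<^esub> = (\<lambda>s q. 0)" "D \<oplus>\<^bsub>InvOps\<^esub> E = (\<lambda>s q. D s q + E s q)"
  "c \<odot>\<^bsub>InvOps\<^esub> D = (\<lambda>s q. sc c (D s q))"
  by (simp_all add: inv_ops_def ver_end_ops_def)

lemma vact_op_nth: "vact_op PB R g D s q = rp g (D (vact PB R (ginv g) s) (ac q g))"
  by (simp add: vact_op_def vact_def pull_fun_def)

lemma ocomp_ops:
  "ocomp R b c (\<lambda>s q. 0) = \<zero>\<^bsub>VP\<^esub>"
  "ocomp R b c (\<lambda>s q. D s q + E s q) = ocomp R b c D \<oplus>\<^bsub>VP\<^esub> ocomp R b c E"
  "ocomp R b c (\<lambda>s q. sc k (D s q)) = k \<odot>\<^bsub>VP\<^esub> ocomp R b c D"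
  by (intro ext; simp add: ocomp_nth co_linear ver_ops_ops DP_ops)+

sublocale Inv: cmodule_embedding "scl R" "InvOps" "\<lambda>D (s, q). D s q"
proof unfold_locales
  show "\<zero>\<^bsub>InvOps\<^esub> \<in> carrier InvOps"
    unfolding inv_ops_iff inv_ops_ops ver_end_ops_iff ocomp_ops
    by (simp add: VP.emb_zero_closed co_linear) (auto simp: vact_op_nth ver_ops_ops DP_ops fun_eq_iff)
  fix D assume D: "D \<in> carrier InvOps"
  then have Dv: "vact_op PB R g D s q = D s q" for g s q by (simp add: inv_ops_iff)
  show "c \<odot>\<^bsub>InvOps\<^esub> D \<in> carrier InvOps" for c
    using D unfolding inv_ops_iff inv_ops_ops ver_end_ops_iff ocomp_ops
    by (simp add: VP.emb_smult_closed co_linear)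
      (auto simp: ver_ops_ops DP_ops fun_eq_iff sum_distrib_left vact_op_nth rp_sc)
  fix E assume E: "E \<in> carrier InvOps"
  show "D \<oplus>\<^bsub>InvOps\<^esub> E \<in> carrier InvOps"
    using D E unfolding inv_ops_iff inv_ops_ops ver_end_ops_iff ocomp_ops
    by (simp add: VP.emb_add_closed co_linear)
      (auto simp: ver_ops_ops DP_ops fun_eq_iff sum.distrib vact_op_nth rp_add)
next
  show "D = E" if "\<And>i. (case i of (s, q) \<Rightarrow> D s q) = (case i of (s, q) \<Rightarrow> E s q)"
    for D E :: "('p \<Rightarrow> 'v) \<Rightarrow> 'p \<Rightarrow> 'v"
    using that by (intro ext) (metis case_prod_conv)
qed (auto simp: inv_ops_ops)

sublocale Invm: cmodule "InvOps" by (rule Inv.cmodule)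

lemma ocomp_linear:
  assumes "b \<in> bas R" "c \<in> bas R"
  shows "linear_map InvOps VP (ocomp R b c)"
  using assms by (simp add: linear_map_def inv_ops_ops ocomp_ops inv_ops_iff ver_end_ops_iff Pi_iff)

abbreviation dcomp :: "'v \<Rightarrow> 'v \<Rightarrow> (('p \<Rightarrow> 'v) \<Rightarrow> 'p \<Rightarrow> 'v) fps \<Rightarrow> (('p \<Rightarrow> complex) \<Rightarrow> 'p \<Rightarrow> complex) fps" where
  "dcomp b c \<equiv> coeffwise (ocomp R b c)"

lemma dcomp_linear: "b \<in> bas R \<Longrightarrow> c \<in> bas R \<Longrightarrow> linear_map (series InvOps) (series VP) (dcomp b c)"
  by (rule linear_map_coeffwise[OF Inv.cmodule VP.cmodule ocomp_linear])

lemma dcomp_closed: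
  "b \<in> bas R \<Longrightarrow> c \<in> bas R \<Longrightarrow> D \<in> carrier (series InvOps) \<Longrightarrow> dcomp b c D \<in> carrier (series VP)"
  by (rule linear_map_closed[OF dcomp_linear])

text \<open>Components of a series of sections as series of functions on P. They separate sections,
  which reduces identities in E to scalar ones.\<close>

definition scomp :: "'v \<Rightarrow> ('m \<Rightarrow> ('p \<times> 'v) set) fps \<Rightarrow> ('p \<Rightarrow> complex) fps" where
  "scomp b s = coeffwise (vcomp R b) (coeffwise (to_fun) s)"

lemma scomp_nth: "fps_nth (scomp b s) n q = co b (to_fun (fps_nth s n) q)"
  by (simp add: scomp_def vcomp_def)

lemma scomp_linear:
  assumes b: "b \<in> bas R"
  shows "linear_map (series SecE) (series CP) (scomp b)"
proof -
  have "linear_map SecE CP (\<lambda>s. vcomp R b (to_fun s))"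
    using sec_to_fun_Gam b
    by (auto simp: linear_map_def sec_to_fun_ops vcomp_def co_linear CP_ops Gam_iff vfns_iff CP_iff)
  from linear_map_coeffwise[OF Sec.cmodule CP.cmodule this]
  show ?thesis by (rule linear_map_cong[OF _ Sec.cmodule]) (intro fps_ext, simp add: scomp_def)
qed

lemma scomp_closed: "b \<in> bas R \<Longrightarrow> s \<in> carrier (series SecE) \<Longrightarrow> scomp b s \<in> carrier (series CP)"
  by (rule linear_map_closed[OF scomp_linear])

lemma scomp_eqI:
  assumes "s \<in> carrier (series SecE)" "t \<in> carrier (series SecE)"
    "\<And>b. b \<in> bas R \<Longrightarrow> scomp b s = scomp b t"
  shows "s = t"
  by (rule Sec.emb_series_eqI[OF assms(1,2)], rule co_eqI) (metis assms(3) scomp_nth)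

lemma linear_map_componentsI:
  assumes M: "cmodule M" and closed: "\<And>x. x \<in> carrier (series M) \<Longrightarrow> U x \<in> carrier (series SecE)"
    and lin: "\<And>b. b \<in> bas R \<Longrightarrow> linear_map (series M) (series CP) (\<lambda>x. scomp b (U x))"
  shows "linear_map (series M) (series SecE) U"
proof -
  interpret cmodule M by fact
  show ?thesis
    unfolding linear_map_def
  proof (intro conjI ballI allI funcsetI closed)
    fix x y assume x: "x \<in> carrier (series M)" and y: "y \<in> carrier (series M)"
    show "U (x \<oplus>\<^bsub>series M\<^esub> y) = U x \<oplus>\<^bsub>series SecE\<^esub> U y"
      by (rule scomp_eqI)
        (use x y closed in \<open>simp_all add: linear_map_add[OF lin] linear_map_add[OF scomp_linear]\<close>)
  next
    fix x c assume x: "x \<in> carrier (series M)"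
    show "U (c \<odot>\<^bsub>series M\<^esub> x) = c \<odot>\<^bsub>series SecE\<^esub> U x"
      by (rule scomp_eqI)
        (use x closed in \<open>simp_all add: linear_map_smult[OF lin] linear_map_smult[OF scomp_linear]\<close>)
  qed
qed

lemma linear_map_sumI:
  assumes M: "cmodule M" and I: "finite I"
    and T: "\<And>c. c \<in> I \<Longrightarrow> linear_map (series M) (series CP) (T c)"
    and S: "\<And>x n q. x \<in> carrier (series M) \<Longrightarrow> fps_nth (S x) n q = (\<Sum>c\<in>I. fps_nth (T c x) n q)"
  shows "linear_map (series M) (series CP) S"
proof -
  interpret cmodule M by fact
  note Tc = linear_map_closed[OF T]
  have Sc: "S x \<in> carrier (series CP)" if "x \<in> carrier (series M)" for x
  proof -
    have "fps_nth (S x) n = (\<lambda>q. \<Sum>c\<in>I. fps_nth (T c x) n q)" for n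
      by (rule ext) (rule S[OF that])
    then show ?thesis using I Tc that by (simp add: carrier_series[of "S x"] CP_sum)
  qed
  show ?thesis
    unfolding linear_map_def
  proof (intro conjI ballI allI funcsetI Sc)
    fix x y assume x: "x \<in> carrier (series M)" and y: "y \<in> carrier (series M)"
    show "S (x \<oplus>\<^bsub>series M\<^esub> y) = S x \<oplus>\<^bsub>series CP\<^esub> S y"
      using x y by (intro CP.emb_series_eqI)
        (simp_all add: Sc S linear_map_add[OF T] CP_ops sum.distrib)
  next
    fix x c assume x: "x \<in> carrier (series M)"
    show "S (c \<odot>\<^bsub>series M\<^esub> x) = c \<odot>\<^bsub>series CP\<^esub> S x"
    proof (rule CP.emb_series_eqI)
      fix n q
      have "fps_nth (S (c \<odot>\<^bsub>series M\<^esub> x)) n q = (\<Sum>d\<in>I. \<Sum>k\<le>n. fps_nth c k * fps_nth (T d x) (n - k) q)"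
        using x by (simp add: S linear_map_smult[OF T] CP.emb_nth_smult Tc)
      also have "\<dots> = (\<Sum>k\<le>n. \<Sum>d\<in>I. fps_nth c k * fps_nth (T d x) (n - k) q)" by (rule sum.swap)
      also have "\<dots> = fps_nth (c \<odot>\<^bsub>series CP\<^esub> S x) n q"
        using x by (simp add: S CP.emb_nth_smult Sc sum_distrib_left)
      finally show "fps_nth (S (c \<odot>\<^bsub>series M\<^esub> x)) n q = fps_nth (c \<odot>\<^bsub>series CP\<^esub> S x) n q" .
    qed (use x Sc in simp_all)
  qed
qed

end

lemma coeffwise_closed:
  assumes "x \<in> carrier (series M)" "\<And>y. y \<in> carrier M \<Longrightarrow> F y \<in> carrier N"
  shows "coeffwise F x \<in> carrier (series N)"
  using assms by (simp add: carrier_series)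

context quantized_bundle
begin

subsection \<open>The group action\<close>

abbreviation mat :: "'g \<Rightarrow> 'v \<Rightarrow> 'v \<Rightarrow> complex" where
  "mat g b c \<equiv> co b (rp g c)"

lemma co_rp_mat: "co b (rp g v) = (\<Sum>c\<in>bas R. mat g b c * co c v)"
  by (subst co_rp) (simp only: mult.commute)

lemma vact_nth: "vact PB R g f q = rp g (f (ac q g))"
  by (simp add: vact_def pull_fun_def)

lemma pull_fun_closed: "f \<in> carrier CP \<Longrightarrow> pull_fun PB g f \<in> carrier CP"
  by (simp add: CP_iff smooth_pull_fun)

lemma pull_fun_inv [simp]: "pull_fun PB g (pull_fun PB (ginv g) f) = f" "pull_fun PB (ginv g) (pull_fun PB g f) = f"
  by (simp_all add: pull_fun_def ac_ac)

lemma pull_fun_closed_iff: "pull_fun PB g f \<in> carrier CP \<longleftrightarrow> f \<in> carrier CP"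
  using pull_fun_closed[of f g] pull_fun_closed[of "pull_fun PB g f" "ginv g"] by auto

lemma pull_op_nth: "pull_op PB g D f q = D (pull_fun PB (ginv g) f) (ac q g)"
  by (simp add: pull_op_def pull_fun_def)

text \<open>Pullback along the action of g is an algebra automorphism. Conjugation by it turns the
  commutator with the pullback of a along g inverse into the commutator with a.\<close>

lemma diff_order_pull_op:
  "diff_order id (carrier CP) k D \<Longrightarrow> diff_order id (carrier CP) k (pull_op PB g D)"
proof (induction k arbitrary: D)
  case 0
  have "pull_op PB g D (\<lambda>x. a x * f x) = (\<lambda>y. a y * pull_op PB g D f y)"
    if "a \<in> carrier CP" "f \<in> carrier CP" for a f
  proof -
    have "pull_fun PB (ginv g) (\<lambda>x. a x * f x) = (\<lambda>x. pull_fun PB (ginv g) a x * pull_fun PB (ginv g) f x)"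
      by (simp add: pull_fun_def)
    then have "D (pull_fun PB (ginv g) (\<lambda>x. a x * f x)) =
        (\<lambda>y. pull_fun PB (ginv g) a y * D (pull_fun PB (ginv g) f) y)"
      using 0 that pull_fun_closed by simp
    then show ?thesis by (intro ext, simp add: pull_op_nth) (simp add: pull_fun_def ac_ac)
  qed
  then show ?case by simp
next
  case (Suc k)
  have "diff_order id (carrier CP) k (\<lambda>f y. pull_op PB g D (\<lambda>x. a x * f x) y - a (id y) * pull_op PB g D f y)"
    if a: "a \<in> carrier CP" for a
  proof -
    let ?a = "pull_fun PB (ginv g) a"
    have "diff_order id (carrier CP) k (\<lambda>f y. D (\<lambda>x. ?a x * f x) y - ?a (id y) * D f y)"
      using bspec[OF Suc.prems[unfolded diff_order.simps(2)] pull_fun_closed[OF a, of "ginv g"]] .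
    then have "diff_order id (carrier CP) k (pull_op PB g (\<lambda>f y. D (\<lambda>x. ?a x * f x) y - ?a (id y) * D f y))"
      by (rule Suc.IH)
    moreover have "pull_op PB g (\<lambda>f y. D (\<lambda>x. ?a x * f x) y - ?a (id y) * D f y) =
        (\<lambda>f y. pull_op PB g D (\<lambda>x. a x * f x) y - a (id y) * pull_op PB g D f y)"
      by (intro ext) (simp add: pull_op_nth pull_fun_def ac_ac)
    ultimately show ?thesis by (simp only:)
  qed
  then show ?case by (subst diff_order.simps(2)) blast
qed

text \<open>Verticality survives because the group acts along the fibres of \<open>pr\<close>, so
  functions pulled back from M are unchanged by the translation.\<close>

lemma pull_op_VP:
  assumes D: "D \<in> carrier VP"
  shows "pull_op PB g D \<in> carrier VP"
proof -
  let ?p = "pull_fun PB (ginv g)"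
  note DP = VP_DP[OF D]
  have add: "?p (\<lambda>x. f x + h x) = (\<lambda>x. ?p f x + ?p h x)" and sc: "?p (\<lambda>x. c * f x) = (\<lambda>x. c * ?p f x)" for f h c
    by (simp_all add: pull_fun_def)
  have "linear_map CP CP (pull_op PB g D)"
    unfolding smooth_fns_linear_iff[OF charted_P]
  proof (intro conjI ballI allI)
    fix f c assume f: "f \<in> carrier CP"
    have "pull_fun PB g (D (?p f)) \<in> carrier CP"
      by (rule pull_fun_closed[OF DP_closed[OF DP pull_fun_closed[OF f]]])
    then show "pull_op PB g D f \<in> carrier CP" by (simp only: pull_op_def o_apply)
    show "pull_op PB g D (\<lambda>x. c * f x) = (\<lambda>x. c * pull_op PB g D f x)"
      using linear_map_smult[OF DP_linear[OF DP] pull_fun_closed[OF f, of "ginv g"], of c]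
      by (intro ext) (simp add: pull_op_nth sc CP_ops)
    fix h assume h: "h \<in> carrier CP"
    show "pull_op PB g D (\<lambda>x. f x + h x) = (\<lambda>x. pull_op PB g D f x + pull_op PB g D h x)"
      using linear_map_add[OF DP_linear[OF DP] pull_fun_closed[OF f, of "ginv g"] pull_fun_closed[OF h, of "ginv g"]]
      by (intro ext) (simp add: pull_op_nth add CP_ops)
  qed
  moreover have "\<exists>k. diff_order id (carrier CP) k (pull_op PB g D)"
    using DP diff_order_pull_op unfolding diff_ops_iff[OF charted_P] by blast
  moreover have "pull_op PB g D f = (\<lambda>x. 0)" if "f \<notin> carrier CP" for f
    using DP_outside[OF DP, of "?p f"] that by (intro ext) (simp add: pull_op_nth pull_fun_closed_iff)
  moreover have "pull_op PB g D (\<lambda>q. f q * a (pr q)) = (\<lambda>q. pull_op PB g D f q * a (pr q))"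
    if f: "f \<in> carrier CP" and a: "a \<in> carrier CM" for f a
  proof -
    have "?p (\<lambda>q. f q * a (pr q)) = (\<lambda>q. ?p f q * a (pr q))" by (simp add: pull_fun_def)
    then show ?thesis
      using D pull_fun_closed[OF f, of "ginv g"] a by (intro ext) (simp add: ver_ops_iff pull_op_nth)
  qed
  ultimately show ?thesis
    by (simp add: ver_ops_iff diff_ops_iff[OF charted_P])
qed

lemma vact_vfns: "s \<in> VF \<Longrightarrow> vact PB R g s \<in> VF"
proof -
  assume s: "s \<in> VF"
  have "smooth_P UNIV (\<lambda>q. \<Sum>c\<in>bas R. mat g b c * co c (s (ac q g)))" for b
    using smooth_pull_fun[of "\<lambda>q. co _ (s q)" g] s
    by (intro smooth_fun_sum[OF charted_P open_UNIV] smooth_fun_mult[OF charted_P open_UNIV] smooth_fun_const)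
      (simp add: vfns_iff pull_fun_def)
  then show ?thesis by (simp add: vfns_iff vact_nth co_rp_mat[of _ g "s (ac _ g)"])
qed

lemma vact_inv [simp]: "vact PB R g (vact PB R (ginv g) s) = s" "vact PB R (ginv g) (vact PB R g s) = s"
  by (intro ext; simp add: vact_nth ac_ac)+

lemma vact_vfns_iff: "vact PB R g s \<in> VF \<longleftrightarrow> s \<in> VF"
  using vact_vfns[of s g] vact_vfns[of "vact PB R g s" "ginv g"] by auto

text \<open>Invariance of \<open>D\<close>, applied to \<open>h \<otimes> d\<close>.\<close>

lemma inv_ops_components:
  assumes D: "D \<in> carrier InvOps" and b: "b \<in> bas R" and d: "d \<in> bas R"
  shows "(\<Sum>c\<in>bas R. mat (ginv g) c d * pull_op PB g (ocomp R b c D) h q) =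
    (\<Sum>e\<in>bas R. mat (ginv g) b e * ocomp R e d D h q)"
proof -
  have oc: "ocomp R x y D \<in> carrier DP" if "x \<in> bas R" "y \<in> bas R" for x y
    using D that by (simp add: inv_ops_iff ver_end_ops_iff VP_DP)
  show ?thesis
  proof (cases "h \<in> carrier CP")
    case False
    then show ?thesis
      using DP_outside[OF oc] b d by (simp add: pull_op_nth pull_fun_closed_iff)
  next
    case h: True
    let ?h = "pull_fun PB (ginv g) h"
    let ?s = "\<lambda>q. sc (h q) d"
    let ?t = "vact PB R (ginv g) ?s"
    have t: "?t \<in> VF" using h d by (intro vact_vfns) (simp add: single_vfns)
    have vt: "vcomp R c ?t = (\<lambda>q. mat (ginv g) c d * ?h q)" for c
      by (intro ext) (simp add: vcomp_def vact_nth rp_sc co_linear pull_fun_def)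
    have h': "?h \<in> carrier CP" by (rule pull_fun_closed[OF h])
    have "vact_op PB R g D = D" using D by (simp add: inv_ops_iff)
    then have "rp g (D ?t (ac q g)) = D ?s q" by (simp only: vact_op_nth[symmetric])
    then have "D ?t (ac q g) = rp (ginv g) (D ?s q)" by (metis rp_inv(1))
    then have "co b (D ?t (ac q g)) = (\<Sum>e\<in>bas R. mat (ginv g) b e * ocomp R e d D h q)"
      by (simp add: co_rp_mat[of b "ginv g" "D ?s q"] ocomp_nth)
    moreover have "co b (D ?t (ac q g)) = (\<Sum>c\<in>bas R. ocomp R b c D (vcomp R c ?t) (ac q g))"
      using D t b by (simp add: inv_ops_iff ver_end_ops_iff)
    moreover have "ocomp R b c D (vcomp R c ?t) (ac q g) = mat (ginv g) c d * pull_op PB g (ocomp R b c D) h q"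
      if "c \<in> bas R" for c
      using linear_map_smult[OF DP_linear[OF oc[OF b that]] h', of "mat (ginv g) c d"]
      by (simp add: vt CP_ops pull_op_nth)
    ultimately show ?thesis by simp
  qed
qed

subsection \<open>The left module structure on sections\<close>

lemma CP_linear_comb:
  assumes "linear_map (series CP) (series CP) T" "\<And>c. c \<in> bas R \<Longrightarrow> A c \<in> carrier (series CP)"
    "x \<in> carrier (series CP)" "\<And>n q. fps_nth x n q = (\<Sum>c\<in>bas R. k c * fps_nth (A c) n q)"
  shows "fps_nth (T x) n q = (\<Sum>c\<in>bas R. k c * fps_nth (T (A c)) n q)"
  by (rule linear_comb[OF CP.cmodule_embedding_axioms CP.cmodule_embedding_axioms assms(1) V.finite_Basis,
        where A = A and k = k]) (simp_all add: assms(2,3,4))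

lemma VP_linear_comb:
  assumes "linear_map (series VP) (series CP) T" "\<And>c. c \<in> bas R \<Longrightarrow> A c \<in> carrier (series VP)"
    "x \<in> carrier (series VP)" "\<And>n h q. fps_nth x n h q = (\<Sum>c\<in>bas R. k c * fps_nth (A c) n h q)"
  shows "fps_nth (T x) n q = (\<Sum>c\<in>bas R. k c * fps_nth (T (A c)) n q)"
  by (rule linear_comb[OF VP.cmodule_embedding_axioms CP.cmodule_embedding_axioms assms(1) V.finite_Basis,
        where A = A and k = k]) (simp_all add: assms(2,3,4) case_prod_unfold)

lemma co_vlmod:
  assumes "b \<in> bas R"
  shows "co b (fps_nth (vlmod PB Q R D s) n q) =
    (\<Sum>c\<in>bas R. fps_nth (vl (dcomp b c D) (coeffwise (vcomp R c) s)) n q)"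
  using assms by (simp add: vlmod_def V.scale_sum_left[symmetric] co_sum_basis)

lemma co_vlmod_sections:
  assumes "b \<in> bas R"
  shows "co b (fps_nth (vlmod PB Q R D (coeffwise (to_fun) s)) n q) =
    (\<Sum>c\<in>bas R. fps_nth (vl (dcomp b c D) (scomp c s)) n q)"
  by (simp add: co_vlmod[OF assms] scomp_def)

lemma scomp_pull:
  assumes s: "s \<in> carrier (series SecE)"
  shows "fps_nth (coeffwise (pull_fun PB g) (scomp c s)) n q =
    (\<Sum>d\<in>bas R. mat (ginv g) c d * fps_nth (scomp d s) n q)"
proof -
  have "equivariant (to_fun (fps_nth s n))"
    using sec_to_fun_Gam[OF carrier_seriesD[OF s]] by (simp add: Gam_iff)
  then show ?thesis
    by (simp add: pull_fun_def scomp_nth equivariantD co_rp_mat[of c "ginv g" "to_fun (fps_nth s n) q"])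
qed

text \<open>Invariance of the scalar action moves the pullback by g onto both factors. Equivariance
  of s replaces its pulled back components by matrix combinations, and
  \<open>inv_ops_components\<close> converts these into the matrix of g inverse acting on the
  result.\<close>

lemma vlmod_Gam:
  assumes D: "D \<in> carrier (series InvOps)" and s: "s \<in> carrier (series SecE)"
  shows "fps_nth (vlmod PB Q R D (coeffwise (to_fun) s)) n \<in> Gam" (is "?f \<in> Gam")
proof -
  let ?X = "\<lambda>b c. vl (dcomp b c D) (scomp c s)"
  have Dc: "dcomp b c D \<in> carrier (series VP)" if "b \<in> bas R" "c \<in> bas R" for b c
    using that D by (rule dcomp_closed)
  have sc: "scomp c s \<in> carrier (series CP)" if "c \<in> bas R" for c
    using that s by (rule scomp_closed)
  have "?f \<in> VF"
    unfolding vfns_iff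
  proof
    fix b assume b: "b \<in> bas R"
    have "(\<lambda>q. \<Sum>c\<in>bas R. fps_nth (?X b c) n q) \<in> carrier CP"
      using ver_lmod_closed[OF Dc[OF b] sc] V.finite_Basis by (intro CP_sum) simp_all
    then show "smooth_P UNIV (\<lambda>q. co b (?f q))"
      by (simp only: co_vlmod_sections[OF b] CP_iff)
  qed
  moreover have "equivariant ?f"
    unfolding equivariant_def
  proof (intro allI co_eqI)
    fix q g b assume b: "b \<in> bas R"
    let ?P = "\<lambda>c. coeffwise (pull_op PB g) (dcomp b c D)"
    have P: "?P c \<in> carrier (series VP)" if "c \<in> bas R" for c
      by (rule coeffwise_closed[OF Dc[OF b that] pull_op_VP])
    \<comment> \<open>The common value of the two sides of \<open>inv_ops_components\<close>, as a
      series of vertical operators. Applying it to \<open>scomp d s\<close> in both forms links the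
      two halves of the computation.\<close>
    define W where "W d = Abs_fps (\<lambda>n h q. \<Sum>e\<in>bas R. mat (ginv g) b e * fps_nth (dcomp e d D) n h q)" for d
    have W: "W d \<in> carrier (series VP)" if "d \<in> bas R" for d
      unfolding W_def carrier_series[of "Abs_fps _"] fps_nth_Abs_fps
      by (intro allI VP_comb V.finite_Basis carrier_seriesD[OF Dc[OF _ that]])
    have WP: "fps_nth (W d) n h q = (\<Sum>c\<in>bas R. mat (ginv g) c d * fps_nth (?P c) n h q)" if d: "d \<in> bas R" for d n h q
      using inv_ops_components[OF carrier_seriesD[OF D] b d] by (simp add: W_def)
    have "co b (?f (ac q g)) = (\<Sum>c\<in>bas R. fps_nth (coeffwise (pull_fun PB g) (?X b c)) n q)"
      by (simp add: co_vlmod_sections[OF b] pull_fun_def)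
    also have "\<dots> = (\<Sum>c\<in>bas R. \<Sum>d\<in>bas R. mat (ginv g) c d * fps_nth (vl (?P c) (scomp d s)) n q)"
    proof (rule sum.cong[OF refl])
      fix c assume c: "c \<in> bas R"
      have p: "coeffwise (pull_fun PB g) (scomp c s) \<in> carrier (series CP)"
        by (rule coeffwise_closed[OF sc[OF c] pull_fun_closed])
      have "coeffwise (pull_fun PB g) (?X b c) = vl (?P c) (coeffwise (pull_fun PB g) (scomp c s))"
        by (rule Q_invariant[OF Dc[OF b c] sc[OF c]])
      moreover have "fps_nth (vl (?P c) (coeffwise (pull_fun PB g) (scomp c s))) n q =
          (\<Sum>d\<in>bas R. mat (ginv g) c d * fps_nth (vl (?P c) (scomp d s)) n q)"
        by (rule CP_linear_comb[OF ver_lmod_linear[OF P[OF c]] sc p scomp_pull[OF s]])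
      ultimately show "fps_nth (coeffwise (pull_fun PB g) (?X b c)) n q =
          (\<Sum>d\<in>bas R. mat (ginv g) c d * fps_nth (vl (?P c) (scomp d s)) n q)"
        by simp
    qed
    also have "\<dots> = (\<Sum>d\<in>bas R. \<Sum>c\<in>bas R. mat (ginv g) c d * fps_nth (vl (?P c) (scomp d s)) n q)"
      by (rule sum.swap)
    also have "\<dots> = (\<Sum>d\<in>bas R. \<Sum>e\<in>bas R. mat (ginv g) b e * fps_nth (?X e d) n q)"
    proof (rule sum.cong[OF refl])
      fix d assume d: "d \<in> bas R"
      note lin = ver_lmod_linear_left[OF sc[OF d]]
      have "fps_nth (vl (W d) (scomp d s)) n q =
          (\<Sum>c\<in>bas R. mat (ginv g) c d * fps_nth (vl (?P c) (scomp d s)) n q)"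
        by (rule VP_linear_comb[OF lin P W[OF d] WP[OF d]])
      moreover have "fps_nth (vl (W d) (scomp d s)) n q =
          (\<Sum>e\<in>bas R. mat (ginv g) b e * fps_nth (?X e d) n q)"
        by (rule VP_linear_comb[OF lin Dc[OF _ d] W[OF d]]) (simp_all add: W_def d)
      ultimately show "(\<Sum>c\<in>bas R. mat (ginv g) c d * fps_nth (vl (?P c) (scomp d s)) n q) =
          (\<Sum>e\<in>bas R. mat (ginv g) b e * fps_nth (?X e d) n q)"
        by simp
    qed
    also have "\<dots> = (\<Sum>e\<in>bas R. \<Sum>d\<in>bas R. mat (ginv g) b e * fps_nth (?X e d) n q)"
      by (rule sum.swap)
    also have "\<dots> = (\<Sum>e\<in>bas R. mat (ginv g) b e * co e (?f q))"
      by (intro sum.cong refl) (simp add: co_vlmod_sections sum_distrib_left)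
    also have "\<dots> = co b (rp (ginv g) (?f q))"
      by (rule co_rp_mat[symmetric])
    finally show "co b (?f (ac q g)) = co b (rp (ginv g) (?f q))" .
  qed
  ultimately show ?thesis by (simp add: Gam_iff)
qed

lemma sec_lmod_closed:
  assumes "D \<in> carrier (series InvOps)" "s \<in> carrier (series SecE)"
  shows "slmod D s \<in> carrier (series SecE)"
  using vlmod_Gam[OF assms] by (simp add: carrier_series sec_lmod_def fun_to_sec_sections)

lemma sec_to_fun_sec_lmod:
  assumes "D \<in> carrier (series InvOps)" "s \<in> carrier (series SecE)"
  shows "coeffwise (to_fun) (slmod D s) = vlmod PB Q R D (coeffwise (to_fun) s)"
  using vlmod_Gam[OF assms] by (intro fps_ext) (simp add: sec_lmod_def)

lemma scomp_sec_lmod: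
  assumes "D \<in> carrier (series InvOps)" "s \<in> carrier (series SecE)" "b \<in> bas R"
  shows "fps_nth (scomp b (slmod D s)) n q =
    (\<Sum>c\<in>bas R. fps_nth (vl (dcomp b c D) (scomp c s)) n q)"
  unfolding scomp_def[of b] sec_to_fun_sec_lmod[OF assms(1,2)] coeffwise_nth
  by (simp add: vcomp_def co_vlmod_sections[OF assms(3)])

lemma linear_map_compose:
  "linear_map L M T \<Longrightarrow> linear_map M N T' \<Longrightarrow> linear_map L N (\<lambda>x. T' (T x))"
  by (auto simp: linear_map_def Pi_iff)

lemma sec_lmod_bilinear:
  "bilinear_map (series InvOps) (series SecE) (series SecE) (slmod)"
  unfolding bilinear_map_def
proof (intro conjI ballI)
  fix s assume s: "s \<in> carrier (series SecE)"
  show "linear_map (series InvOps) (series SecE) (\<lambda>D. slmod D s)"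
  proof (rule linear_map_componentsI[OF Inv.cmodule sec_lmod_closed[OF _ s]], assumption)
    fix b assume b: "b \<in> bas R"
    show "linear_map (series InvOps) (series CP) (\<lambda>D. scomp b (slmod D s))"
    proof (rule linear_map_sumI[OF Inv.cmodule V.finite_Basis _ scomp_sec_lmod[OF _ s b]])
      show "linear_map (series InvOps) (series CP) (\<lambda>D. vl (dcomp b c D) (scomp c s))"
        if "c \<in> bas R" for c
        by (rule linear_map_compose[OF dcomp_linear[OF b that] ver_lmod_linear_left[OF scomp_closed[OF that s]]])
    qed
  qed
next
  fix D assume D: "D \<in> carrier (series InvOps)"
  show "linear_map (series SecE) (series SecE) (slmod D)"
  proof (rule linear_map_componentsI[OF Sec.cmodule sec_lmod_closed[OF D]], assumption)
    fix b assume b: "b \<in> bas R"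
    show "linear_map (series SecE) (series CP) (\<lambda>s. scomp b (slmod D s))"
    proof (rule linear_map_sumI[OF Sec.cmodule V.finite_Basis _ scomp_sec_lmod[OF D _ b]])
      show "linear_map (series SecE) (series CP) (\<lambda>s. vl (dcomp b c D) (scomp c s))"
        if "c \<in> bas R" for c
        by (rule linear_map_compose[OF scomp_linear[OF that] ver_lmod_linear[OF dcomp_closed[OF b that D]]])
    qed
  qed
qed

lemma vlmod_lowest:
  assumes D: "D \<in> carrier (series InvOps)" and s: "s \<in> carrier (series SecE)"
  shows "fps_nth (vlmod PB Q R D (coeffwise (to_fun) s)) 0 = fps_nth D 0 (to_fun (fps_nth s 0))"
proof (rule ext, rule co_eqI)
  fix q b assume b: "b \<in> bas R"
  have "to_fun (fps_nth s 0) \<in> VF"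
    using sec_to_fun_Gam[OF carrier_seriesD[OF s]] by (simp add: Gam_iff)
  then have "co b (fps_nth D 0 (to_fun (fps_nth s 0)) q) =
      (\<Sum>c\<in>bas R. ocomp R b c (fps_nth D 0) (vcomp R c (to_fun (fps_nth s 0))) q)"
    using carrier_seriesD[OF D, of 0] b by (simp add: inv_ops_iff ver_end_ops_iff)
  moreover have "fps_nth (vl (dcomp b c D) (scomp c s)) 0 =
      ocomp R b c (fps_nth D 0) (vcomp R c (to_fun (fps_nth s 0)))" if "c \<in> bas R" for c
    using ver_lmod_lowest[OF dcomp_closed[OF b that D] scomp_closed[OF that s]] by (simp add: scomp_def)
  ultimately show "co b (fps_nth (vlmod PB Q R D (coeffwise (to_fun) s)) 0 q) =
      co b (fps_nth D 0 (to_fun (fps_nth s 0)) q)"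
    by (simp add: co_vlmod_sections[OF b])
qed

text \<open>Elementary endomorphisms act as Kronecker deltas, so only the middle index survives. By
  extension by zero this holds for every h, smooth or not, as equality of series of operators
  requires.\<close>

lemma ocomp_vstar:
  assumes D: "D \<in> carrier (series InvOps)" and E: "E \<in> carrier (series InvOps)"
    and b: "b \<in> bas R" and d: "d \<in> bas R"
  shows "fps_nth (dcomp b d (vstar PB Q R D E)) n h q =
    (\<Sum>c\<in>bas R. fps_nth (ver_star PB Q (dcomp b c D) (dcomp c d E)) n h q)"
proof -
  let ?X = "\<lambda>b c d. fps_nth (ver_star PB Q (dcomp b c D) (dcomp c d E)) n"
  have X: "?X b c d \<in> carrier DP" if "b \<in> bas R" "c \<in> bas R" "d \<in> bas R" for b c d
    using ver_star(1)[OF dcomp_closed[OF that(1,2) D] dcomp_closed[OF that(2,3) E]] by (intro VP_DP) simp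
  have "fps_nth (dcomp b d (vstar PB Q R D E)) n h q =
      (\<Sum>b'\<in>bas R. \<Sum>c\<in>bas R. \<Sum>d'\<in>bas R.
        co b (tensor_op PB R (?X b' c d') (elem_end R b' d') (\<lambda>q. sc (h q) d) q))"
    by (simp add: ocomp_nth vstar_def co_linear)
  also have "\<dots> = (\<Sum>b'\<in>bas R. \<Sum>c\<in>bas R. \<Sum>d'\<in>bas R. if d' = d then if b' = b then ?X b c d h q else 0 else 0)"
    using d by (intro sum.cong refl) (simp add: co_tensor_op_single X co_elem_end co_basis)
  also have "\<dots> = (\<Sum>b'\<in>bas R. if b' = b then \<Sum>c\<in>bas R. ?X b c d h q else 0)"
    using d V.finite_Basis by (intro sum.cong refl) (simp add: sum.delta)
  also have "\<dots> = (\<Sum>c\<in>bas R. ?X b c d h q)"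
    using b V.finite_Basis by (simp add: sum.delta)
  finally show ?thesis .
qed

text \<open>Matrix multiplication: each scalar product of components acts by composition, and the
  sums over the two inner indices are interchanged.\<close>

lemma sec_lmod_vstar:
  assumes D: "D \<in> carrier (series InvOps)" and E: "E \<in> carrier (series InvOps)"
    and s: "s \<in> carrier (series SecE)"
  shows "slmod (vstar PB Q R D E) s = slmod D (slmod E s)"
proof -
  let ?s = "coeffwise (to_fun) s"
  note Es = sec_lmod_closed[OF E s]
  have "vlmod PB Q R (vstar PB Q R D E) ?s = vlmod PB Q R D (vlmod PB Q R E ?s)"
  proof (intro fps_ext ext co_eqI)
    fix n q b assume b: "b \<in> bas R"
    let ?Y = "\<lambda>c d. vl (dcomp c d E) (scomp d s)"
    have Y: "?Y c d \<in> carrier (series CP)" if "c \<in> bas R" "d \<in> bas R" for c d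
      by (rule ver_lmod_closed[OF dcomp_closed[OF that E] scomp_closed[OF that(2) s]])
    have "co b (fps_nth (vlmod PB Q R (vstar PB Q R D E) ?s) n q) =
        (\<Sum>d\<in>bas R. \<Sum>c\<in>bas R. fps_nth (vl (dcomp b c D) (?Y c d)) n q)"
      unfolding co_vlmod_sections[OF b]
    proof (rule sum.cong[OF refl])
      fix d assume d: "d \<in> bas R"
      let ?X = "\<lambda>c. ver_star PB Q (dcomp b c D) (dcomp c d E)"
      have X: "?X c \<in> carrier (series VP)" if "c \<in> bas R" for c
        by (rule ver_star(1)[OF dcomp_closed[OF b that D] dcomp_closed[OF that d E]])
      \<comment> \<open>The unit coefficients give the sum the shape expected by
        \<open>VP_comb\<close>.\<close>
      have "fps_nth (dcomp b d (vstar PB Q R D E)) n = (\<lambda>h q. \<Sum>c\<in>bas R. 1 * fps_nth (?X c) n h q)" for n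
        by (intro ext) (simp only: ocomp_vstar[OF D E b d] mult_1)
      then have Z: "dcomp b d (vstar PB Q R D E) \<in> carrier (series VP)"
        unfolding carrier_series[of "dcomp _ _ _"]
        by (simp only:) (intro allI VP_comb V.finite_Basis carrier_seriesD[OF X])
      have "fps_nth (vl (dcomp b d (vstar PB Q R D E)) (scomp d s)) n q =
          (\<Sum>c\<in>bas R. 1 * fps_nth (vl (?X c) (scomp d s)) n q)"
        by (rule VP_linear_comb[OF ver_lmod_linear_left[OF scomp_closed[OF d s]] X Z])
          (simp_all only: ocomp_vstar[OF D E b d] mult_1)
      then show "fps_nth (vl (dcomp b d (vstar PB Q R D E)) (scomp d s)) n q =
          (\<Sum>c\<in>bas R. fps_nth (vl (dcomp b c D) (?Y c d)) n q)"
        using ver_star(2)[OF dcomp_closed[OF b _ D] dcomp_closed[OF _ d E] scomp_closed[OF d s]] by simp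
    qed
    also have "\<dots> = (\<Sum>c\<in>bas R. \<Sum>d\<in>bas R. fps_nth (vl (dcomp b c D) (?Y c d)) n q)"
      by (rule sum.swap)
    also have "\<dots> = (\<Sum>c\<in>bas R. fps_nth (vl (dcomp b c D) (scomp c (slmod E s))) n q)"
    proof (rule sum.cong[OF refl])
      fix c assume c: "c \<in> bas R"
      have "fps_nth (vl (dcomp b c D) (scomp c (slmod E s))) n q =
          (\<Sum>d\<in>bas R. 1 * fps_nth (vl (dcomp b c D) (?Y c d)) n q)"
        by (rule CP_linear_comb[OF ver_lmod_linear[OF dcomp_closed[OF b c D]] Y[OF c] scomp_closed[OF c Es]])
          (simp_all only: scomp_sec_lmod[OF E s c] mult_1)
      then show "(\<Sum>d\<in>bas R. fps_nth (vl (dcomp b c D) (?Y c d)) n q) =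
          fps_nth (vl (dcomp b c D) (scomp c (slmod E s))) n q"
        by simp
    qed
    also have "\<dots> = co b (fps_nth (vlmod PB Q R D (vlmod PB Q R E ?s)) n q)"
      using co_vlmod_sections[OF b, of D "slmod E s"] by (simp only: sec_to_fun_sec_lmod[OF E s])
    finally show "co b (fps_nth (vlmod PB Q R (vstar PB Q R D E) ?s) n q) =
        co b (fps_nth (vlmod PB Q R D (vlmod PB Q R E ?s)) n q)" .
  qed
  then show ?thesis
    unfolding sec_lmod_def[of PB Q R "vstar PB Q R D E"] sec_lmod_def[of PB Q R D]
    by (simp only: sec_to_fun_sec_lmod[OF E s])
qed

subsection \<open>The right module structure on sections\<close>

context
  fixes a assumes a: "a \<in> carrier (series CM)"
begin

lemma co_vrmod_sections:
  "b \<in> bas R \<Longrightarrow> co b (fps_nth (vrmod PB \<rho> R (coeffwise (to_fun) s) a) n q) =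
    fps_nth (rm (scomp b s) a) n q"
  by (simp add: vrmod_def co_sum_basis scomp_def)

text \<open>The right action on P commutes with pullback, and for fixed a it is linear; it therefore
  respects the matrix relation between the translated components of s.\<close>

lemma vrmod_Gam:
  assumes s: "s \<in> carrier (series SecE)"
  shows "fps_nth (vrmod PB \<rho> R (coeffwise (to_fun) s) a) n \<in> Gam" (is "?f \<in> Gam")
proof -
  have sc: "scomp c s \<in> carrier (series CP)" if "c \<in> bas R" for c
    using that s by (rule scomp_closed)
  have "?f \<in> VF"
    unfolding vfns_iff
  proof
    fix b assume b: "b \<in> bas R"
    have "fps_nth (rm (scomp b s) a) n \<in> carrier CP"
      using rmod_closed[OF sc[OF b] a] by simp
    then show "smooth_P UNIV (\<lambda>q. co b (?f q))"
      by (simp only: co_vrmod_sections[OF b] CP_iff)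
  qed
  moreover have "equivariant ?f"
    unfolding equivariant_def
  proof (intro allI co_eqI)
    fix q g b assume b: "b \<in> bas R"
    have p: "coeffwise (pull_fun PB g) (scomp b s) \<in> carrier (series CP)"
      by (rule coeffwise_closed[OF sc[OF b] pull_fun_closed])
    have "co b (?f (ac q g)) = fps_nth (coeffwise (pull_fun PB g) (rm (scomp b s) a)) n q"
      by (simp add: co_vrmod_sections[OF b] pull_fun_def)
    also have "\<dots> = fps_nth (rm (coeffwise (pull_fun PB g) (scomp b s)) a) n q"
      by (simp only: rho_invariant[OF sc[OF b] a])
    also have "\<dots> = (\<Sum>d\<in>bas R. mat (ginv g) b d * fps_nth (rm (scomp d s) a) n q)"
      by (rule CP_linear_comb[OF rmod_linear[OF a] sc p scomp_pull[OF s]])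
    also have "\<dots> = co b (rp (ginv g) (?f q))"
      by (simp add: co_rp_mat[of b "ginv g" "?f q"] co_vrmod_sections)
    finally show "co b (?f (ac q g)) = co b (rp (ginv g) (?f q))" .
  qed
  ultimately show ?thesis by (simp add: Gam_iff)
qed

lemma sec_rmod_closed:
  assumes "s \<in> carrier (series SecE)"
  shows "srmod s a \<in> carrier (series SecE)"
  using vrmod_Gam[OF assms] by (simp add: carrier_series sec_rmod_def fun_to_sec_sections)

lemma scomp_sec_rmod:
  assumes "s \<in> carrier (series SecE)" "b \<in> bas R"
  shows "scomp b (srmod s a) = rm (scomp b s) a"
  using vrmod_Gam[OF assms(1)]
  by (intro fps_ext ext) (simp add: scomp_nth sec_rmod_def co_vrmod_sections[OF assms(2)])

lemma sec_rmod_linear: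
  "linear_map (series SecE) (series SecE) (\<lambda>s. srmod s a)"
proof (rule linear_map_componentsI[OF Sec.cmodule sec_rmod_closed], assumption)
  show "linear_map (series SecE) (series CP) (\<lambda>s. scomp b (srmod s a))"
    if "b \<in> bas R" for b
    by (rule linear_map_cong[OF linear_map_compose[OF scomp_linear[OF that] rmod_linear[OF a]] Sec.cmodule])
      (simp add: scomp_sec_rmod that)
qed

lemma sec_rmod_lowest:
  assumes s: "s \<in> carrier (series SecE)"
  shows "fps_nth (srmod s a) 0 = (\<lambda>m. fps_nth a 0 m \<odot>\<^bsub>Fib m\<^esub> fps_nth s 0 m)"
proof -
  have s0: "fps_nth s 0 \<in> carrier SecE" using s by simp
  have "fps_nth (vrmod PB \<rho> R (coeffwise (to_fun) s) a) 0 =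
      (\<lambda>q. sc (fps_nth a 0 (pr q)) (to_fun (fps_nth s 0) q))"
    by (rule ext, rule co_eqI)
      (simp add: co_vrmod_sections rmod_lowest[OF scomp_closed[OF _ s] a] scomp_nth co_linear mult.commute)
  then have "fps_nth (srmod s a) 0 =
      to_sec (\<lambda>q. sc (fps_nth a 0 (pr q)) (to_fun (fps_nth s 0) q))"
    by (simp add: sec_rmod_def)
  then show ?thesis
    by (simp only: fun_to_sec_ops(2)[OF sec_to_fun_Gam[OF s0]] fun_to_sec_inverse[OF s0])
qed

text \<open>In components this is \<open>ver_lmod_rmod\<close>, summed with the help of linearity of
  the right action.\<close>

lemma sec_lmod_sec_rmod:
  assumes D: "D \<in> carrier (series InvOps)" and s: "s \<in> carrier (series SecE)"
  shows "slmod D (srmod s a) = srmod (slmod D s) a"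
proof (rule scomp_eqI)
  note Ds = sec_lmod_closed[OF D s]
  show "slmod D (srmod s a) \<in> carrier (series SecE)"
    by (rule sec_lmod_closed[OF D sec_rmod_closed[OF s]])
  show "srmod (slmod D s) a \<in> carrier (series SecE)"
    by (rule sec_rmod_closed[OF Ds])
  fix b assume b: "b \<in> bas R"
  show "scomp b (slmod D (srmod s a)) = scomp b (srmod (slmod D s) a)"
  proof (intro fps_ext ext)
    fix n q
    let ?X = "\<lambda>c. vl (dcomp b c D) (scomp c s)"
    have X: "?X c \<in> carrier (series CP)" if "c \<in> bas R" for c
      by (rule ver_lmod_closed[OF dcomp_closed[OF b that D] scomp_closed[OF that s]])
    have "fps_nth (scomp b (slmod D (srmod s a))) n q =
        (\<Sum>c\<in>bas R. 1 * fps_nth (rm (?X c) a) n q)"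
      by (simp add: scomp_sec_lmod[OF D sec_rmod_closed[OF s] b] scomp_sec_rmod[OF s]
          ver_lmod_rmod[OF dcomp_closed[OF b _ D] scomp_closed[OF _ s] a])
    also have "\<dots> = fps_nth (rm (scomp b (slmod D s)) a) n q"
      by (rule CP_linear_comb[OF rmod_linear[OF a] X scomp_closed[OF b Ds], symmetric])
        (simp_all only: scomp_sec_lmod[OF D s b] mult_1)
    finally show "fps_nth (scomp b (slmod D (srmod s a))) n q =
        fps_nth (scomp b (srmod (slmod D s) a)) n q"
      by (simp only: scomp_sec_rmod[OF Ds b])
  qed
qed

end

subsection \<open>Lowest order\<close>

text \<open>Multiplication commutes with all multiplications, so it has order zero and is vertical;
  the conditional implements extension by zero.\<close>

lemma mult_op_VP:
  assumes a: "smooth_P UNIV a"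
  shows "(\<lambda>h q. if h \<in> carrier CP then a q * h q else 0) \<in> carrier VP" (is "?D \<in> _")
proof -
  have closed: "(\<lambda>q. a q * h q) \<in> carrier CP" if "h \<in> carrier CP" for h
    using a that by (simp add: CP_iff smooth_fun_mult[OF charted_P open_UNIV])
  have closed_sc: "(\<lambda>q. c * h q) \<in> carrier CP" if "h \<in> carrier CP" for c h
    using that by (simp add: CP_iff smooth_fun_mult[OF charted_P open_UNIV] smooth_fun_const)
  have closed_add: "(\<lambda>q. f q + h q) \<in> carrier CP" if "f \<in> carrier CP" "h \<in> carrier CP" for f h
    using that by (simp add: CP_iff smooth_fun_add[OF charted_P open_UNIV])
  have "linear_map CP CP ?D"
    unfolding smooth_fns_linear_iff[OF charted_P]
  proof (intro conjI ballI allI)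
    fix f c assume f: "f \<in> carrier CP"
    show "?D f \<in> carrier CP" using f closed[OF f] by simp
    show "?D (\<lambda>q. c * f q) = (\<lambda>q. c * ?D f q)"
      by (simp only: f closed_sc[OF f] if_True mult.left_commute[of "a _" c])
    fix h assume h: "h \<in> carrier CP"
    show "?D (\<lambda>q. f q + h q) = (\<lambda>q. ?D f q + ?D h q)"
      using f h closed_add[OF f h] by (simp add: distrib_left)
  qed
  moreover have "diff_order id (carrier CP) 0 ?D"
    unfolding diff_order.simps
  proof (intro ballI)
    fix b f assume b: "b \<in> carrier CP" and f: "f \<in> carrier CP"
    show "?D (\<lambda>x. b x * f x) = (\<lambda>y. b (id y) * ?D f y)"
      by (simp only: f smooth_fns_mult[OF charted_P b f] if_True id_apply mult.left_commute[of "a _" "b _"])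
  qed
  moreover have "(\<lambda>q. f q * b (pr q)) \<in> carrier CP" if "f \<in> carrier CP" "b \<in> carrier CM" for f b
    using that smooth_pullback[OF open_UNIV, of b]
    by (simp add: CP_iff smooth_fns_iff smooth_fun_mult[OF charted_P open_UNIV])
  ultimately show ?thesis
    unfolding ver_ops_iff diff_ops_iff[OF charted_P]
    by (intro conjI exI[of _ 0] ballI allI impI) (assumption | simp only: if_True if_False mult.assoc)+
qed

definition mult_op :: "('m \<Rightarrow> ('p \<times> 'v) set \<Rightarrow> ('p \<times> 'v) set) \<Rightarrow> ('p \<Rightarrow> 'v) \<Rightarrow> 'p \<Rightarrow> 'v" where
  "mult_op A s q = (if s \<in> VF then end_fun A q (s q) else 0)"

text \<open>The components are multiplications by the smooth matrix entries of
  \<open>end_fun A\<close>, and equivariance of \<open>end_fun\<close> is invariance of the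
  operator.\<close>

lemma mult_op_inv_ops:
  assumes A: "A \<in> carrier EndE"
  shows "mult_op A \<in> carrier InvOps"
  unfolding inv_ops_iff ver_end_ops_iff
proof (intro conjI ballI allI impI)
  have oc: "ocomp R b c (mult_op A) = (\<lambda>h q. if h \<in> carrier CP then co b (end_fun A q c) * h q else 0)"
    if "c \<in> bas R" for b c
    using that by (intro ext) (simp add: ocomp_nth mult_op_def single_vfns end_fun_linear[OF A] co_linear mult.commute)
  show "ocomp R b c (mult_op A) \<in> carrier VP" if "b \<in> bas R" "c \<in> bas R" for b c
    unfolding oc[OF that(2)] by (rule mult_op_VP[OF smooth_end_fun[OF A that]])
  fix s assume s: "s \<in> VF"
  show "co b (mult_op A s q) = (\<Sum>c\<in>bas R. ocomp R b c (mult_op A) (vcomp R c s) q)" if b: "b \<in> bas R" for b q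
  proof -
    have "mult_op A s q = end_fun A q (\<Sum>c\<in>bas R. sc (co c (s q)) c)"
      using s by (simp add: mult_op_def co_expand)
    then have "co b (mult_op A s q) = (\<Sum>c\<in>bas R. co c (s q) * co b (end_fun A q c))"
      by (simp only: end_fun_linear[OF A] co_linear)
    also have "\<dots> = (\<Sum>c\<in>bas R. ocomp R b c (mult_op A) (vcomp R c s) q)"
      using s by (intro sum.cong refl) (simp add: oc vfns_vcomp, simp add: vcomp_def mult.commute)
    finally show ?thesis .
  qed
next
  show "mult_op A s = (\<lambda>q. 0)" if "s \<notin> VF" for s
    using that by (intro ext) (simp add: mult_op_def)
  show "vact_op PB R g (mult_op A) = mult_op A" for g
  proof (intro ext)
    fix s q
    have "vact PB R (ginv g) s (ac q g) = rp (ginv g) (s q)"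
      by (simp add: vact_nth ac_ac)
    then show "vact_op PB R g (mult_op A) s q = mult_op A s q"
      by (simp add: vact_op_nth mult_op_def vact_vfns_iff end_fun_ac[OF A])
  qed
qed

text \<open>In lowest order the deformed left action is plain application, and pointwise application
  of \<open>end_fun A\<close> on P corresponds to that of A on M.\<close>

lemma sec_lmod_mult_op:
  assumes A: "A \<in> carrier EndE" and s: "s \<in> carrier SecE"
  shows "fps_nth (slmod (const_series InvOps (mult_op A)) (const_series SecE s)) 0 =
    (\<lambda>m. A m (s m))"
proof -
  let ?D = "const_series InvOps (mult_op A)" and ?s = "const_series SecE s"
  have "mult_op A (to_fun s) = (\<lambda>q. end_fun A q (to_fun s q))"
    using sec_to_fun_Gam[OF s] by (intro ext) (simp add: mult_op_def Gam_iff)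
  also have "\<dots> = to_fun (\<lambda>m. A m (s m))"
    using end_fun_fib_vec[OF A sections_fibre[OF s]] by (intro ext) (simp add: sec_to_fun_def)
  finally have "fps_nth (slmod ?D ?s) 0 = to_sec (to_fun (\<lambda>m. A m (s m)))"
    using vlmod_lowest[of ?D ?s] mult_op_inv_ops[OF A] s by (simp add: sec_lmod_def)
  then show ?thesis
    using A s by (simp add: fun_to_sec_to_fun sections_fibre)
qed

text \<open>Since T commutes with the formal parameter, the constant term of \<open>T s\<close>
  depends on that of s alone. In lowest order the right action is multiplication by a function, so
  commuting with it makes this induced map linear over functions on M, as
  \<open>sections_tensorial\<close> demands.\<close>

lemma series_tensorial:
  assumes T: "linear_map (series SecE) (series SecE) T"
    and com: "\<And>s a. s \<in> carrier (series SecE) \<Longrightarrow> a \<in> carrier (series CM) \<Longrightarrow>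
      T (srmod s a) = srmod (T s) a"
  shows "\<exists>A\<in>carrier EndE. \<forall>s\<in>carrier (series SecE).
    fps_nth (T s) 0 = (\<lambda>m. A m (fps_nth s 0 m))"
proof -
  let ?S = "SecE"
  interpret CM: cmodule_embedding "(*)" CM "\<lambda>f x. f x" by (rule smooth_fns_embedding[OF charted_M])
  interpret CMm: cmodule CM by (rule CM.cmodule)
  note Tc = linear_map_closed[OF T]
  define T0 where "T0 s = fps_nth (T (const_series ?S s)) 0" for s
  have T0: "fps_nth (T x) 0 = T0 (fps_nth x 0)" if x: "x \<in> carrier (series ?S)" for x
  proof -
    have x0: "const_series ?S (fps_nth x 0) \<in> carrier (series ?S)" using x by simp
    have "T x = T (const_series ?S (fps_nth x 0)) \<oplus>\<^bsub>series ?S\<^esub> T (fps_X \<odot>\<^bsub>series ?S\<^esub> shift_down x)"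
      using linear_map_add[OF T x0, of "fps_X \<odot>\<^bsub>series ?S\<^esub> shift_down x"] Secm.series_decompose[OF x] x
      by (simp add: Secm.smult_X)
    also have "T (fps_X \<odot>\<^bsub>series ?S\<^esub> shift_down x) = shift_up ?S (T (shift_down x))"
      using linear_map_smult[OF T, of "shift_down x" fps_X] Tc x by (simp add: Secm.smult_X)
    finally show ?thesis using Tc[OF x0] by (simp add: T0_def)
  qed
  have "\<exists>A\<in>carrier EndE. \<forall>s\<in>carrier ?S. T0 s = (\<lambda>m. A m (s m))"
  proof (rule sections_tensorial)
    show "T0 s \<in> carrier ?S" if "s \<in> carrier ?S" for s
      using that Tc by (simp add: T0_def)
    show "T0 (s \<oplus>\<^bsub>?S\<^esub> t) = T0 s \<oplus>\<^bsub>?S\<^esub> T0 t" if "s \<in> carrier ?S" "t \<in> carrier ?S" for s t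
      using T0[of "const_series ?S s \<oplus>\<^bsub>series ?S\<^esub> const_series ?S t"]
        linear_map_add[OF T, of "const_series ?S s" "const_series ?S t"] that
      by (simp add: T0_def)
    show "T0 (\<lambda>m. a m \<odot>\<^bsub>Fib m\<^esub> s m) = (\<lambda>m. a m \<odot>\<^bsub>Fib m\<^esub> T0 s m)"
      if a: "smooth_M UNIV a" and s: "s \<in> carrier ?S" for a s
    proof -
      have a': "const_series CM a \<in> carrier (series CM)"
        using a by (simp add: smooth_fns_iff)
      have s': "const_series ?S s \<in> carrier (series ?S)" using s by simp
      have "T0 (\<lambda>m. a m \<odot>\<^bsub>Fib m\<^esub> s m) =
          fps_nth (T (srmod (const_series ?S s) (const_series CM a))) 0"
        using T0[OF sec_rmod_closed[OF a' s']] sec_rmod_lowest[OF a' s'] by simp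
      also have "\<dots> = (\<lambda>m. a m \<odot>\<^bsub>Fib m\<^esub> T0 s m)"
        using sec_rmod_lowest[OF a' Tc[OF s']] by (simp add: com[OF s' a'] T0_def)
      finally show ?thesis .
    qed
  qed
  then obtain A where A: "A \<in> carrier EndE"
    and T0A: "\<And>s. s \<in> carrier ?S \<Longrightarrow> T0 s = (\<lambda>m. A m (s m))" by blast
  show ?thesis
    by (intro bexI[OF _ A] ballI) (simp only: T0 T0A carrier_seriesD)
qed

lemma bimodule_quotient:
  assumes "deformed_bimodule PB \<rho> R starE lmodE"
  shows "\<exists>\<phi>. algebra_hom (series InvOps) (vstar PB Q R) (series EndE) starE \<phi> \<and>
    \<phi> ` carrier (series InvOps) = carrier (series EndE) \<and>
    (\<forall>D\<in>carrier (series InvOps). \<forall>s\<in>carrier (series SecE).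
      slmod D s = lmodE (\<phi> D) s)"
proof -
  let ?Ends = "series EndE" and ?Secs = "series SecE"
  have starE: "bilinear_map ?Ends ?Ends ?Ends starE"
    and lmodE: "bilinear_map ?Ends ?Secs ?Secs lmodE"
    and lmodE_starE: "\<And>A B s. A \<in> carrier ?Ends \<Longrightarrow> B \<in> carrier ?Ends \<Longrightarrow> s \<in> carrier ?Secs \<Longrightarrow>
      lmodE (starE A B) s = lmodE A (lmodE B s)"
    and lmodE_lowest: "\<And>A s. A \<in> carrier ?Ends \<Longrightarrow> s \<in> carrier ?Secs \<Longrightarrow>
      fps_nth (lmodE A s) 0 = (\<lambda>m. fps_nth A 0 m (fps_nth s 0 m))"
    and lmodE_rmod: "\<And>A s a. A \<in> carrier ?Ends \<Longrightarrow> s \<in> carrier ?Secs \<Longrightarrow> a \<in> carrier (series CM) \<Longrightarrow>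
      lmodE A (srmod s a) = srmod (lmodE A s) a"
    using assms unfolding deformed_bimodule_def Let_def by blast+
  interpret deformed_commutant "InvOps" "EndE" "SecE" "slmod" lmodE
    "\<lambda>A s m. A m (s m)" "\<lambda>a s. srmod s a" "carrier (series CM)"
  proof (intro deformed_commutant.intro[OF Inv.cmodule End.cmodule Sec.cmodule] deformed_commutant_axioms.intro)
    show "bilinear_map (series InvOps) ?Secs ?Secs (slmod)"
      by (rule sec_lmod_bilinear)
    show "bilinear_map ?Ends ?Secs ?Secs lmodE"
      by (rule lmodE)
    show "linear_map ?Secs ?Secs (\<lambda>s. srmod s a)" if "a \<in> carrier (series CM)" for a
      using that by (rule sec_rmod_linear)
    show "slmod D (srmod s a) = srmod (slmod D s) a"
      if "D \<in> carrier (series InvOps)" "s \<in> carrier ?Secs" "a \<in> carrier (series CM)" for D s a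
      by (rule sec_lmod_sec_rmod[OF that(3,1,2)])
    show "lmodE A (srmod s a) = srmod (lmodE A s) a"
      if "A \<in> carrier ?Ends" "s \<in> carrier ?Secs" "a \<in> carrier (series CM)" for A s a
      by (rule lmodE_rmod[OF that])
    show "fps_nth (lmodE A s) 0 = (\<lambda>m. fps_nth A 0 m (fps_nth s 0 m))"
      if "A \<in> carrier ?Ends" "s \<in> carrier ?Secs" for A s
      by (rule lmodE_lowest[OF that])
    show "\<exists>e\<in>carrier EndE. \<forall>s\<in>carrier ?Secs. fps_nth (T s) 0 = (\<lambda>m. e m (fps_nth s 0 m))"
      if "linear_map ?Secs ?Secs T"
        "\<And>s a. s \<in> carrier ?Secs \<Longrightarrow> a \<in> carrier (series CM) \<Longrightarrow>
          T (srmod s a) = srmod (T s) a" for T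
      by (rule series_tensorial[OF that(1)]) (rule that(2))
    show "e = e'" if "e \<in> carrier EndE" "e' \<in> carrier EndE"
      "\<And>x. x \<in> carrier SecE \<Longrightarrow> (\<lambda>m. e m (x m)) = (\<lambda>m. e' m (x m))" for e e'
      by (rule end_sections_faithful[OF that(1,2)]) (rule that(3))
    show "\<exists>d\<in>carrier InvOps. \<forall>x\<in>carrier SecE.
        fps_nth (slmod (const_series InvOps d) (const_series SecE x)) 0 =
        (\<lambda>m. e m (x m))" if "e \<in> carrier EndE" for e
      by (intro bexI[OF _ mult_op_inv_ops[OF that]] ballI sec_lmod_mult_op[OF that])
  qed
  have "algebra_hom (series InvOps) (vstar PB Q R) ?Ends starE \<phi>"
    unfolding algebra_hom_def
  proof (intro conjI ballI phi_linear)
    fix D E assume D: "D \<in> carrier (series InvOps)" and E: "E \<in> carrier (series InvOps)"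
    have "linear_map ?Ends ?Ends (starE (\<phi> D))"
      using starE phi(1)[OF D] unfolding bilinear_map_def by blast
    then have closed: "starE (\<phi> D) (\<phi> E) \<in> carrier ?Ends"
      using phi(1)[OF E] by (rule linear_map_closed)
    show "\<phi> (vstar PB Q R D E) = starE (\<phi> D) (\<phi> E)"
      by (rule phi_mult[OF sec_lmod_vstar[OF D E] lmodE_starE[OF phi(1)[OF D] phi(1)[OF E]] D E closed])
  qed
  then show ?thesis
    by (intro exI[of _ \<phi>] conjI ballI phi_surj phi(2))
qed

end

theorem theorem6p4:
  fixes PB :: "('p::{t2_space,second_countable_topology}, 'm::{t2_space,second_countable_topology},
      'g::{t2_space,second_countable_topology},
      'ep::real_inner, 'em::real_inner, 'eg::real_inner) pfb"
    and R :: "('g, 'v::ab_group_add) grep"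
    and C :: "nat \<Rightarrow> ('m \<Rightarrow> complex) \<Rightarrow> ('m \<Rightarrow> complex) \<Rightarrow> 'm \<Rightarrow> complex"
    and \<rho> :: "nat \<Rightarrow> ('p \<Rightarrow> complex) \<Rightarrow> ('m \<Rightarrow> complex) \<Rightarrow> 'p \<Rightarrow> complex"
    and Q :: "nat \<Rightarrow> (('p \<Rightarrow> complex) \<Rightarrow> 'p \<Rightarrow> complex) \<Rightarrow> ('p \<Rightarrow> complex) \<Rightarrow> 'p \<Rightarrow> complex"
  assumes "principal_bundle PB"
    and "star_product (base PB) C"
    and "bundle_quantization PB C \<rho>"
    and "vertical_bimodule PB \<rho> Q"
    and "representation_of PB R"
  shows "\<forall>starE lmodE. deformed_bimodule PB \<rho> R starE lmodE \<longrightarrow>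
    (\<exists>\<phi>. algebra_hom (series (inv_ops PB R)) (vstar PB Q R) (series (end_sections PB R)) starE \<phi> \<and>
         \<phi> ` carrier (series (inv_ops PB R)) = carrier (series (end_sections PB R)) \<and>
         (\<forall>D\<in>carrier (series (inv_ops PB R)). \<forall>s\<in>carrier (series (sections PB R)).
            sec_lmod PB Q R D s = lmodE (\<phi> D) s))"
proof -
  interpret quantized_bundle PB R C \<rho> Q
    using assms by unfold_locales
  show ?thesis using bimodule_quotient by blast
qed

end
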